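(* Let $m\ge2$, $\vec\alpha\in U_m$, $1\le i\le m$, and let $\epsilon=\{\epsilon_I\}_{I\in\mathcal{D}}$ satisfy $\|\epsilon\|_\infty=\sup_{I\in\mathcal{D}}|\epsilon_I|<\infty$. If $b\in BMO^d\cap L^p(\mathbb{R})$ for some $1<p<\infty$, then for all $1<p_1,\dots,p_m,r<\infty$ with $\sum_{j=1}^m\frac1{p_j}=\frac1r$ there is a constant $C$ (independent of $b$ and the $f_j$) such that $$\|[b,T_\epsilon^{\vec\alpha}]_i(f_1,\dots,f_m)\|_{L^r}\le C\|b\|_{BMO^d}\prod_{j=1}^m\|f_j\|_{L^{p_j}}$$ for all $f_j\in L^{p_j}$.
   Context: $\mathcal{D}=\{[k2^{-n},(k+1)2^{-n}):k,n\in\mathbb{Z}\}$ is the standard dyadic grid on $\mathbb{R}$. For $I\in\mathcal{D}$ with left and right halves $I_-,I_+$, the Haar function is $h_I=|I|^{-1/2}(\mathbf{1}_{I_+}-\mathbf{1}_{I_-})$, and $h_I^k$ denotes its pointwise $k$-th power. $\langle f,g\rangle=\int_{\mathbb{R}}fg$ and $\langle f\rangle_I=\frac{1}{|I|}\int_I f$. For a function $f$ and $I\in\mathcal{D}$: $f(I,0)=\langle f,h_I\rangle$ and $f(I,1)=\langle f\rangle_I$. For $\vec\alpha\in\{0,1\}^m$, $\sigma(\vec\alpha)=\#\{j:\alpha_j=0\}$, and $U_m=\{0,1\}^m\setminus\{(1,\dots,1)\}$. $T_\epsilon^{\vec\alpha}(f_1,\dots,f_m)=\sum_{I\in\mathcal{D}}\epsilon_I\Big(\prod_{j=1}^m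 f_j(I,\alpha_j)\Big)h_I^{\sigma(\vec\alpha)}$. The $i$-th commutator with $b$ is $[b,T_\epsilon^{\vec\alpha}]_i(f_1,\dots,f_m)=T_\epsilon^{\vec\alpha}(f_1,\dots,f_{i-1},bf_i,f_{i+1},\dots,f_m)-b\,T_\epsilon^{\vec\alpha}(f_1,\dots,f_m)$. $BMO^d$ consists of locally integrable $b$ with $\|b\|_{BMO^d}=\sup_{I\in\mathcal{D}}\frac1{|I|}\int_I|b-\langle b\rangle_I|<\infty$. *)

theory Defs
  imports "HOL-Analysis.Analysis"
begin

text \<open>Dyadic intervals are indexed by pairs (k,n) of integers:
  dint (k,n) = [k 2^-n, (k+1) 2^-n).  This indexing is a bijection onto the standard dyadic grid.\<close>

definition dlen :: "int \<times> int \<Rightarrow> real" where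
  "dlen I = (2::real) powi (- snd I)"

definition dint :: "int \<times> int \<Rightarrow> real set" where
  "dint I = {real_of_int (fst I) * dlen I ..< real_of_int (fst I + 1) * dlen I}"

definition dleft :: "int \<times> int \<Rightarrow> int \<times> int" where
  "dleft I = (2 * fst I, snd I + 1)"

definition dright :: "int \<times> int \<Rightarrow> int \<times> int" where
  "dright I = (2 * fst I + 1, snd I + 1)"

definition haar :: "int \<times> int \<Rightarrow> real \<Rightarrow> real" where
  "haar I x = dlen I powr (-1/2) *
     (indicator (dint (dright I)) x - indicator (dint (dleft I)) x)"

definition coef :: "(real \<Rightarrow> real) \<Rightarrow> int \<times> int \<Rightarrow> nat \<Rightarrow> real" where
  "coef f I a = (if a = 0 then (\<integral>x. f x * haar I x \<partial>lborel)
                 else (1 / dlen I) * (LINT x : dint I | lborel. f x))"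

definition sigma :: "nat \<Rightarrow> (nat \<Rightarrow> nat) \<Rightarrow> nat" where
  "sigma m \<alpha> = card {j \<in> {1..m}. \<alpha> j = 0}"

text \<open>Exhausting increasing sequence of finite families of dyadic intervals:
  scales 2^-N \<le> |I| \<le> 2^N and I \<subseteq> [-2^N, 2^N).\<close>
definition dtrunc :: "nat \<Rightarrow> (int \<times> int) set" where
  "dtrunc N = {I. \<bar>snd I\<bar> \<le> int N \<and> dint I \<subseteq> {- ((2::real) ^ N) ..< 2 ^ N}}"

definition Tpart :: "(int \<times> int \<Rightarrow> real) \<Rightarrow> nat \<Rightarrow> (nat \<Rightarrow> nat) \<Rightarrow> (nat \<Rightarrow> real \<Rightarrow> real)
    \<Rightarrow> nat \<Rightarrow> real \<Rightarrow> real" where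
  "Tpart \<epsilon> m \<alpha> f N x =
     (\<Sum>I\<in>dtrunc N. \<epsilon> I * (\<Prod>j=1..m. coef (f j) I (\<alpha> j)) * haar I x ^ sigma m \<alpha>)"

text \<open>T_eps^alpha(f_1..f_m)(x) = sum over all dyadic I, understood as the pointwise limit of the
  truncated sums (set to 0 where the limit does not exist).\<close>
definition Top :: "(int \<times> int \<Rightarrow> real) \<Rightarrow> nat \<Rightarrow> (nat \<Rightarrow> nat) \<Rightarrow> (nat \<Rightarrow> real \<Rightarrow> real)
    \<Rightarrow> real \<Rightarrow> real" where
  "Top \<epsilon> m \<alpha> f x =
     (if convergent (\<lambda>N. Tpart \<epsilon> m \<alpha> f N x) then lim (\<lambda>N. Tpart \<epsilon> m \<alpha> f N x) else 0)"

definition commut :: "(real \<Rightarrow> real) \<Rightarrow> (int \<times> int \<Rightarrow> real) \<Rightarrow> nat \<Rightarrow> (nat \<Rightarrow> nat) \<Rightarrow> nat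
    \<Rightarrow> (nat \<Rightarrow> real \<Rightarrow> real) \<Rightarrow> real \<Rightarrow> real" where
  "commut b \<epsilon> m \<alpha> i f x =
     Top \<epsilon> m \<alpha> (f(i := (\<lambda>y. b y * f i y))) x - b x * Top \<epsilon> m \<alpha> f x"

definition in_Lp :: "real \<Rightarrow> (real \<Rightarrow> real) \<Rightarrow> bool" where
  "in_Lp p f \<longleftrightarrow> f \<in> borel_measurable lborel \<and> integrable lborel (\<lambda>x. \<bar>f x\<bar> powr p)"

definition Lp_norm :: "real \<Rightarrow> (real \<Rightarrow> real) \<Rightarrow> real" where
  "Lp_norm p f = (\<integral>x. \<bar>f x\<bar> powr p \<partial>lborel) powr (1 / p)"

definition bmo_osc :: "(real \<Rightarrow> real) \<Rightarrow> int \<times> int \<Rightarrow> real" where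
  "bmo_osc b I = (1 / dlen I) *
     (LINT x : dint I | lborel. \<bar>b x - (1 / dlen I) * (LINT y : dint I | lborel. b y)\<bar>)"

definition in_BMOd :: "(real \<Rightarrow> real) \<Rightarrow> bool" where
  "in_BMOd b \<longleftrightarrow> b \<in> borel_measurable lborel \<and>
     (\<forall>K. compact K \<longrightarrow> set_integrable lborel K b) \<and>
     bdd_above (range (bmo_osc b))"

definition bmo_norm :: "(real \<Rightarrow> real) \<Rightarrow> real" where
  "bmo_norm b = (SUP I. bmo_osc b I)"

end

theory Submission
  imports Defs
begin

text \<open>
  Pairing with a test function in a further slot turns the commutator into an (m+1)-linear form
  over the dyadic intervals in which at least two slots carry Haar coefficients and in which
  the symbol enters only through its oscillation: b may be replaced by b minus its average on the
  interval at hand. Up to the John--Nirenberg inequality everything then reduces to one principle: a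
  family of weights that is Carleson with respect to a function w can be summed against products of
  averages at the price of integrating w against maximal functions.
  Two Haar slots produce such a family, because of the Stein type estimate which controls
  the squared Haar coefficients weighted by a power s - 2 of the averages, 1 < s \<le> 2, by the
  integral of the s-th power. All these estimates follow by induction on the depth of a finite
  dyadic tree. The form bound gives the norm bound for the truncated operators by duality, and Fatou's lemma passes to the limit, which exists almost everywhere: the
  large scales decay geometrically, and at the small scales the square functions are finite
  almost everywhere, which suffices for a dyadic martingale transform by stopping and Kolmogorov's
  inequality.
\<close>

section \<open>Dyadic intervals and trees\<close>

text \<open>The obstacle is that no slot is tied to the exponent 2, so orthogonality of the Haar
  functions is of little help; the weight of exponent \<open>s - 2\<close> in the Stein estimate
  replaces it at every exponent above 1. That weight must be cancelled again, and each cancellation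
  passes through a maximal function, which is bounded only at strictly larger exponents. The
  bookkeeping of exponents serves to keep this strict gap. It comes from \<open>m \<ge> 2\<close>:
  the dual form has at least three slots, so the reciprocal exponents of any two add up to less than
  1, and all exponents can be lowered by a common factor.

  Every bound is proved on an arbitrary root interval, for every depth, and with normalised local
  norms. The conclusion of one estimate is therefore the Carleson hypothesis of the next, and the
  symbol can be treated as one more slot. Membership of the symbol in some \<open>L^q\<close> enters
  through the decay of the averages of \<open>b * f i\<close> at large scales, without which the
  limit defining the operator on the modified tuple is not under control.\<close>

lemma dlen_pos [simp]: "0 < dlen I"
  by (simp add: dlen_def)

lemma dlen_nonneg [simp]: "0 \<le> dlen I"
  using dlen_pos[of I] by linarith

lemma dlen_nonzero [simp]: "dlen I \<noteq> 0"
  using dlen_pos[of I] by linarith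

lemma dlen_child [simp]: "dlen (dleft I) = dlen I / 2" "dlen (dright I) = dlen I / 2"
  by (simp_all add: dlen_def dleft_def dright_def power_int_diff)

lemma snd_child [simp]: "snd (dleft I) = snd I + 1" "snd (dright I) = snd I + 1"
  by (simp_all add: dleft_def dright_def)

lemma dint_halves: "dint I = dint (dleft I) \<union> dint (dright I)"
  and dint_halves_disjoint: "dint (dleft I) \<inter> dint (dright I) = {}"
proof -
  have L: "dint (dleft I) = {real_of_int (fst I) * dlen I ..< (real_of_int (fst I) + 1/2) * dlen I}"
    unfolding dint_def dlen_child by (simp add: dleft_def field_simps)
  have R: "dint (dright I) = {(real_of_int (fst I) + 1/2) * dlen I ..< (real_of_int (fst I) + 1) * dlen I}"
    unfolding dint_def dlen_child by (simp add: dright_def algebra_simps)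
  have "real_of_int (fst I) * dlen I \<le> (real_of_int (fst I) + 1/2) * dlen I"
    "(real_of_int (fst I) + 1/2) * dlen I \<le> (real_of_int (fst I) + 1) * dlen I"
    by (intro mult_right_mono; simp)+
  then show "dint I = dint (dleft I) \<union> dint (dright I)"
    unfolding L R by (simp add: dint_def ivl_disj_un_two(3))
  show "dint (dleft I) \<inter> dint (dright I) = {}"
    unfolding L R by auto
qed

lemma dint_child_subset: "dint (dleft I) \<subseteq> dint I" "dint (dright I) \<subseteq> dint I"
  using dint_halves[of I] by auto

lemma dint_borel [measurable]: "dint I \<in> sets borel"
  by (simp add: dint_def)

lemma emeasure_dint: "emeasure lborel (dint I) = ennreal (dlen I)"
  by (simp add: dint_def algebra_simps)

lemma measure_dint [simp]: "measure lborel (dint I) = dlen I"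
  by (simp add: measure_def emeasure_dint)

text \<open>The interval of generation \<open>n\<close> through \<open>x\<close>. By
  \<open>mem_dint_iff\<close> membership becomes an equation between index pairs, and nestedness of
  the grid becomes a statement about parents.\<close>

definition dyad :: "int \<Rightarrow> real \<Rightarrow> int \<times> int" where
  "dyad n x = (\<lfloor>x * 2 powi n\<rfloor>, n)"

lemma snd_dyad [simp]: "snd (dyad n x) = n"
  by (simp add: dyad_def)

lemma mem_dint_iff: "x \<in> dint I \<longleftrightarrow> dyad (snd I) x = I"
proof -
  obtain k n where I: "I = (k, n)" by (cases I)
  have p: "(2::real) powi n > 0" by simp
  have e: "(2::real) powi (- n) = 1 / 2 powi n" by (simp add: power_int_minus field_simps)
  have "x \<in> dint I \<longleftrightarrow> real_of_int k \<le> x * 2 powi n \<and> x * 2 powi n < real_of_int k + 1"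
    using p by (simp add: I dint_def dlen_def e field_simps)
  also have "\<dots> \<longleftrightarrow> \<lfloor>x * 2 powi n\<rfloor> = k" by linarith
  finally show ?thesis by (simp add: I dyad_def)
qed

lemma mem_dint_dyad [simp]: "x \<in> dint (dyad n x)"
  by (simp add: mem_dint_iff)

lemma dyad_eqI: "x \<in> dint I \<Longrightarrow> snd I = n \<Longrightarrow> dyad n x = I"
  by (auto simp: mem_dint_iff)

lemma dint_nonempty: "\<exists>x. x \<in> dint I"
proof -
  have "real_of_int (fst I) * dlen I < real_of_int (fst I + 1) * dlen I" by simp
  then have "real_of_int (fst I) * dlen I \<in> dint I" by (simp add: dint_def)
  then show ?thesis ..
qed

lemma dyad_child_cases: "dyad (n + 1) x = dleft (dyad n x) \<or> dyad (n + 1) x = dright (dyad n x)"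
  using dint_halves[of "dyad n x"] mem_dint_dyad[of x n] mem_dint_iff[of x "dleft (dyad n x)"]
    mem_dint_iff[of x "dright (dyad n x)"] by auto

text \<open>The two child maps are injective with disjoint ranges, so a child determines its parent;
  points that share an interval share all its ancestors.\<close>

lemma dyad_coarsen_nat: "dyad (n + int k) x = dyad (n + int k) y \<Longrightarrow> dyad n x = dyad n y"
proof (induction k)
  case (Suc k)
  have e: "n + int (Suc k) = (n + int k) + 1" by simp
  have inj: "dleft I = dleft J \<Longrightarrow> I = J" "dright I = dright J \<Longrightarrow> I = J" "dleft I
      \<noteq> dright J" for I J
    by (auto simp: dleft_def dright_def prod_eq_iff) presburger
  have "dyad (n + int k) x = dyad (n + int k) y"
    using Suc.prems dyad_child_cases[of "n + int k" x] dyad_child_cases[of "n + int k" y] inj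
    unfolding e by metis
  then show ?case by (rule Suc.IH)
qed simp

lemma dyad_coarsen: "dyad n x = dyad n y \<Longrightarrow> k \<le> n \<Longrightarrow> dyad k x = dyad k y"
  using dyad_coarsen_nat[of k "nat (n - k)" x y] by simp

lemma dint_nested:
  assumes "x \<in> dint I" "x \<in> dint J" "snd I \<le> snd J"
  shows "dint J \<subseteq> dint I"
proof
  fix y assume "y \<in> dint J"
  with assms(2) have "dyad (snd J) x = dyad (snd J) y" by (simp add: mem_dint_iff)
  from dyad_coarsen[OF this assms(3)] show "y \<in> dint I"
    using assms(1) by (simp add: mem_dint_iff)
qed

section \<open>Finite dyadic trees and sums over them\<close>

primrec dtree :: "nat \<Rightarrow> int \<times> int \<Rightarrow> (int \<times> int) set" where
  "dtree 0 Q = {}"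
| "dtree (Suc d) Q = insert Q (dtree d (dleft Q) \<union> dtree d (dright Q))"

text \<open>The recursive form of a sum over \<open>dtree d Q\<close>. An induction on the depth
  peels off the root and leaves two trees of equal depth below the children, so the root is always
  generalised.\<close>

primrec tsum :: "(int \<times> int \<Rightarrow> real) \<Rightarrow> nat \<Rightarrow> int \<times> int
    \<Rightarrow> real" where
  "tsum a 0 Q = 0"
| "tsum a (Suc d) Q = a Q + tsum a d (dleft Q) + tsum a d (dright Q)"

lemma dtree_bounds:
  "J \<in> dtree d Q \<Longrightarrow> dint J \<subseteq> dint Q \<and> snd Q \<le> snd J \<and> snd J < snd Q
      + int d"
proof (induction d arbitrary: Q)
  case (Suc d)
  then consider "J = Q" | "J \<in> dtree d (dleft Q)" | "J \<in> dtree d (dright Q)" by auto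
  then show ?case
  proof cases
    case 2
    then show ?thesis using Suc.IH[OF 2] dint_child_subset[of Q] by auto
  next
    case 3
    then show ?thesis using Suc.IH[OF 3] dint_child_subset[of Q] by auto
  qed simp
qed simp

lemma finite_dtree [simp]: "finite (dtree d Q)"
  by (induction d arbitrary: Q) auto

lemma tsum_eq_sum: "tsum a d Q = sum a (dtree d Q)"
proof (induction d arbitrary: Q)
  case (Suc d)
  have "dtree d (dleft Q) \<inter> dtree d (dright Q) = {}"
  proof (rule ccontr)
    assume "dtree d (dleft Q) \<inter> dtree d (dright Q) \<noteq> {}"
    then obtain J where "J \<in> dtree d (dleft Q)" "J \<in> dtree d (dright Q)" by auto
    then have "dint J \<subseteq> dint (dleft Q) \<inter> dint (dright Q)" using dtree_bounds by blast
    then show False using dint_halves_disjoint dint_nonempty by fastforce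
  qed
  moreover have "Q \<notin> dtree d (dleft Q) \<union> dtree d (dright Q)"
    using dtree_bounds[of Q d "dleft Q"] dtree_bounds[of Q d "dright Q"] by auto
  ultimately show ?case by (simp add: Suc.IH sum.union_disjoint)
qed simp

lemma dtreeI:
  "dint J \<subseteq> dint Q \<Longrightarrow> snd Q \<le> snd J \<Longrightarrow> snd J < snd Q + int d
      \<Longrightarrow> J \<in> dtree d Q"
proof (induction d arbitrary: Q)
  case (Suc d)
  obtain x where x: "x \<in> dint J" "x \<in> dint Q" using Suc.prems(1) dint_nonempty by blast
  show ?case
  proof (cases "snd J = snd Q")
    case True
    then have "J = Q" using x by (simp add: mem_dint_iff)
    then show ?thesis by simp
  next
    case False
    then have s: "snd Q + 1 \<le> snd J" using Suc.prems(2) by simp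
    from x(2) consider "x \<in> dint (dleft Q)" | "x \<in> dint (dright Q)" using dint_halves by blast
    then show ?thesis
    proof cases
      case 1
      have "J \<in> dtree d (dleft Q)"
        using Suc.prems s dint_nested[OF 1 x(1)] by (intro Suc.IH) auto
      then show ?thesis by simp
    next
      case 2
      have "J \<in> dtree d (dright Q)"
        using Suc.prems s dint_nested[OF 2 x(1)] by (intro Suc.IH) auto
      then show ?thesis by simp
    qed
  qed
qed simp

lemma tsum_mono:
  "(\<And>J. dint J \<subseteq> dint Q \<Longrightarrow> a J \<le> a' J) \<Longrightarrow> tsum a d Q \<le>
      tsum a' d Q"
  unfolding tsum_eq_sum using dtree_bounds by (intro sum_mono) blast

lemma tsum_nonneg: "(\<And>J. 0 \<le> a J) \<Longrightarrow> 0 \<le> tsum a d Q"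
  unfolding tsum_eq_sum by (intro sum_nonneg) auto

lemma tsum_add: "tsum (\<lambda>J. a J + a' J) d Q = tsum a d Q + tsum a' d Q"
  unfolding tsum_eq_sum by (simp add: sum.distrib)

lemma tsum_cmult: "tsum (\<lambda>J. c * a J) d Q = c * tsum a d Q"
  unfolding tsum_eq_sum by (simp add: sum_distrib_left)

lemma tsum_Cauchy_Schwarz:
  assumes "\<And>J. 0 \<le> x J" "\<And>J. 0 \<le> y J"
  shows "tsum (\<lambda>J. sqrt (x J) * sqrt (y J)) d Q \<le> sqrt (tsum x d Q) * sqrt (tsum y d Q)"
proof -
  have "(\<Sum>J\<in>dtree d Q. sqrt (x J) * sqrt (y J))\<^sup>2
      \<le> (\<Sum>J\<in>dtree d Q. (sqrt (x J))\<^sup>2) * (\<Sum>J\<in>dtree d Q. (sqrt (y J))\<^sup>2)"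
    by (rule Cauchy_Schwarz_ineq_sum)
  then have "(\<Sum>J\<in>dtree d Q. sqrt (x J) * sqrt (y J))\<^sup>2 \<le> sum x (dtree d Q) * sum y (dtree d Q)"
    using assms by simp
  then have "(\<Sum>J\<in>dtree d Q. sqrt (x J) * sqrt (y J)) \<le> sqrt (sum x (dtree d Q) * sum y (dtree d Q))"
    by (rule real_le_rsqrt)
  then show ?thesis by (simp add: tsum_eq_sum real_sqrt_mult)
qed

section \<open>The truncation windows as unions of trees\<close>

lemma dint_dtrunc_top:
  "dint (0, - int N) = {0 ..< 2 ^ N}" "dint (-1, - int N) = {- (2 ^ N) ..< 0}"
  by (simp_all add: dint_def dlen_def)

text \<open>No dyadic interval has 0 in its interior, so the window splits at the origin into two
  trees. Their depth is \<open>2 * N + 1\<close> because the generations run from \<open>- N\<close>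
  to \<open>N\<close> inclusive.\<close>

lemma dtrunc_eq: "dtrunc N = dtree (2 * N + 1) (0, - int N) \<union> dtree (2 * N + 1) (-1, - int N)"
proof (intro equalityI subsetI)
  fix I assume "I \<in> dtrunc N"
  then have s: "- int N \<le> snd I" "snd I \<le> int N" and sub: "dint I \<subseteq> {- (2 ^ N) ..< 2 ^ N}"
    by (auto simp: dtrunc_def)
  obtain x where x: "x \<in> dint I" using dint_nonempty by blast
  then have "x \<in> dint (0, - int N) \<or> x \<in> dint (-1, - int N)"
    using sub by (auto simp: dint_dtrunc_top)
  then show "I \<in> dtree (2 * N + 1) (0, - int N) \<union> dtree (2 * N + 1) (-1, - int N)"
  proof
    assume "x \<in> dint (0, - int N)"
    then show ?thesis using dint_nested[OF _ x] s by (intro UnI1 dtreeI) auto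
  next
    assume "x \<in> dint (-1, - int N)"
    then show ?thesis using dint_nested[OF _ x] s by (intro UnI2 dtreeI) auto
  qed
next
  fix I assume "I \<in> dtree (2 * N + 1) (0, - int N) \<union> dtree (2 * N + 1) (-1, - int N)"
  then show "I \<in> dtrunc N"
  proof
    assume "I \<in> dtree (2 * N + 1) (0, - int N)"
    from dtree_bounds[OF this] have "dint I \<subseteq> {0 ..< 2 ^ N}" "\<bar>snd I\<bar> \<le> int N"
      by (auto simp: dint_dtrunc_top)
    moreover have "{0 ..< (2::real) ^ N} \<subseteq> {- (2 ^ N) ..< 2 ^ N}" by (simp add: ivl_subset)
    ultimately show ?thesis unfolding dtrunc_def by blast
  next
    assume "I \<in> dtree (2 * N + 1) (-1, - int N)"
    from dtree_bounds[OF this] have "dint I \<subseteq> {- (2 ^ N) ..< 0}" "\<bar>snd I\<bar> \<le> int N"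
      by (auto simp: dint_dtrunc_top)
    moreover have "{- ((2::real) ^ N) ..< 0} \<subseteq> {- (2 ^ N) ..< 2 ^ N}" by (simp add: ivl_subset)
    ultimately show ?thesis unfolding dtrunc_def by blast
  qed
qed

lemma sum_dtrunc: "sum a (dtrunc N) = tsum a (2 * N + 1) (0, - int N) + tsum a (2 * N + 1) (-1, - int N)"
proof -
  have "dtree (2 * N + 1) (0, - int N) \<inter> dtree (2 * N + 1) (-1, - int N) = {}"
  proof (rule ccontr)
    assume "\<not> ?thesis"
    then obtain J where "J \<in> dtree (2 * N + 1) (0, - int N)" "J \<in> dtree (2 * N + 1) (-1, - int N)" by auto
    then have "dint J \<subseteq> dint (0, - int N) \<inter> dint (-1, - int N)" using dtree_bounds by blast
    moreover have "dint (0, - int N) \<inter> dint (-1, - int N) = {}" by (auto simp: dint_dtrunc_top)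
    ultimately show False using dint_nonempty by fastforce
  qed
  then show ?thesis unfolding dtrunc_eq tsum_eq_sum by (intro sum.union_disjoint) auto
qed

section \<open>Averages and Haar coefficients\<close>

abbreviation dinteg :: "(real \<Rightarrow> real) \<Rightarrow> int \<times> int \<Rightarrow> real" where
  "dinteg f Q \<equiv> set_lebesgue_integral lborel (dint Q) f"

abbreviation dintegrable :: "(real \<Rightarrow> real) \<Rightarrow> int \<times> int \<Rightarrow> bool" where
  "dintegrable f Q \<equiv> set_integrable lborel (dint Q) f"

definition avg :: "(real \<Rightarrow> real) \<Rightarrow> int \<times> int \<Rightarrow> real" where
  "avg f Q = dinteg f Q / dlen Q"

text \<open>The Haar coefficient \<open>coef f Q 0\<close> divided by the square root of the length of
    \<open>Q\<close>; with this
  normalisation all powers of the length cancel in the operators.\<close>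

definition hcoef :: "(real \<Rightarrow> real) \<Rightarrow> int \<times> int \<Rightarrow> real" where
  "hcoef f Q = (avg f (dright Q) - avg f (dleft Q)) / 2"

lemma dinteg_eq_avg: "dinteg f Q = dlen Q * avg f Q"
  by (simp add: avg_def)

lemma dintegrable_subset: "dintegrable f Q \<Longrightarrow> dint J \<subseteq> dint Q \<Longrightarrow>
    dintegrable f J"
  by (rule set_integrable_subset) auto

lemma dintegrable_child: "dintegrable f Q \<Longrightarrow> dintegrable f (dleft Q)" "dintegrable f Q
    \<Longrightarrow> dintegrable f (dright Q)"
  using dintegrable_subset dint_child_subset by blast+

lemma dinteg_split: "dintegrable f Q \<Longrightarrow> dinteg f Q = dinteg f (dleft Q) + dinteg f (dright Q)"
  using set_integral_Un[OF dint_halves_disjoint dintegrable_child(1) dintegrable_child(2), of Q f]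
  by (simp flip: dint_halves)

lemma avg_split: "dintegrable f Q \<Longrightarrow> avg f Q = (avg f (dleft Q) + avg f (dright Q)) / 2"
  by (simp add: avg_def dinteg_split field_simps)

lemma avg_child:
  assumes "dintegrable f Q"
  shows "avg f (dleft Q) = avg f Q - hcoef f Q" "avg f (dright Q) = avg f Q + hcoef f Q"
  using avg_split[OF assms] by (simp_all add: hcoef_def field_simps)

lemma dinteg_cong: "(\<And>x. x \<in> dint Q \<Longrightarrow> f x = g x) \<Longrightarrow> dinteg f Q = dinteg g Q"
  by (rule set_lebesgue_integral_cong) auto

lemma dintegrable_const [simp]: "dintegrable (\<lambda>x. c) Q"
  unfolding set_integrable_def by (simp add: emeasure_dint)

lemma dinteg_const [simp]: "dinteg (\<lambda>x. c) Q = c * dlen Q"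
  unfolding set_lebesgue_integral_def by simp

lemma avg_const [simp]: "avg (\<lambda>x. c) Q = c"
  by (simp add: avg_def)

lemma dinteg_nonneg: "(\<And>x. x \<in> dint Q \<Longrightarrow> 0 \<le> f x) \<Longrightarrow> 0 \<le> dinteg f Q"
  unfolding set_lebesgue_integral_def by (intro integral_nonneg_AE) (auto simp: indicator_def)

lemma avg_nonneg: "(\<And>x. x \<in> dint Q \<Longrightarrow> 0 \<le> f x) \<Longrightarrow> 0 \<le> avg f Q"
  unfolding avg_def by (simp add: dinteg_nonneg)

lemma avg_mono:
  "dintegrable f Q \<Longrightarrow> dintegrable g Q \<Longrightarrow> (\<And>x. x \<in> dint Q
      \<Longrightarrow> f x \<le> g x) \<Longrightarrow> avg f Q \<le> avg g Q"
  unfolding avg_def by (simp add: divide_right_mono set_integral_mono)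

lemma avg_add: "dintegrable f Q \<Longrightarrow> dintegrable g Q \<Longrightarrow> avg (\<lambda>x. f x + g x)
    Q = avg f Q + avg g Q"
  by (simp add: avg_def add_divide_distrib)

lemma avg_diff: "dintegrable f Q \<Longrightarrow> dintegrable g Q \<Longrightarrow> avg (\<lambda>x. f x - g
    x) Q = avg f Q - avg g Q"
  by (simp add: avg_def diff_divide_distrib)

lemma avg_cmult: "avg (\<lambda>x. c * f x) Q = c * avg f Q"
  by (simp add: avg_def)

lemma hcoef_diff: "dintegrable f Q \<Longrightarrow> dintegrable g Q \<Longrightarrow> hcoef (\<lambda>x. f x -
    g x) Q = hcoef f Q - hcoef g Q"
  by (simp add: hcoef_def avg_diff dintegrable_child field_simps)

lemma hcoef_cmult: "hcoef (\<lambda>x. c * f x) Q = c * hcoef f Q"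
  by (simp add: hcoef_def avg_cmult algebra_simps)

section \<open>Integrability of bounded functions on one interval\<close>

lemma dintegrable_bound:
  assumes "dintegrable f Q" "g \<in> borel_measurable borel" "\<And>x. x \<in> dint Q \<Longrightarrow> \<bar>g
      x\<bar> \<le> \<bar>f x\<bar>"
  shows "dintegrable g Q"
  using assms(1)
proof (rule set_integrable_bound)
  show "set_borel_measurable lborel (dint Q) g"
    using assms(2) unfolding set_borel_measurable_def by simp
qed (use assms(3) in auto)

lemma abs_avg_le:
  assumes "dintegrable f Q" shows "\<bar>avg f Q\<bar> \<le> avg (\<lambda>x. \<bar>f x\<bar>) Q"
proof -
  have a: "dintegrable (\<lambda>x. \<bar>f x\<bar>) Q" using assms by (rule set_integrable_abs)
  have m: "dintegrable (\<lambda>x. - f x) Q" using set_integrable_mult_right[of "-1" lborel "dint Q" f] assms by simp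
  have "avg f Q \<le> avg (\<lambda>x. \<bar>f x\<bar>) Q" by (rule avg_mono[OF assms a]) auto
  moreover have "avg (\<lambda>x. - f x) Q \<le> avg (\<lambda>x. \<bar>f x\<bar>) Q" by (rule avg_mono[OF m a]) auto
  moreover have "avg (\<lambda>x. - f x) Q = - avg f Q" using avg_cmult[of "-1" f Q] by simp
  ultimately show ?thesis by linarith
qed

lemma abs_hcoef_le:
  assumes "dintegrable f Q" shows "\<bar>hcoef f Q\<bar> \<le> avg (\<lambda>x. \<bar>f x\<bar>) Q"
proof -
  have "\<bar>hcoef f Q\<bar> \<le> (\<bar>avg f (dleft Q)\<bar> + \<bar>avg f (dright Q)\<bar>) / 2"
    unfolding hcoef_def using abs_triangle_ineq4[of "avg f (dright Q)" "avg f (dleft Q)"] by simp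
  also have "\<dots> \<le> (avg (\<lambda>x. \<bar>f x\<bar>) (dleft Q) + avg (\<lambda>x. \<bar>f x\<bar>)
      (dright Q)) / 2"
    using abs_avg_le[OF dintegrable_child(1)[OF assms]] abs_avg_le[OF dintegrable_child(2)[OF assms]] by simp
  also have "\<dots> = avg (\<lambda>x. \<bar>f x\<bar>) Q"
    by (simp add: avg_split[OF set_integrable_abs[OF assms]])
  finally show ?thesis .
qed

text \<open>Measurable on the whole line, but bounded on \<open>Q\<close> only: truncated maximal
  functions and averages at a fixed generation take finitely many values on \<open>Q\<close>, yet
  may be unbounded elsewhere.\<close>

definition dbounded :: "(real \<Rightarrow> real) \<Rightarrow> int \<times> int \<Rightarrow> bool" where
  "dbounded f Q \<longleftrightarrow> f \<in> borel_measurable borel \<and> (\<exists>K. \<forall>x\<in>dint Q.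
      \<bar>f x\<bar> \<le> K)"

lemma dbounded_const [simp]: "dbounded (\<lambda>x. c) Q"
  unfolding dbounded_def by auto

lemma bqE:
  assumes "dbounded f Q" obtains K where "0 \<le> K" "\<And>x. x \<in> dint Q \<Longrightarrow> \<bar>f x\<bar>
      \<le> K"
proof -
  obtain K where K: "\<forall>x\<in>dint Q. \<bar>f x\<bar> \<le> K" using assms by (auto simp: dbounded_def)
  obtain x where "x \<in> dint Q" using dint_nonempty by blast
  with K have "0 \<le> K" by (meson abs_ge_zero order_trans)
  with K show ?thesis by (intro that[of K]) auto
qed

lemma dbounded_mult [simp]: assumes "dbounded f Q" "dbounded g Q" shows "dbounded (\<lambda>x. f x * g x) Q"
proof -
  obtain K where K: "0 \<le> K" "\<And>x. x \<in> dint Q \<Longrightarrow> \<bar>f x\<bar> \<le> K" using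
      bqE[OF assms(1)] by blast
  obtain L where L: "0 \<le> L" "\<And>x. x \<in> dint Q \<Longrightarrow> \<bar>g x\<bar> \<le> L" using
      bqE[OF assms(2)] by blast
  have "\<forall>x\<in>dint Q. \<bar>f x * g x\<bar> \<le> K * L" using K L by (auto simp: abs_mult intro!: mult_mono)
  then show ?thesis using assms unfolding dbounded_def by auto
qed

lemma dbounded_diff [simp]: assumes "dbounded f Q" "dbounded g Q" shows "dbounded (\<lambda>x. f x - g x) Q"
proof -
  obtain K where K: "0 \<le> K" "\<And>x. x \<in> dint Q \<Longrightarrow> \<bar>f x\<bar> \<le> K" using
      bqE[OF assms(1)] by blast
  obtain L where L: "0 \<le> L" "\<And>x. x \<in> dint Q \<Longrightarrow> \<bar>g x\<bar> \<le> L" using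
      bqE[OF assms(2)] by blast
  have "\<forall>x\<in>dint Q. \<bar>f x - g x\<bar> \<le> K + L"
    using K L by (meson abs_triangle_ineq4 add_mono order_trans)
  then show ?thesis using assms unfolding dbounded_def by auto
qed

lemma dbounded_max [simp]: assumes "dbounded f Q" "dbounded g Q" shows "dbounded (\<lambda>x. max (f x) (g x)) Q"
proof -
  obtain K where K: "0 \<le> K" "\<And>x. x \<in> dint Q \<Longrightarrow> \<bar>f x\<bar> \<le> K" using
      bqE[OF assms(1)] by blast
  obtain L where L: "0 \<le> L" "\<And>x. x \<in> dint Q \<Longrightarrow> \<bar>g x\<bar> \<le> L" using
      bqE[OF assms(2)] by blast
  have "\<forall>x\<in>dint Q. \<bar>max (f x) (g x)\<bar> \<le> max K L"
    using K L by (fastforce simp: max_def)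
  then show ?thesis using assms unfolding dbounded_def by auto
qed

lemma dbounded_powr [simp]:
  assumes "dbounded f Q" "\<And>x. 0 \<le> f x" "0 \<le> t" shows "dbounded (\<lambda>x. f x powr t) Q"
proof -
  obtain K where K: "0 \<le> K" "\<And>x. x \<in> dint Q \<Longrightarrow> \<bar>f x\<bar> \<le> K" using
      bqE[OF assms(1)] by blast
  have "\<bar>f x powr t\<bar> \<le> K powr t" if "x \<in> dint Q" for x
    using K(2)[OF that] assms(2)[of x] assms(3) by (simp add: powr_mono2)
  then show ?thesis using assms unfolding dbounded_def by auto
qed

lemma dbounded_prod [simp]:
  assumes "\<And>j. j \<in> S \<Longrightarrow> dbounded (F j) Q" shows "dbounded (\<lambda>x. \<Prod>j\<in>S.
      F j x) Q"
  using assms by (induction S rule: infinite_finite_induct) auto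

lemma dbounded_subset: "dbounded f Q \<Longrightarrow> dint J \<subseteq> dint Q \<Longrightarrow> dbounded f J"
  unfolding dbounded_def by blast

lemma dintegrable_mult_dbounded:
  assumes "dintegrable f Q" "f \<in> borel_measurable borel" "dbounded g Q"
  shows "dintegrable (\<lambda>x. f x * g x) Q"
proof -
  obtain K where K: "0 \<le> K" "\<And>x. x \<in> dint Q \<Longrightarrow> \<bar>g x\<bar> \<le> K" using
      bqE[OF assms(3)] by blast
  have "dintegrable (\<lambda>x. K * f x) Q" using assms(1) by simp
  then show ?thesis
  proof (rule dintegrable_bound)
    show "(\<lambda>x. f x * g x) \<in> borel_measurable borel" using assms by (auto simp: dbounded_def)
    show "\<bar>f x * g x\<bar> \<le> \<bar>K * f x\<bar>" if "x \<in> dint Q" for x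
      using mult_left_mono[OF K(2)[OF that], of "\<bar>f x\<bar>"] K(1) by (simp add: abs_mult mult.commute)
  qed
qed

lemma dbounded_dintegrable: "dbounded f Q \<Longrightarrow> dintegrable f Q"
  using dintegrable_mult_dbounded[of Q "\<lambda>x. 1" f] by simp

section \<open>Local Lebesgue spaces and Jensen's inequality\<close>

definition Lloc :: "real \<Rightarrow> (real \<Rightarrow> real) \<Rightarrow> bool" where
  "Lloc s f \<longleftrightarrow> f \<in> borel_measurable borel \<and> (\<forall>Q. dintegrable (\<lambda>x.
      \<bar>f x\<bar> powr s) Q)"

lemma Lloc_measurable: "Lloc s f \<Longrightarrow> f \<in> borel_measurable borel"
  by (simp add: Lloc_def)

lemma Lloc_dintegrable: "Lloc s f \<Longrightarrow> dintegrable (\<lambda>x. \<bar>f x\<bar> powr s) Q"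
  unfolding Lloc_def by blast

lemma Lloc_bound:
  assumes "Lloc s f" "g \<in> borel_measurable borel" "\<And>x. \<bar>g x\<bar> \<le> \<bar>f x\<bar>" "0 \<le> s"
  shows "Lloc s g"
  unfolding Lloc_def
proof (intro conjI allI)
  fix Q show "dintegrable (\<lambda>x. \<bar>g x\<bar> powr s) Q"
    by (rule dintegrable_bound[OF Lloc_dintegrable[OF assms(1)]]) (use assms in \<open>auto intro: powr_mono2\<close>)
qed fact

lemma Lloc_mono:
  assumes "Lloc t f" "0 \<le> s" "s \<le> t" shows "Lloc s f"
  unfolding Lloc_def
proof (intro conjI allI)
  show m: "f \<in> borel_measurable borel" using assms(1) by (rule Lloc_measurable)
  fix Q
  have "dintegrable (\<lambda>x. 1 + \<bar>f x\<bar> powr t) Q"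
    using Lloc_dintegrable[OF assms(1), of Q] by (intro set_integral_add) auto
  then show "dintegrable (\<lambda>x. \<bar>f x\<bar> powr s) Q"
  proof (rule dintegrable_bound)
    show "\<bar>\<bar>f x\<bar> powr s\<bar> \<le> \<bar>1 + \<bar>f x\<bar> powr t\<bar>" for x
    proof (cases "\<bar>f x\<bar> \<le> 1")
      case True
      have "\<bar>f x\<bar> powr s \<le> 1 powr s" using True assms(2) by (intro powr_mono2) auto
      then show ?thesis by (simp add: add_increasing2)
    next
      case False
      then have "\<bar>f x\<bar> powr s \<le> \<bar>f x\<bar> powr t" using assms(3) by (intro powr_mono) auto
      then show ?thesis by simp
    qed
  qed (use m in auto)
qed

lemma Lloc_one:
  assumes "Lloc s f" "1 \<le> s" shows "dintegrable f Q" "dintegrable (\<lambda>x. \<bar>f x\<bar>) Q"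
proof -
  have "Lloc 1 f" by (rule Lloc_mono[OF assms(1)]) (use assms in auto)
  then have m: "f \<in> borel_measurable borel" and i: "dintegrable (\<lambda>x. \<bar>f x\<bar>) Q"
    using Lloc_dintegrable[of 1 f Q] by (simp_all add: Lloc_measurable)
  show "dintegrable (\<lambda>x. \<bar>f x\<bar>) Q" by fact
  show "dintegrable f Q" by (rule dintegrable_bound[OF i m]) auto
qed

lemma Lloc_1_iff: "Lloc 1 f \<longleftrightarrow> f \<in> borel_measurable borel \<and> (\<forall>Q. dintegrable f Q)"
  using Lloc_one[of 1 f] set_integrable_abs[of lborel _ f] unfolding Lloc_def
  by (simp only: powr_one abs_ge_zero) blast

text \<open>Rearranged, this says that \<open>u powr p\<close> lies above its tangent at
  \<open>v\<close>. It is Young's inequality for the conjugate exponents \<open>p\<close> and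
  \<open>q\<close>, and it drives both Jensen's and Doob's inequality.\<close>

lemma powr_tangent:
  fixes u v p :: real
  assumes "1 < p" "0 \<le> u" "0 \<le> v"
  shows "p * (u * v powr (p - 1)) \<le> u powr p + (p - 1) * v powr p"
proof -
  define q where "q = p / (p - 1)"
  have q: "1 < q" "1 / p + 1 / q = 1" using assms(1) by (auto simp: q_def field_simps)
  have e: "(p - 1) * q = p" using assms(1) by (simp add: q_def)
  have "u * v powr (p - 1) \<le> u powr p / p + (v powr (p - 1)) powr q / q"
    using assms q by (intro Youngs_inequality) auto
  also have "(v powr (p - 1)) powr q = v powr p" by (simp add: powr_powr e)
  also have "u powr p / p + v powr p / q = (u powr p + (p - 1) * v powr p) / p"
    using assms(1) by (simp add: q_def field_simps)
  finally show ?thesis using assms(1) by (simp add: field_simps)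
qed

text \<open>The tangent inequality with \<open>v\<close> equal to the mean is averaged over
  \<open>Q\<close>. The case \<open>p = 1\<close> is separate because the tangent form requires
  \<open>1 < p\<close>.\<close>

lemma jensen_powr:
  assumes "1 \<le> p" "Lloc p f"
  shows "(avg (\<lambda>x. \<bar>f x\<bar>) Q) powr p \<le> avg (\<lambda>x. \<bar>f x\<bar> powr p) Q"
proof (cases "p = 1")
  case True
  then show ?thesis by (simp add: avg_nonneg)
next
  case False
  then have p: "1 < p" using assms(1) by simp
  define A where "A = avg (\<lambda>x. \<bar>f x\<bar>) Q"
  have A: "0 \<le> A" unfolding A_def by (rule avg_nonneg) auto
  have i1: "dintegrable (\<lambda>x. \<bar>f x\<bar>) Q" using Lloc_one assms by blast
  have ip: "dintegrable (\<lambda>x. \<bar>f x\<bar> powr p) Q" using Lloc_dintegrable assms by blast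
  have 1: "avg (\<lambda>x. (p * A powr (p - 1)) * \<bar>f x\<bar> - (p - 1) * A powr p) Q \<le> avg
      (\<lambda>x. \<bar>f x\<bar> powr p) Q"
  proof (rule avg_mono)
    show "p * A powr (p - 1) * \<bar>f x\<bar> - (p - 1) * A powr p \<le> \<bar>f x\<bar> powr p" for x
      using powr_tangent[OF p, of "\<bar>f x\<bar>" A] A by (simp add: algebra_simps)
  qed (use i1 ip in auto)
  have 2: "avg (\<lambda>x. (p * A powr (p - 1)) * \<bar>f x\<bar> - (p - 1) * A powr p) Q
      = p * A powr (p - 1) * A - (p - 1) * A powr p"
    using i1 by (simp add: avg_diff avg_cmult flip: A_def)
  have 3: "A powr (p - 1) * A = A powr p"
    using A powr_add[of A "p - 1" 1] by simp
  have "p * A powr (p - 1) * A - (p - 1) * A powr p \<le> avg (\<lambda>x. \<bar>f x\<bar> powr p) Q"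
    using 1 unfolding 2 .
  moreover have "p * A powr (p - 1) * A - (p - 1) * A powr p = A powr p"
    using 3 by (simp add: left_diff_distrib mult.assoc)
  ultimately show ?thesis unfolding A_def[symmetric] by simp
qed

section \<open>Maximal functions and Carleson embedding\<close>

lemma dint_subset_imp_snd_le:
  assumes "dint J \<subseteq> dint Q" shows "snd Q \<le> snd J"
proof (rule ccontr)
  assume "\<not> snd Q \<le> snd J"
  then have "dlen Q < dlen J" unfolding dlen_def by (intro power_int_strict_increasing) auto
  moreover have "emeasure lborel (dint J) \<le> emeasure lborel (dint Q)"
    using assms by (intro emeasure_mono) auto
  then have "dlen J \<le> dlen Q" by (simp add: emeasure_dint)
  ultimately show False by simp
qed

text \<open>The \<open>L^s\<close> norm for normalised Lebesgue measure on \<open>Q\<close>. It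
  increases with \<open>s\<close>, which lets exponents be raised freely, and it is scale invariant,
  so every estimate carries exactly one factor \<open>dlen Q\<close>.\<close>

definition lnorm :: "real \<Rightarrow> (real \<Rightarrow> real) \<Rightarrow> int \<times> int \<Rightarrow>
    real" where
  "lnorm s f Q = (avg (\<lambda>x. \<bar>f x\<bar> powr s) Q) powr (1 / s)"

lemma lnorm_nonneg [simp]: "0 \<le> lnorm s f Q"
  by (simp add: lnorm_def)

lemma lnorm_powr: "0 < s \<Longrightarrow> lnorm s f Q powr s = avg (\<lambda>x. \<bar>f x\<bar> powr s) Q"
  by (simp add: lnorm_def powr_powr avg_nonneg)

lemma lnorm_1: "lnorm 1 f Q = avg (\<lambda>x. \<bar>f x\<bar>) Q"
  by (simp add: lnorm_def avg_nonneg)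

lemma Lloc_powr:
  assumes "Lloc (s * u) f" shows "Lloc u (\<lambda>x. \<bar>f x\<bar> powr s)"
proof -
  have "f \<in> borel_measurable borel" using assms by (rule Lloc_measurable)
  then have "(\<lambda>x. \<bar>f x\<bar> powr s) \<in> borel_measurable borel" by measurable
  then show ?thesis using assms unfolding Lloc_def by (simp add: powr_powr)
qed

lemma lnorm_mono:
  assumes "Lloc t f" "0 < s" "s \<le> t" shows "lnorm s f Q \<le> lnorm t f Q"
proof -
  have e: "s * (t / s) = t" using assms by simp
  have "(avg (\<lambda>x. \<bar>\<bar>f x\<bar> powr s\<bar>) Q) powr (t / s) \<le> avg (\<lambda>x.
      \<bar>\<bar>f x\<bar> powr s\<bar> powr (t / s)) Q"
    using assms by (intro jensen_powr Lloc_powr) (auto simp: e)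
  then have "(avg (\<lambda>x. \<bar>f x\<bar> powr s) Q) powr (t / s) \<le> avg (\<lambda>x. \<bar>f x\<bar>
      powr t) Q"
    using assms(2) by (simp add: powr_powr e)
  then have "((avg (\<lambda>x. \<bar>f x\<bar> powr s) Q) powr (t / s)) powr (1 / t) \<le> (avg (\<lambda>x.
      \<bar>f x\<bar> powr t) Q) powr (1 / t)"
    using assms by (intro powr_mono2) auto
  then show ?thesis using assms by (simp add: lnorm_def powr_powr)
qed

text \<open>With \<open>M\<close> the whole sum, each factor is at most
  \<open>M powr (1 / p j)\<close>, and these exponents add up to 1. The weights
  \<open>1 / p j\<close> of the sharp inequality are given up; this is the origin of the factor
  \<open>card S\<close> in \<open>hoelder_avg\<close>.\<close>

lemma prod_le_sum_powr:
  fixes x p :: "'a \<Rightarrow> real"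
  assumes "finite S" "\<And>j. j \<in> S \<Longrightarrow> 0 < p j" "(\<Sum>j\<in>S. 1 / p j) = 1" "\<And>j. j
      \<in> S \<Longrightarrow> 0 \<le> x j"
  shows "(\<Prod>j\<in>S. x j) \<le> (\<Sum>j\<in>S. x j powr p j)"
proof -
  define M where "M = (\<Sum>j\<in>S. x j powr p j)"
  have le: "x j powr p j \<le> M" if "j \<in> S" for j
    unfolding M_def using that assms(1) by (intro member_le_sum) auto
  have ne: "S \<noteq> {}" using assms(3) by auto
  have xle: "x j \<le> M powr (1 / p j)" if "j \<in> S" for j
  proof -
    have "x j = (x j powr p j) powr (1 / p j)" using assms(2,4)[OF that] by (simp add: powr_powr)
    also have "\<dots> \<le> M powr (1 / p j)" using le[OF that] assms(2)[OF that] by (intro powr_mono2) auto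
    finally show ?thesis .
  qed
  have M0: "0 \<le> M" unfolding M_def by (intro sum_nonneg) auto
  have "(\<Prod>j\<in>S. x j) \<le> (\<Prod>j\<in>S. M powr (1 / p j))"
    using xle assms(4) by (intro prod_mono) auto
  also have "\<dots> = M"
  proof (cases "M = 0")
    case True
    then show ?thesis using ne assms(1) by (auto simp: prod_zero_iff)
  next
    case False
    then show ?thesis using assms(1,3) M0 by (simp flip: powr_sum)
  qed
  finally show ?thesis by (simp add: M_def)
qed

lemma dintegrable_sum:
  "(\<And>j. j \<in> S \<Longrightarrow> dintegrable (g j) Q) \<Longrightarrow> dintegrable (\<lambda>x.
      \<Sum>j\<in>S. g j x) Q"
  by (induction S rule: infinite_finite_induct) (auto intro: set_integral_add)

lemma hoelder_avg:
  fixes F :: "'a \<Rightarrow> real \<Rightarrow> real"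
  assumes "finite S" "\<And>j. j \<in> S \<Longrightarrow> 0 < p j" "(\<Sum>j\<in>S. 1 / p j) = 1"
    and m: "\<And>j. j \<in> S \<Longrightarrow> F j \<in> borel_measurable borel"
    and i: "\<And>j. j \<in> S \<Longrightarrow> dintegrable (\<lambda>x. \<bar>F j x\<bar> powr p j) Q"
  shows "dintegrable (\<lambda>x. \<Prod>j\<in>S. \<bar>F j x\<bar>) Q"
    and "avg (\<lambda>x. \<Prod>j\<in>S. \<bar>F j x\<bar>) Q \<le> card S * (\<Prod>j\<in>S. lnorm (p j) (F j) Q)"
proof -
  have isum: "dintegrable (\<lambda>x. \<Sum>j\<in>S. c j * \<bar>F j x\<bar> powr p j) Q" for c
    using i by (intro dintegrable_sum) auto
  have avsum: "avg (\<lambda>x. \<Sum>j\<in>S. c j * \<bar>F j x\<bar> powr p j) Q = (\<Sum>j\<in>S. c j * avg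
      (\<lambda>x. \<bar>F j x\<bar> powr p j) Q)" for c
    using assms(1) i
  proof (induction S rule: finite_induct)
    case (insert k S)
    have 1: "dintegrable (\<lambda>x. \<Sum>j\<in>S. c j * \<bar>F j x\<bar> powr p j) Q"
      using insert.prems by (intro dintegrable_sum) auto
    then show ?case using insert by (simp add: avg_add avg_cmult)
  qed simp
  show ip: "dintegrable (\<lambda>x. \<Prod>j\<in>S. \<bar>F j x\<bar>) Q"
  proof (rule dintegrable_bound[OF isum[of "\<lambda>_. 1"]])
    show "\<bar>\<Prod>j\<in>S. \<bar>F j x\<bar>\<bar> \<le> \<bar>\<Sum>j\<in>S. 1 * \<bar>F j x\<bar> powr p
        j\<bar>" for x
      using prod_le_sum_powr[OF assms(1-3), of "\<lambda>j. \<bar>F j x\<bar>"]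
      by (simp add: prod_nonneg sum_nonneg)
  qed (use m in auto)
  \<comment> \<open>The norms are shifted by \<open>e\<close> so that they can serve as divisors
    even when they vanish; \<open>e\<close> tends to 0 at the end.\<close>
  have "avg (\<lambda>x. \<Prod>j\<in>S. \<bar>F j x\<bar>) Q \<le> card S * (\<Prod>j\<in>S. lnorm (p j) (F j)
      Q + e)" if e: "0 < e" for e
  proof -
    define N where "N j = lnorm (p j) (F j) Q + e" for j
    have N: "0 < N j" for j using e lnorm_nonneg[of "p j" "F j" Q] unfolding N_def by linarith
    define c where "c j = (\<Prod>j\<in>S. N j) * N j powr (- p j)" for j
    have "avg (\<lambda>x. \<Prod>j\<in>S. \<bar>F j x\<bar>) Q \<le> avg (\<lambda>x. \<Sum>j\<in>S. c j *
        \<bar>F j x\<bar> powr p j) Q"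
    proof (rule avg_mono[OF ip isum])
      fix x
      have "(\<Prod>j\<in>S. \<bar>F j x\<bar> / N j) \<le> (\<Sum>j\<in>S. (\<bar>F j x\<bar> / N j) powr p j)"
        using N by (intro prod_le_sum_powr assms(1-3)) (auto intro: divide_nonneg_pos)
      then have "(\<Prod>j\<in>S. N j) * (\<Prod>j\<in>S. \<bar>F j x\<bar> / N j) \<le> (\<Prod>j\<in>S. N j)
          * (\<Sum>j\<in>S. (\<bar>F j x\<bar> / N j) powr p j)"
        using N by (intro mult_left_mono prod_nonneg) (auto intro: less_imp_le)
      moreover have "(\<Prod>j\<in>S. N j) * (\<Prod>j\<in>S. \<bar>F j x\<bar> / N j) = (\<Prod>j\<in>S.
          \<bar>F j x\<bar>)"
        using N by (simp add: less_imp_neq[symmetric] flip: prod.distrib)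
      moreover have "(\<Prod>j\<in>S. N j) * (\<Sum>j\<in>S. (\<bar>F j x\<bar> / N j) powr p j) =
          (\<Sum>j\<in>S. c j * \<bar>F j x\<bar> powr p j)"
        using N by (simp add: sum_distrib_left c_def powr_divide powr_minus_divide less_imp_le)
      ultimately show "(\<Prod>j\<in>S. \<bar>F j x\<bar>) \<le> (\<Sum>j\<in>S. c j * \<bar>F j x\<bar> powr p
          j)" by simp
    qed
    also have "\<dots> = (\<Sum>j\<in>S. c j * avg (\<lambda>x. \<bar>F j x\<bar> powr p j) Q)" by (rule avsum)
    also have "\<dots> \<le> (\<Sum>j\<in>S. (\<Prod>j\<in>S. N j))"
    proof (rule sum_mono)
      fix j assume j: "j \<in> S"
      have "avg (\<lambda>x. \<bar>F j x\<bar> powr p j) Q = lnorm (p j) (F j) Q powr p j"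
        using assms(2)[OF j] by (simp add: lnorm_powr)
      also have "\<dots> \<le> N j powr p j" using e assms(2)[OF j] by (intro powr_mono2) (auto simp: N_def)
      finally have "N j powr (- p j) * avg (\<lambda>x. \<bar>F j x\<bar> powr p j) Q \<le> N j powr (- p j) *
          N j powr p j"
        by (intro mult_left_mono) auto
      also have "\<dots> = 1" using N[of j] by (simp flip: powr_add)
      finally have "(\<Prod>j\<in>S. N j) * (N j powr (- p j) * avg (\<lambda>x. \<bar>F j x\<bar> powr p j) Q)
          \<le> (\<Prod>j\<in>S. N j) * 1"
        using N by (intro mult_left_mono prod_nonneg) (auto intro: less_imp_le)
      then show "c j * avg (\<lambda>x. \<bar>F j x\<bar> powr p j) Q \<le> (\<Prod>j\<in>S. N j)"
        by (simp add: c_def mult.assoc)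
    qed
    finally show ?thesis by (simp add: N_def)
  qed
  then have ev: "eventually (\<lambda>e. avg (\<lambda>x. \<Prod>j\<in>S. \<bar>F j x\<bar>) Q \<le> card S *
      (\<Prod>j\<in>S. lnorm (p j) (F j) Q + e)) (at_right 0)"
    by (intro eventually_at_right_less[THEN eventually_mono]) auto
  have "((\<lambda>e. card S * (\<Prod>j\<in>S. lnorm (p j) (F j) Q + e)) \<longlongrightarrow> card S *
      (\<Prod>j\<in>S. lnorm (p j) (F j) Q + 0)) (at_right 0)"
    by (intro tendsto_intros)
  from tendsto_lowerbound[OF this ev] show "avg (\<lambda>x. \<Prod>j\<in>S. \<bar>F j x\<bar>) Q \<le> card S
      * (\<Prod>j\<in>S. lnorm (p j) (F j) Q)"
    by simp
qed

section \<open>Truncated dyadic maximal functions and Doob's inequality\<close>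

primrec dmax :: "(int \<times> int \<Rightarrow> real) \<Rightarrow> nat \<Rightarrow> int \<Rightarrow> real
    \<Rightarrow> real" where
  "dmax c 0 n x = 0"
| "dmax c (Suc d) n x = max (c (dyad n x)) (dmax c d (n + 1) x)"

lemma measurable_dyad [measurable]: "(\<lambda>x. c (dyad n x)) \<in> borel_measurable borel" for c :: "int
    \<times> int \<Rightarrow> real"
proof -
  have "(\<lambda>x::real. \<lfloor>x * 2 powi n\<rfloor>) \<in> borel \<rightarrow>\<^sub>M count_space UNIV"
      for n :: int by measurable
  moreover have "(\<lambda>k. c (k, n)) \<in> count_space UNIV \<rightarrow>\<^sub>M borel" by simp
  ultimately show ?thesis unfolding dyad_def by (rule measurable_compose)
qed

lemma dmax_measurable [measurable]: "dmax c d n \<in> borel_measurable borel"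
proof (induction d arbitrary: n)
  case (Suc d)
  note [measurable] = Suc
  show ?case unfolding dmax.simps by measurable
next
  case 0
  have "dmax c 0 n = (\<lambda>_. 0)" for n by (simp add: fun_eq_iff)
  then show ?case by simp
qed

lemma dmax_nonneg [simp]: "0 \<le> dmax c d n x"
  by (induction d arbitrary: n) (auto simp: le_max_iff_disj)

lemma dmax_Suc_in: "x \<in> dint Q \<Longrightarrow> dmax c (Suc d) (snd Q) x = max (c Q) (dmax c d (snd Q + 1) x)"
  by (simp add: dyad_eqI)

lemma dbounded_children: "dbounded f (dleft Q) \<Longrightarrow> dbounded f (dright Q) \<Longrightarrow> dbounded f Q"
proof -
  assume a: "dbounded f (dleft Q)" "dbounded f (dright Q)"
  obtain K where K: "0 \<le> K" "\<And>x. x \<in> dint (dleft Q) \<Longrightarrow> \<bar>f x\<bar> \<le> K"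
      using bqE[OF a(1)] by blast
  obtain L where L: "0 \<le> L" "\<And>x. x \<in> dint (dright Q) \<Longrightarrow> \<bar>f x\<bar> \<le> L"
      using bqE[OF a(2)] by blast
  have "\<forall>x\<in>dint Q. \<bar>f x\<bar> \<le> K + L" unfolding dint_halves[of Q] using K L by fastforce
  then show "dbounded f Q" using a unfolding dbounded_def by blast
qed

lemma dmax_dbounded [simp]: "dbounded (dmax c d (snd Q)) Q"
proof (induction d arbitrary: Q)
  case (Suc d)
  have "dbounded (dmax c d (snd Q + 1)) Q" using Suc[of "dleft Q"] Suc[of "dright Q"] by (simp add: dbounded_children)
  then have "dbounded (\<lambda>x. max (c Q) (dmax c d (snd Q + 1) x)) Q" by simp
  then obtain K where "\<forall>x\<in>dint Q. \<bar>max (c Q) (dmax c d (snd Q + 1) x)\<bar> \<le> K" by (auto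
      simp: dbounded_def)
  then have "\<forall>x\<in>dint Q. \<bar>dmax c (Suc d) (snd Q) x\<bar> \<le> K" by (simp add: dmax_Suc_in
      del: dmax.simps)
  then show ?case unfolding dbounded_def by (auto simp del: dmax.simps)
qed (auto simp: dbounded_def intro!: exI[of _ 0])

lemma dmax_ge: "n \<le> k \<Longrightarrow> k < n + int d \<Longrightarrow> c (dyad k x) \<le> dmax c d n x"
proof (induction d arbitrary: n)
  case (Suc d)
  show ?case
  proof (cases "n = k")
    case False
    then have "c (dyad k x) \<le> dmax c d (n + 1) x" using Suc.prems by (intro Suc.IH) auto
    then show ?thesis by simp
  qed simp
qed simp

text \<open>Doob's maximal inequality: the left-hand side decreases when the tree is refined, because
  \<open>u powr p\<close> lies above its tangent at the running maximum.\<close>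

lemma doob_bellman:
  assumes p: "1 < p" and f: "f \<in> borel_measurable borel" "\<And>x. 0 \<le> f x"
  shows "dintegrable f Q \<Longrightarrow> 0 \<le> \<theta> \<Longrightarrow>
    dinteg (\<lambda>x. (max \<theta> (dmax (avg f) d (snd Q) x)) powr p
        - p / (p - 1) * (f x * (max \<theta> (dmax (avg f) d (snd Q) x)) powr (p - 1))) Q
    \<le> dlen Q * (\<theta> powr p - p / (p - 1) * (avg f Q * \<theta> powr (p - 1)))"
proof (induction d arbitrary: Q \<theta>)
  case 0
  have "dinteg (\<lambda>x. \<theta> powr p - (p / (p - 1) * \<theta> powr (p - 1)) * f x) Q
     = \<theta> powr p * dlen Q - (p / (p - 1) * \<theta> powr (p - 1)) * dinteg f Q"
    using 0 by (subst set_integral_diff) auto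
  then show ?case using 0 by (simp add: dinteg_eq_avg algebra_simps)
next
  case (Suc d)
  define q where "q = p / (p - 1)"
  define A where "A = avg f Q"
  define \<mu> where "\<mu> = max \<theta> A"
  define H where "H x = (max \<mu> (dmax (avg f) d (snd Q + 1) x)) powr p
        - q * (f x * (max \<mu> (dmax (avg f) d (snd Q + 1) x)) powr (p - 1))" for x
  have \<mu>: "0 \<le> \<mu>" using Suc.prems by (auto simp: \<mu>_def)
  have A: "0 \<le> A" unfolding A_def using f by (intro avg_nonneg) auto
  have b: "dbounded (dmax (avg f) d (snd Q + 1)) Q"
    using dmax_dbounded[of "avg f" d "dleft Q"] dmax_dbounded[of "avg f" d "dright Q"] by (simp add:
        dbounded_children)
  have "dintegrable (\<lambda>x. f x * (max \<mu> (dmax (avg f) d (snd Q + 1) x)) powr (p - 1)) Q"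
    using Suc.prems f b p \<mu> by (intro dintegrable_mult_dbounded dbounded_powr dbounded_max) (auto simp:
        le_max_iff_disj)
  moreover have "dintegrable (\<lambda>x. (max \<mu> (dmax (avg f) d (snd Q + 1) x)) powr p) Q"
    using b p \<mu> by (intro dbounded_dintegrable dbounded_powr dbounded_max) (auto simp: le_max_iff_disj)
  ultimately have iH: "dintegrable H Q" unfolding H_def by (intro set_integral_diff set_integrable_mult_right)
  have "dinteg H (dleft Q) \<le> dlen (dleft Q) * (\<mu> powr p - q * (avg f (dleft Q) * \<mu> powr (p - 1)))"
    using Suc.IH[of "dleft Q" \<mu>] dintegrable_child[OF Suc.prems(1)] \<mu> by (simp add: H_def[abs_def] q_def)
  moreover have "dinteg H (dright Q) \<le> dlen (dright Q) * (\<mu> powr p - q * (avg f (dright Q) * \<mu> powr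
      (p - 1)))"
    using Suc.IH[of "dright Q" \<mu>] dintegrable_child[OF Suc.prems(1)] \<mu> by (simp add: H_def[abs_def] q_def)
  moreover have "dlen (dleft Q) * (\<mu> powr p - q * (avg f (dleft Q) * \<mu> powr (p - 1)))
     + dlen (dright Q) * (\<mu> powr p - q * (avg f (dright Q) * \<mu> powr (p - 1)))
     = dlen Q * (\<mu> powr p - q * (A * \<mu> powr (p - 1)))"
    unfolding A_def avg_child[OF Suc.prems(1)] by (simp add: algebra_simps)
  ultimately have "dinteg H Q \<le> dlen Q * (\<mu> powr p - q * (A * \<mu> powr (p - 1)))"
    unfolding dinteg_split[OF iH] by linarith
  also have "\<dots> \<le> dlen Q * (\<theta> powr p - q * (A * \<theta> powr (p - 1)))"
  proof (rule mult_left_mono)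
    show "\<mu> powr p - q * (A * \<mu> powr (p - 1)) \<le> \<theta> powr p - q * (A * \<theta> powr (p - 1))"
    proof (cases "A \<le> \<theta>")
      case True
      then show ?thesis by (simp add: \<mu>_def)
    next
      case False
      then have m: "\<mu> = A" by (simp add: \<mu>_def)
      have AA: "A * A powr (p - 1) = A powr p" using A powr_add[of A 1 "p - 1"] by simp
      have "p * (A * \<theta> powr (p - 1)) \<le> A powr p + (p - 1) * \<theta> powr p"
        using powr_tangent[OF p A Suc.prems(2)] .
      then have "(p * (A * \<theta> powr (p - 1))) / (p - 1) \<le> (A powr p + (p - 1) * \<theta> powr p) / (p - 1)"
        using p by (intro divide_right_mono) auto
      then have "q * (A * \<theta> powr (p - 1)) \<le> A powr p / (p - 1) + \<theta> powr p"
        using p by (simp add: q_def add_divide_distrib)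
      moreover have "A powr p - q * A powr p = - (A powr p / (p - 1))"
        using p by (simp add: q_def field_simps)
      ultimately show ?thesis unfolding m AA by linarith
    qed
  qed simp
  finally have "dinteg H Q \<le> dlen Q * (\<theta> powr p - q * (A * \<theta> powr (p - 1)))" .
  moreover have "dinteg (\<lambda>x. (max \<theta> (dmax (avg f) (Suc d) (snd Q) x)) powr p
        - q * (f x * (max \<theta> (dmax (avg f) (Suc d) (snd Q) x)) powr (p - 1))) Q = dinteg H Q"
    by (rule dinteg_cong) (simp add: dmax_Suc_in H_def \<mu>_def A_def max.assoc del: dmax.simps)
  ultimately show ?case by (simp add: q_def A_def del: dmax.simps)
qed

text \<open>The Bellman inequality started at 0 bounds the integral of \<open>M powr p\<close> by
  \<open>q\<close> times that of \<open>f * M powr (p - 1)\<close>. A pointwise split then replaces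
  Hoelder's inequality, and half of the left-hand side is absorbed, which is legitimate because
  \<open>M\<close> is bounded on \<open>Q\<close>.\<close>

lemma doob_maximal:
  assumes p: "1 < p" and f: "f \<in> borel_measurable borel" "\<And>x. 0 \<le> f x" and i: "dintegrable
      (\<lambda>x. f x powr p) Q" "dintegrable f Q"
  shows "dinteg (\<lambda>x. dmax (avg f) d (snd Q) x powr p) Q
    \<le> 2 * (p / (p - 1) * (2 * (p / (p - 1))) powr (p - 1)) * dinteg (\<lambda>x. f x powr p) Q"
proof -
  define q where "q = p / (p - 1)"
  have q: "1 < q" using p by (simp add: q_def)
  define M where "M = dmax (avg f) d (snd Q)"
  have M: "0 \<le> M x" "dbounded M Q" "M \<in> borel_measurable borel" for x by (auto simp: M_def)
  have iM: "dintegrable (\<lambda>x. M x powr p) Q" using M p by (intro dbounded_dintegrable dbounded_powr) auto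
  have ifM: "dintegrable (\<lambda>x. f x * M x powr (p - 1)) Q"
    using M p f i by (intro dintegrable_mult_dbounded dbounded_powr) auto
  have "dinteg (\<lambda>x. M x powr p - q * (f x * M x powr (p - 1))) Q \<le> 0"
    using doob_bellman[OF p f i(2), of 0 d] p by (simp add: M_def q_def max_absorb2)
  then have 1: "dinteg (\<lambda>x. M x powr p) Q \<le> dinteg (\<lambda>x. q * (f x * M x powr (p - 1))) Q"
    using iM ifM by simp
  \<comment> \<open>The threshold \<open>2 * q * f x\<close> is chosen so that the points above it
    contribute at most half of \<open>M x powr p\<close>.\<close>
  have pw: "q * (f x * M x powr (p - 1)) \<le> q * (2 * q) powr (p - 1) * f x powr p + M x powr p / 2" for x
  proof (cases "M x \<le> 2 * q * f x")
    case True
    have "M x powr (p - 1) \<le> (2 * q * f x) powr (p - 1)"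
      using True M p by (intro powr_mono2) auto
    also have "\<dots> = (2 * q) powr (p - 1) * f x powr (p - 1)" using q f by (simp add: powr_mult)
    finally have "q * (f x * M x powr (p - 1)) \<le> q * (f x * ((2 * q) powr (p - 1) * f x powr (p - 1)))"
      using q f by (intro mult_left_mono) auto
    also have "\<dots> = q * (2 * q) powr (p - 1) * (f x powr 1 * f x powr (p - 1))"
      using f by simp
    also have "\<dots> = q * (2 * q) powr (p - 1) * f x powr p"
      by (simp only: powr_add[symmetric]) simp
    finally show ?thesis by (simp add: add_increasing2)
  next
    case False
    have "q * (f x * M x powr (p - 1)) = (2 * q * f x) * M x powr (p - 1) / 2" by simp
    also have "\<dots> \<le> M x * M x powr (p - 1) / 2"
      using False by (intro divide_right_mono mult_right_mono) auto
    also have "M x * M x powr (p - 1) = M x powr p" using M powr_add[of "M x" 1 "p - 1"] by simp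
    finally show ?thesis using q by (simp add: add_increasing)
  qed
  have "dinteg (\<lambda>x. q * (f x * M x powr (p - 1))) Q
     \<le> dinteg (\<lambda>x. q * (2 * q) powr (p - 1) * f x powr p + M x powr p / 2) Q"
    by (rule set_integral_mono) (use iM ifM i(1) pw in \<open>auto intro!: set_integral_add(1)\<close>)
  also have "\<dots> = q * (2 * q) powr (p - 1) * dinteg (\<lambda>x. f x powr p) Q + dinteg (\<lambda>x. M x
      powr p) Q / 2"
    using iM i by simp
  finally show ?thesis using 1 unfolding M_def[symmetric] q_def[symmetric] by (simp add: algebra_simps)
qed

definition dmaxp :: "real \<Rightarrow> (real \<Rightarrow> real) \<Rightarrow> nat \<Rightarrow> int
    \<Rightarrow> real \<Rightarrow> real" where
  "dmaxp s f d n x = dmax (avg (\<lambda>x. \<bar>f x\<bar> powr s)) d n x powr (1 / s)"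

lemma dmaxp_nonneg [simp]: "0 \<le> dmaxp s f d n x"
  by (simp add: dmaxp_def)

lemma dmaxp_dbounded: "0 < s \<Longrightarrow> dbounded (dmaxp s f d (snd Q)) Q"
  using dbounded_powr[of "dmax (avg (\<lambda>x. \<bar>f x\<bar> powr s)) d (snd Q)" Q "1 / s"] by (simp add:
      dmaxp_def[abs_def])

lemma dmaxp_ge:
  assumes "0 < s" "dint J \<subseteq> dint Q" "snd J < snd Q + int d" "x \<in> dint J"
  shows "lnorm s f J \<le> dmaxp s f d (snd Q) x"
proof -
  have "avg (\<lambda>x. \<bar>f x\<bar> powr s) J \<le> dmax (avg (\<lambda>x. \<bar>f x\<bar> powr s)) d (snd Q) x"
    using dmax_ge[OF dint_subset_imp_snd_le[OF assms(2)] assms(3), of "avg (\<lambda>x. \<bar>f x\<bar> powr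
        s)" x] assms(4)
    by (simp add: dyad_eqI)
  then show ?thesis unfolding lnorm_def dmaxp_def using assms(1) by (intro powr_mono2) (auto intro: avg_nonneg)
qed

text \<open>Doob's inequality at the exponent \<open>t / s\<close> for the function
  \<open>\<bar>f\<bar> powr s\<close>. The exponent exceeds 1 only if \<open>s < t\<close>; this is
  the strict gap that every later choice of exponents has to provide.\<close>

lemma dmaxp_bound:
  assumes "0 < s" "s < t"
  shows "\<exists>C\<ge>0. \<forall>f d Q. Lloc t f \<longrightarrow> lnorm t (dmaxp s f d (snd Q)) Q \<le> C *
      lnorm t f Q"
proof -
  define p where "p = t / s"
  have p: "1 < p" using assms by (simp add: p_def)
  define C where "C = 2 * (p / (p - 1) * (2 * (p / (p - 1))) powr (p - 1))"
  have C: "0 \<le> C" using p by (simp add: C_def)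
  have "lnorm t (dmaxp s f d (snd Q)) Q \<le> C powr (1 / t) * lnorm t f Q" if "Lloc t f" for f d Q
  proof -
    define g where "g x = \<bar>f x\<bar> powr s" for x
    have gp: "g x powr p = \<bar>f x\<bar> powr t" for x using assms by (simp add: g_def powr_powr p_def)
    have fm: "f \<in> borel_measurable borel" using that by (rule Lloc_measurable)
    have gm: "g \<in> borel_measurable borel" unfolding g_def using fm by measurable
    have ig: "dintegrable g Q" unfolding g_def using Lloc_mono[OF that, of s] assms by (intro Lloc_dintegrable) auto
    have Ge: "\<bar>dmaxp s f d (snd Q) x\<bar> powr t = dmax (avg g) d (snd Q) x powr p" for x
      using assms by (simp add: dmaxp_def g_def[abs_def] powr_powr p_def)
    have "dinteg (\<lambda>x. dmax (avg g) d (snd Q) x powr p) Q \<le> C * dinteg (\<lambda>x. g x powr p) Q"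
      unfolding C_def using p gm ig Lloc_dintegrable[OF that, of Q]
      by (intro doob_maximal) (auto simp: gp, auto simp: g_def)
    then have "avg (\<lambda>x. \<bar>dmaxp s f d (snd Q) x\<bar> powr t) Q \<le> C * avg (\<lambda>x. \<bar>f
        x\<bar> powr t) Q"
      unfolding Ge gp avg_def by (simp add: divide_right_mono)
    then have "(avg (\<lambda>x. \<bar>dmaxp s f d (snd Q) x\<bar> powr t) Q) powr (1 / t) \<le> (C * avg
        (\<lambda>x. \<bar>f x\<bar> powr t) Q) powr (1 / t)"
      using assms by (intro powr_mono2) (auto intro: avg_nonneg)
    then show ?thesis unfolding lnorm_def using C by (simp add: powr_mult avg_nonneg)
  qed
  then show ?thesis by (intro exI[of _ "C powr (1 / t)"]) auto
qed

text \<open>The running maximum \<open>\<theta>\<close> of \<open>c\<close> along the path from the root is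
    what makes the induction close.\<close>

lemma carleson_embedding_aux:
  assumes a: "\<And>J. 0 \<le> a J"
  shows "\<lbrakk>\<And>J d'. dint J \<subseteq> dint Q \<Longrightarrow> snd J + int d' = snd Q + int d
      \<Longrightarrow> tsum a d' J \<le> dinteg w J;
    \<And>J x. dint J \<subseteq> dint Q \<Longrightarrow> snd J < snd Q + int d \<Longrightarrow> x \<in> dint
        J \<Longrightarrow> c J \<le> G x;
    dbounded w Q; dbounded G Q; \<And>x. 0 \<le> w x; 0 \<le> \<theta>\<rbrakk>
  \<Longrightarrow> tsum (\<lambda>J. a J * c J) d Q \<le> dinteg (\<lambda>x. w x * (max \<theta> (G x) -
      \<theta>)) Q + \<theta> * tsum a d Q"
proof (induction d arbitrary: Q \<theta>)
  case 0
  then show ?case by (auto intro!: dinteg_nonneg mult_nonneg_nonneg)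
next
  case (Suc d)
  define \<mu> where "\<mu> = max \<theta> (c Q)"
  let ?H = "\<lambda>x. w x * (max \<mu> (G x) - \<mu>)"
  have bH: "dbounded ?H Q" using Suc.prems by auto
  have IH: "tsum (\<lambda>J. a J * c J) d R \<le> dinteg ?H R + \<mu> * tsum a d R"
    if R: "snd R = snd Q + 1" "dint R \<subseteq> dint Q" for R
  proof (rule Suc.IH)
    show "tsum a d' J \<le> dinteg w J" if "dint J \<subseteq> dint R" "snd J + int d' = snd R + int d" for J d'
      using that R by (intro Suc.prems(1)) auto
    show "c J \<le> G x" if "dint J \<subseteq> dint R" "snd J < snd R + int d" "x \<in> dint J" for J x
      using that R by (intro Suc.prems(2)[of J]) auto
  qed (use Suc.prems dbounded_subset[OF _ R(2)] in \<open>auto simp: \<mu>_def\<close>)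
  have car: "tsum a (Suc d) Q \<le> dinteg w Q" by (rule Suc.prems(1)) auto
  have "tsum (\<lambda>J. a J * c J) (Suc d) Q \<le> a Q * c Q + dinteg ?H Q + \<mu> * (tsum a (Suc d) Q - a Q)"
    using IH[of "dleft Q"] IH[of "dright Q"] dint_child_subset[of Q] dinteg_split[OF dbounded_dintegrable[OF bH]]
    by (simp add: algebra_simps)
  also have "\<dots> \<le> dinteg ?H Q + \<mu> * tsum a (Suc d) Q"
    using mult_left_mono[of "c Q" \<mu> "a Q"] a[of Q] by (simp add: \<mu>_def algebra_simps)
  \<comment> \<open>On \<open>Q\<close> the function \<open>G\<close> is at least
    \<open>c Q\<close>, so passing from \<open>\<theta>\<close> to \<open>\<mu>\<close> lowers the
    integral by exactly \<open>(\<mu> - \<theta>) * dinteg w Q\<close>. By the Carleson bound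
    \<open>car\<close> at the root this gain outweighs the extra \<open>\<mu> - \<theta>\<close> in
    front of the tree sum.\<close>
  also have "dinteg ?H Q = dinteg (\<lambda>x. w x * (max \<theta> (G x) - \<theta>) - (\<mu> - \<theta>) * w x) Q"
  proof (rule dinteg_cong)
    fix x assume "x \<in> dint Q"
    then have "c Q \<le> G x" by (intro Suc.prems(2)) auto
    then have "max \<mu> (G x) = max \<theta> (G x)" by (auto simp: \<mu>_def)
    then show "w x * (max \<mu> (G x) - \<mu>) = w x * (max \<theta> (G x) - \<theta>) - (\<mu> - \<theta>) * w x"
      by (simp add: algebra_simps)
  qed
  also have "\<dots> = dinteg (\<lambda>x. w x * (max \<theta> (G x) - \<theta>)) Q - (\<mu> - \<theta>) * dinteg w Q"
    using Suc.prems by (subst set_integral_diff) (auto intro!: dbounded_dintegrable)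
  also have "\<dots> + \<mu> * tsum a (Suc d) Q \<le> dinteg (\<lambda>x. w x * (max \<theta> (G x) -
      \<theta>)) Q + \<theta> * tsum a (Suc d) Q"
    using mult_left_mono[OF car, of "\<mu> - \<theta>"] by (simp add: \<mu>_def algebra_simps del: tsum.simps)
  finally show ?case by simp
qed

lemma carleson_embedding:
  assumes "\<And>J. 0 \<le> a J"
    and "\<And>J d'. dint J \<subseteq> dint Q \<Longrightarrow> snd J + int d' = snd Q + int d
        \<Longrightarrow> tsum a d' J \<le> dinteg w J"
    and "\<And>J x. dint J \<subseteq> dint Q \<Longrightarrow> snd J < snd Q + int d \<Longrightarrow> x \<in>
        dint J \<Longrightarrow> c J \<le> G x"
    and "dbounded w Q" "dbounded G Q" "\<And>x. 0 \<le> w x" "\<And>x. 0 \<le> G x"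
  shows "tsum (\<lambda>J. a J * c J) d Q \<le> dinteg (\<lambda>x. w x * G x) Q"
proof -
  have "tsum (\<lambda>J. a J * c J) d Q \<le> dinteg (\<lambda>x. w x * (max 0 (G x) - 0)) Q + 0 * tsum a d Q"
    using assms by (intro carleson_embedding_aux) auto
  then show ?thesis using assms(7) by (simp add: max_absorb2)
qed

text \<open>A Carleson bound by two local norms absorbs further factors by slightly raising all exponents.\<close>

lemma carleson_multilinear:
  fixes \<tau> p :: "'a \<Rightarrow> real"
  assumes fin: "finite S" and kl: "k \<in> S" "l \<in> S" "k \<noteq> l"
    and \<tau>: "\<And>j. j \<in> S \<Longrightarrow> 0 < \<tau> j" "\<And>j. j \<in> S \<Longrightarrow>
        \<tau> j < p j" and sp: "(\<Sum>j\<in>S. 1 / p j) = 1"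
  shows "\<exists>C\<ge>0. \<forall>a f K Q d. (\<forall>j\<in>S. Lloc (p j) (f j)) \<longrightarrow>
      (\<forall>J. 0 \<le> a J) \<longrightarrow> 0 \<le> K \<longrightarrow>
    (\<forall>J d'. dint J \<subseteq> dint Q \<longrightarrow> tsum a d' J \<le> K * (dlen J * (lnorm (\<tau>
        k) (f k) J * lnorm (\<tau> l) (f l) J))) \<longrightarrow>
    tsum (\<lambda>J. a J * (\<Prod>j\<in>S-{k,l}. lnorm (\<tau> j) (f j) J)) d Q \<le> C * K * (dlen Q *
        (\<Prod>j\<in>S. lnorm (p j) (f j) Q))"
proof -
  have "\<forall>j\<in>S. \<exists>C\<ge>0. \<forall>f d Q. Lloc (p j) f \<longrightarrow> lnorm (p j) (dmaxp
      (\<tau> j) f d (snd Q)) Q \<le> C * lnorm (p j) f Q"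
    using \<tau> dmaxp_bound by blast
  then obtain C where C: "\<And>j. j \<in> S \<Longrightarrow> 0 \<le> C j"
    "\<And>j f d Q. j \<in> S \<Longrightarrow> Lloc (p j) f \<Longrightarrow> lnorm (p j) (dmaxp (\<tau> j) f
        d (snd Q)) Q \<le> C j * lnorm (p j) f Q"
    by metis
  have psplit: "(\<Prod>j\<in>S. g j) = g k * g l * (\<Prod>j\<in>S-{k,l}. g j)" for g :: "'a \<Rightarrow> real"
  proof -
    have "(\<Prod>j\<in>S. g j) = g k * (\<Prod>j\<in>S-{k}. g j)" using fin kl by (simp add: prod.remove)
    also have "(\<Prod>j\<in>S-{k}. g j) = g l * (\<Prod>j\<in>S-{k}-{l}. g j)" using fin kl by (intro
        prod.remove) auto
    also have "S - {k} - {l} = S - {k,l}" by auto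
    finally show ?thesis by simp
  qed
  have main: "tsum (\<lambda>J. a J * (\<Prod>j\<in>S-{k,l}. lnorm (\<tau> j) (f j) J)) d Q
      \<le> (card S * (\<Prod>j\<in>S. C j)) * K * (dlen Q * (\<Prod>j\<in>S. lnorm (p j) (f j) Q))"
    if f: "\<forall>j\<in>S. Lloc (p j) (f j)" and a: "\<forall>J. 0 \<le> a J" and K: "0 \<le> K"
      and car: "\<forall>J d'. dint J \<subseteq> dint Q \<longrightarrow> tsum a d' J \<le> K * (dlen J *
          (lnorm (\<tau> k) (f k) J * lnorm (\<tau> l) (f l) J))"
    for a f K Q d
  proof -
    define g where "g j = dmaxp (\<tau> j) (f j) d (snd Q)" for j
    have g: "dbounded (g j) Q" "0 \<le> g j x" if "j \<in> S" for j x
      using \<tau>(1)[OF that] dmaxp_dbounded by (auto simp: g_def)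
    have g0: "0 \<le> g j x" for j x by (auto simp: g_def)
    \<comment> \<open>On \<open>J\<close> a local norm is a constant below the corresponding maximal
      function. The hypothesis thus becomes a Carleson bound by the integral of \<open>w\<close>,
      and what remains is the product of all maximal functions, ready for Hoelder and
      \<open>dmaxp_bound\<close>.\<close>
    define w where "w x = K * (g k x * g l x)" for x
    define G where "G x = (\<Prod>j\<in>S-{k,l}. g j x)" for x
    have bw: "dbounded w Q" unfolding w_def using g kl by simp
    have bG: "dbounded G Q" unfolding G_def using g by (intro dbounded_prod) auto
    have "tsum (\<lambda>J. a J * (\<Prod>j\<in>S-{k,l}. lnorm (\<tau> j) (f j) J)) d Q \<le> dinteg
        (\<lambda>x. w x * G x) Q"
    proof (rule carleson_embedding)
      fix J d' assume J: "dint J \<subseteq> dint Q" "snd J + int d' = snd Q + int d"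
      show "tsum a d' J \<le> dinteg w J"
      \<comment> \<open>For \<open>d' = 0\<close> the interval \<open>J\<close> lies one generation
        below the last one seen by the maximal functions, so the domination fails; but then the tree
        sum is empty.\<close>
      proof (cases d')
        case 0
        then show ?thesis using K g0 by (auto simp: w_def intro!: dinteg_nonneg mult_nonneg_nonneg)
      next
        case (Suc e)
        then have s: "snd J < snd Q + int d" using J(2) by auto
        have "tsum a d' J \<le> K * (dlen J * (lnorm (\<tau> k) (f k) J * lnorm (\<tau> l) (f l) J))"
          using car J by blast
        also have "\<dots> = dinteg (\<lambda>x. K * (lnorm (\<tau> k) (f k) J * lnorm (\<tau> l) (f l) J)) J"
          by (simp only: dinteg_const) (simp add: algebra_simps)
        also have "\<dots> \<le> dinteg w J"
        proof (rule set_integral_mono)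
          show "dintegrable w J" using bw J(1) by (intro dbounded_dintegrable) (rule dbounded_subset)
          fix x assume x: "x \<in> dint J"
          show "K * (lnorm (\<tau> k) (f k) J * lnorm (\<tau> l) (f l) J) \<le> w x"
            unfolding w_def g_def using K kl \<tau>(1)
            by (intro mult_left_mono mult_mono dmaxp_ge J s x) auto
        qed simp
        finally show ?thesis .
      qed
    next
      fix J x assume J: "dint J \<subseteq> dint Q" "snd J < snd Q + int d" "x \<in> dint J"
      show "(\<Prod>j\<in>S-{k,l}. lnorm (\<tau> j) (f j) J) \<le> G x"
        unfolding G_def g_def using \<tau>(1) J by (intro prod_mono conjI dmaxp_ge) auto
    next
      show "dbounded w Q" "dbounded G Q" by fact+
    qed (use a K g0 in \<open>auto simp: w_def G_def intro!: mult_nonneg_nonneg prod_nonneg\<close>)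
    also have "dinteg (\<lambda>x. w x * G x) Q = K * dinteg (\<lambda>x. \<Prod>j\<in>S. \<bar>g j x\<bar>) Q"
      using g0 by (simp add: psplit w_def G_def mult.assoc)
    also have "\<dots> = K * (dlen Q * avg (\<lambda>x. \<Prod>j\<in>S. \<bar>g j x\<bar>) Q)"
      by (simp only: dinteg_eq_avg)
    also have "\<dots> \<le> K * (dlen Q * (card S * (\<Prod>j\<in>S. lnorm (p j) (g j) Q)))"
    proof (intro mult_left_mono)
      show "avg (\<lambda>x. \<Prod>j\<in>S. \<bar>g j x\<bar>) Q \<le> card S * (\<Prod>j\<in>S. lnorm (p j)
          (g j) Q)"
      proof (rule hoelder_avg)
        fix j assume j: "j \<in> S"
        show p0: "0 < p j" using \<tau>[OF j] by simp
        show "g j \<in> borel_measurable borel" using g j by (auto simp: dbounded_def)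
        show "dintegrable (\<lambda>x. \<bar>g j x\<bar> powr p j) Q"
          using g(1)[OF j] g0 p0 by (intro dbounded_dintegrable dbounded_powr) (auto simp: abs_of_nonneg)
      qed (use fin sp in auto)
    qed (use K in auto)
    also have "\<dots> \<le> K * (dlen Q * (card S * (\<Prod>j\<in>S. C j * lnorm (p j) (f j) Q)))"
      using K f C(2) unfolding g_def by (intro mult_left_mono prod_mono) auto
    finally show ?thesis by (simp add: prod.distrib algebra_simps)
  qed
  show ?thesis
    by (rule exI[of _ "card S * (\<Prod>j\<in>S. C j)"]) (use main C(1) in \<open>auto intro!:
        mult_nonneg_nonneg prod_nonneg\<close>)
qed

section \<open>Pairs of Haar coefficients\<close>

lemma powr_quadratic_lower:
  fixes s x :: real
  assumes s: "1 < s" "s \<le> 2" and x: "0 \<le> x" "x \<le> 2"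
  shows "1 + s * (x - 1) + s * (s - 1) / 4 * (x - 1)\<^sup>2 \<le> x powr s"
proof -
  consider "x = 0" | "x = 1" | "0 < x" "x \<noteq> 1" using x by linarith
  then show ?thesis
  proof cases
    case 1
    have "(s - 1) * (s / 4 - 1) \<le> 0" using s by (intro mult_nonneg_nonpos) auto
    then show ?thesis using 1 by (simp add: field_simps)
  next
    case 2
    then show ?thesis by simp
  next
    case 3
    define D where "D m y = (if m = 0 then y powr s else if m = 1 then s * y powr (s - 1)
        else s * (s - 1) * y powr (s - 2))" for m :: nat and y :: real
    have "\<exists>t. (if x < 1 then x < t \<and> t < 1 else 1 < t \<and> t < x) \<and>
        x powr s = (\<Sum>m<2. (D m 1 / fact m) * (x - 1) ^ m) + (D 2 t / fact 2) * (x - 1) ^ 2"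
    proof (rule Taylor[where a = "min x 1" and b = "max x 1"])
      show "\<forall>m t. m < (2::nat) \<and> min x 1 \<le> t \<and> t \<le> max x 1 \<longrightarrow> (D m
          has_real_derivative D (Suc m) t) (at t)"
      proof (intro allI impI)
        fix m :: nat and t :: real assume m: "m < 2 \<and> min x 1 \<le> t \<and> t \<le> max x 1"
        then have t: "0 < t" using 3 by (auto simp: min_def split: if_splits)
        have "m = 0 \<or> m = 1" using m by auto
        then show "(D m has_real_derivative D (Suc m) t) (at t)"
        proof
          assume m: "m = 0"
          have "((\<lambda>y. y powr s) has_real_derivative s * t powr (s - 1)) (at t)"
            using has_real_derivative_powr[OF t] .
          then show ?thesis by (simp add: m D_def[abs_def])
        next
          assume m: "m = 1"
          have "((\<lambda>y. s * y powr (s - 1)) has_real_derivative s * ((s - 1) * t powr (s - 1 - 1))) (at t)"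
            by (intro DERIV_cmult has_real_derivative_powr t)
          then show ?thesis by (simp add: m D_def[abs_def] mult.assoc)
        qed
      qed
    qed (use 3 in \<open>auto simp: D_def\<close>)
    then obtain t where t: "if x < 1 then x < t \<and> t < 1 else 1 < t \<and> t < x"
      and e: "x powr s = 1 + s * (x - 1) + s * (s - 1) * t powr (s - 2) / 2 * (x - 1)\<^sup>2"
      by (auto simp: D_def numeral_2_eq_2 lessThan_Suc)
    have t02: "0 < t" "t \<le> 2" using t 3 x by (auto split: if_splits)
    have "(1/2::real) \<le> 2 powr (s - 2)"
      using powr_mono[of "-1" "s - 2" "2::real"] s by (simp add: powr_minus)
    also have "\<dots> \<le> t powr (s - 2)" using t02 s by (intro powr_mono2') auto
    finally have "1/2 \<le> t powr (s - 2)" .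
    then have "s * (s - 1) / 4 * (x - 1)\<^sup>2 \<le> s * (s - 1) * t powr (s - 2) / 2 * (x - 1)\<^sup>2"
      using mult_left_mono[of "1/2" "t powr (s - 2)" "s * (s - 1)"] s by (intro mult_right_mono) auto
    then show ?thesis using e by linarith
  qed
qed

text \<open>After scaling by \<open>a\<close> this is the quadratic bound at \<open>1 + y\<close>
  and \<open>1 - y\<close>, averaged: the linear terms cancel. The condition on \<open>h\<close>
  says that both children of a nonnegative function have nonnegative averages.\<close>

lemma powr_two_point:
  fixes s a h :: real
  assumes s: "1 < s" "s \<le> 2" and h: "\<bar>h\<bar> \<le> a"
  shows "s * (s - 1) / 4 * (h\<^sup>2 * a powr (s - 2)) \<le> ((a - h) powr s + (a + h) powr s) / 2 - a powr s"
proof (cases "a = 0")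
  case True
  then show ?thesis using h by simp
next
  case False
  then have a: "0 < a" using h by linarith
  define y where "y = h / a"
  have y: "\<bar>y\<bar> \<le> 1" using h a by (simp add: y_def)
  define \<kappa> where "\<kappa> = s * (s - 1) / 4"
  have "1 + s * y + \<kappa> * y\<^sup>2 \<le> (1 + y) powr s"
    using powr_quadratic_lower[OF s, of "1 + y"] y by (simp add: \<kappa>_def)
  moreover have "1 - s * y + \<kappa> * y\<^sup>2 \<le> (1 - y) powr s"
    using powr_quadratic_lower[OF s, of "1 - y"] y by (simp add: \<kappa>_def)
  ultimately have "\<kappa> * y\<^sup>2 \<le> ((1 - y) powr s + (1 + y) powr s) / 2 - 1" by argo
  then have *: "s * (s - 1) / 4 * y\<^sup>2 \<le> ((1 - y) powr s + (1 + y) powr s) / 2 - 1"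
    unfolding \<kappa>_def .
  have ah: "a - h = a * (1 - y)" "a + h = a * (1 + y)" using a by (auto simp: y_def field_simps)
  have "a powr s * (s * (s - 1) / 4 * y\<^sup>2) \<le> a powr s * (((1 - y) powr s + (1 + y) powr s) / 2 - 1)"
    by (rule mult_left_mono[OF *]) simp
  also have "\<dots> = ((a - h) powr s + (a + h) powr s) / 2 - a powr s"
  proof -
    have "(a - h) powr s = a powr s * (1 - y) powr s" "(a + h) powr s = a powr s * (1 + y) powr s"
      unfolding ah using a y by (simp_all add: powr_mult)
    then show ?thesis by (simp add: algebra_simps)
  qed
  also have "a powr s * (s * (s - 1) / 4 * y\<^sup>2) = s * (s - 1) / 4 * (h\<^sup>2 * (a powr s / a powr 2))"
    using a by (simp add: y_def power_divide)
  also have "a powr s / a powr 2 = a powr (s - 2)" by (simp add: powr_diff)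
  finally show ?thesis .
qed

text \<open>The convexity gap in Jensen's inequality telescopes along the tree; at each node it dominates
  the squared Haar coefficient by the two-point inequality.\<close>

lemma stein_nonneg:
  assumes s: "1 < s" "s \<le> 2" and f: "Lloc s f" "\<And>x. 0 \<le> f x"
  shows "s * (s - 1) / 4 * tsum (\<lambda>J. dlen J * ((hcoef f J)\<^sup>2 * (avg f J) powr (s - 2))) d Q
    \<le> dinteg (\<lambda>x. f x powr s) Q - dlen Q * (avg f Q) powr s"
proof (induction d arbitrary: Q)
  case 0
  have "(avg f Q) powr s \<le> avg (\<lambda>x. f x powr s) Q" using jensen_powr[of s f Q] s f by simp
  then have "dlen Q * (avg f Q) powr s \<le> dlen Q * avg (\<lambda>x. f x powr s) Q" by (intro mult_left_mono) auto
  then show ?case by (simp add: dinteg_eq_avg)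
next
  case (Suc d)
  define a where "a = avg f Q"
  define h where "h = hcoef f Q"
  have i: "dintegrable f Q" using Lloc_one f s by auto
  have ip: "dintegrable (\<lambda>x. f x powr s) Q" using Lloc_dintegrable[OF f(1), of Q] f(2) by simp
  have "\<bar>h\<bar> \<le> a" using abs_hcoef_le[OF i] f(2) by (simp add: a_def h_def)
  note * = mult_left_mono[OF powr_two_point[OF s this], of "dlen Q"]
  define \<kappa> where "\<kappa> = s * (s - 1) / 4"
  show ?case
    using Suc[of "dleft Q"] Suc[of "dright Q"] *
    unfolding avg_child[OF i] dinteg_split[OF ip] dlen_child tsum.simps a_def[symmetric] h_def[symmetric]
        \<kappa>_def[symmetric]
    by (simp add: algebra_simps)
qed

text \<open>The factor 4 comes from the two-point inequality, one factor 2 from squaring a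
  difference, and another factor 2 from adding the positive and the negative part.\<close>

definition stein_const :: "real \<Rightarrow> real" where "stein_const s = 16 / (s * (s - 1))"

text \<open>Signed functions are split into positive and negative part. Because
  \<open>s - 2 \<le> 0\<close>, the weight built from the average of \<open>\<bar>f\<bar>\<close> is
  smaller than the one built from the average of either part, so the estimate for nonnegative
  functions applies to each.\<close>

lemma stein:
  assumes s: "1 < s" "s \<le> 2" and f: "Lloc s f"
  shows "tsum (\<lambda>J. dlen J * ((hcoef f J)\<^sup>2 * (avg (\<lambda>x. \<bar>f x\<bar>) J) powr (s - 2)))
      d Q \<le> stein_const s * dinteg (\<lambda>x. \<bar>f x\<bar> powr s) Q"
proof -
  have fm [measurable]: "f \<in> borel_measurable borel" using f by (rule Lloc_measurable)
  define fp where "fp x = max (f x) 0" for x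
  define fn where "fn x = max (- f x) 0" for x
  have pn: "f = (\<lambda>x. fp x - fn x)" by (auto simp: fp_def fn_def fun_eq_iff max_def)
  have fp: "Lloc s fp" "0 \<le> fp x" "fp x \<le> \<bar>f x\<bar>" for x
    using s by (auto intro!: Lloc_bound[OF f] simp: fp_def[abs_def])
  have fn: "Lloc s fn" "0 \<le> fn x" "fn x \<le> \<bar>f x\<bar>" for x
    using s by (auto intro!: Lloc_bound[OF f] simp: fn_def[abs_def])
  define T where "T g J = dlen J * ((hcoef g J)\<^sup>2 * (avg g J) powr (s - 2))" for g J
  have i: "dintegrable (\<lambda>x. \<bar>f x\<bar>) J" for J using Lloc_one f s by auto
  have part: "(hcoef g J)\<^sup>2 * (avg (\<lambda>x. \<bar>f x\<bar>) J) powr (s - 2) \<le> (hcoef g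
      J)\<^sup>2 * (avg g J) powr (s - 2)"
    if g: "Lloc s g" "\<And>x. 0 \<le> g x" "\<And>x. g x \<le> \<bar>f x\<bar>" for g J
  \<comment> \<open>\<open>0 powr (s - 2)\<close> evaluates to 0, so the comparison of weights
    breaks down at 0; there the Haar coefficient vanishes as well.\<close>
  proof (cases "avg g J = 0")
    case True
    have "\<bar>hcoef g J\<bar> \<le> avg (\<lambda>x. \<bar>g x\<bar>) J" using Lloc_one g s by (intro
        abs_hcoef_le) auto
    then have "hcoef g J = 0" using True g(2) by simp
    then show ?thesis by simp
  next
    case False
    then have "0 < avg g J" using avg_nonneg[of J g] g(2) by force
    moreover have "avg g J \<le> avg (\<lambda>x. \<bar>f x\<bar>) J" using Lloc_one g s i by (intro avg_mono) auto
    ultimately show ?thesis using s by (intro mult_left_mono powr_mono2') auto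
  qed
  have "tsum (\<lambda>J. dlen J * ((hcoef f J)\<^sup>2 * (avg (\<lambda>x. \<bar>f x\<bar>) J) powr (s - 2))) d Q
     \<le> tsum (\<lambda>J. 2 * T fp J + 2 * T fn J) d Q"
  proof (rule tsum_mono)
    fix J
    have e: "hcoef f J = hcoef fp J - hcoef fn J"
      unfolding pn using Lloc_one fp fn s by (intro hcoef_diff) (auto simp flip: pn)
    have "(hcoef f J)\<^sup>2 + (hcoef fp J + hcoef fn J)\<^sup>2 = 2 * (hcoef fp J)\<^sup>2 + 2 * (hcoef fn
        J)\<^sup>2"
      unfolding e by (simp add: power2_eq_square algebra_simps)
    then have "(hcoef f J)\<^sup>2 \<le> 2 * (hcoef fp J)\<^sup>2 + 2 * (hcoef fn J)\<^sup>2"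
      using zero_le_power2[of "hcoef fp J + hcoef fn J"] by linarith
    then have "(hcoef f J)\<^sup>2 * (avg (\<lambda>x. \<bar>f x\<bar>) J) powr (s - 2)
       \<le> (2 * (hcoef fp J)\<^sup>2 + 2 * (hcoef fn J)\<^sup>2) * (avg (\<lambda>x. \<bar>f x\<bar>) J) powr
           (s - 2)"
      by (rule mult_right_mono) simp
    also have "\<dots> \<le> 2 * ((hcoef fp J)\<^sup>2 * (avg fp J) powr (s - 2)) + 2 * ((hcoef fn J)\<^sup>2 *
        (avg fn J) powr (s - 2))"
      using part[OF fp, of J] part[OF fn, of J] by (simp add: algebra_simps)
    finally show "dlen J * ((hcoef f J)\<^sup>2 * (avg (\<lambda>x. \<bar>f x\<bar>) J) powr (s - 2)) \<le> 2 *
        T fp J + 2 * T fn J"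
      using mult_left_mono[OF _ dlen_nonneg[of J]] by (fastforce simp: T_def algebra_simps)
  qed
  also have "\<dots> = 2 * tsum (T fp) d Q + 2 * tsum (T fn) d Q"
    by (simp add: tsum_add tsum_cmult)
  also have "\<dots> \<le> stein_const s * dinteg (\<lambda>x. \<bar>f x\<bar> powr s) Q"
  proof -
    have one: "s * (s - 1) / 4 * tsum (T g) d Q \<le> dinteg (\<lambda>x. \<bar>f x\<bar> powr s) Q"
      if g: "Lloc s g" "\<And>x. 0 \<le> g x" "\<And>x. g x \<le> \<bar>f x\<bar>" for g
    proof -
      have "s * (s - 1) / 4 * tsum (T g) d Q \<le> dinteg (\<lambda>x. g x powr s) Q - dlen Q * (avg g Q) powr s"
        using stein_nonneg[OF s g(1,2)] by (simp add: T_def[abs_def])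
      also have "\<dots> \<le> dinteg (\<lambda>x. g x powr s) Q" by simp
      also have "\<dots> \<le> dinteg (\<lambda>x. \<bar>f x\<bar> powr s) Q"
        using Lloc_dintegrable[OF g(1), of Q] Lloc_dintegrable[OF f, of Q] g(2,3) s
        by (intro set_integral_mono powr_mono2) auto
      finally show ?thesis .
    qed
    have "0 < s * (s - 1)" using s by simp
    then show ?thesis using one[OF fp] one[OF fn] by (simp add: stein_const_def field_simps)
  qed
  finally show ?thesis .
qed

lemma lnorm_of_powr:
  assumes "0 < u" "0 < v"
  shows "lnorm u (\<lambda>x. \<bar>f x\<bar> powr v) Q = lnorm (v * u) f Q powr v"
  using assms by (simp add: lnorm_def powr_powr)

text \<open>The weight \<open>avg powr (s - 2)\<close> in the Stein estimate is undone by treating its inverse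
  as two further slots.\<close>

lemma pair_bound_eq:
  assumes t: "1 < t1" "1 < t2" "1 / t1 + 1 / t2 = 1"
  shows "\<exists>C\<ge>0. \<forall>f g Q d. Lloc t1 f \<longrightarrow> Lloc t2 g \<longrightarrow>
    tsum (\<lambda>J. dlen J * (\<bar>hcoef f J\<bar> * \<bar>hcoef g J\<bar>)) d Q \<le> C * (dlen Q * (lnorm
        t1 f Q * lnorm t2 g Q))"
proof -
  \<comment> \<open>The Stein estimate needs \<open>1 < s\<close>, the maximal functions of slots 0
    and 1 need \<open>s < t1\<close> and \<open>s < t2\<close>, and \<open>s < 2\<close> keeps
    \<open>v\<close> positive.\<close>
  define s where "s = (1 + min (min t1 t2) 2) / 2"
  have s: "1 < s" "s < 2" "s < t1" "s < t2" using t by (auto simp: s_def min_def)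
  define v where "v = (2 - s) / 2"
  have v: "0 < v" using s by (simp add: v_def)
  \<comment> \<open>Slots 0 and 1 will hold \<open>\<bar>f\<bar> powr (s / 2)\<close> and
    \<open>\<bar>g\<bar> powr (s / 2)\<close>, measured in \<open>L^2\<close> as Cauchy-Schwarz and
    Stein deliver them. Slots 2 and 3 hold the powers of exponent \<open>v\<close>, whose
    \<open>L^(1/v)\<close> norm is the average to the power \<open>v\<close>. As
    \<open>s / 2 + v = 1\<close>, the reciprocals of the \<open>p j\<close> sum to
    \<open>1 / t1 + 1 / t2\<close>.\<close>
  define \<tau> where "\<tau> j = (if j < 2 then 2 else 1 / v)" for j :: nat
  define p where "p j = (if j = 0 then 2 * t1 / s else if j = 1 then 2 * t2 / s else if j = 2 then t1 / v else
      t2 / v)" for j :: nat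
  define S where "S = {0, 1, 2, 3::nat}"
  have "\<exists>C\<ge>0. \<forall>a f K Q d. (\<forall>j\<in>S. Lloc (p j) (f j)) \<longrightarrow>
      (\<forall>J. 0 \<le> a J) \<longrightarrow> 0 \<le> K \<longrightarrow>
    (\<forall>J d'. dint J \<subseteq> dint Q \<longrightarrow> tsum a d' J \<le> K * (dlen J * (lnorm (\<tau>
        0) (f 0) J * lnorm (\<tau> 1) (f 1) J))) \<longrightarrow>
    tsum (\<lambda>J. a J * (\<Prod>j\<in>S-{0,1}. lnorm (\<tau> j) (f j) J)) d Q \<le> C * K * (dlen Q *
        (\<Prod>j\<in>S. lnorm (p j) (f j) Q))"
  proof (rule carleson_multilinear)
    show "(\<Sum>j\<in>S. 1 / p j) = 1"
    proof -
      have "(\<Sum>j\<in>S. 1 / p j) = (s / 2 + v) * (1 / t1 + 1 / t2)"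
        using s t by (simp add: S_def p_def v_def field_simps)
      also have "\<dots> = 1" using t by (simp add: v_def field_simps)
      finally show ?thesis .
    qed
  qed (use s t v in \<open>auto simp: S_def \<tau>_def p_def field_simps\<close>)
  then obtain C where C: "0 \<le> C" and C'': "\<forall>a f K Q d. (\<forall>j\<in>S. Lloc (p j) (f j))
      \<longrightarrow> (\<forall>J. 0 \<le> a J) \<longrightarrow> 0 \<le> K \<longrightarrow>
    (\<forall>J d'. dint J \<subseteq> dint Q \<longrightarrow> tsum a d' J \<le> K * (dlen J * (lnorm (\<tau>
        0) (f 0) J * lnorm (\<tau> 1) (f 1) J))) \<longrightarrow>
    tsum (\<lambda>J. a J * (\<Prod>j\<in>S-{0,1}. lnorm (\<tau> j) (f j) J)) d Q \<le> C * K * (dlen Q *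
        (\<Prod>j\<in>S. lnorm (p j) (f j) Q))"
    by (elim exE conjE) (rule that)
  note C' = C''[THEN spec, THEN spec, THEN spec, THEN spec, THEN spec, THEN mp, THEN mp, THEN mp, THEN mp]
  have main: "tsum (\<lambda>J. dlen J * (\<bar>hcoef f J\<bar> * \<bar>hcoef g J\<bar>)) d Q \<le> (C *
      stein_const s) * (dlen Q * (lnorm t1 f Q * lnorm t2 g Q))"
    if f: "Lloc t1 f" and g: "Lloc t2 g" for f g Q d
  proof -
    define A where "A h J = avg (\<lambda>x. \<bar>h x\<bar>) J" for h :: "real \<Rightarrow> real" and J
    have A0: "0 \<le> A h J" for h J unfolding A_def by (rule avg_nonneg) auto
    have fs: "Lloc s f" "Lloc s g" using Lloc_mono f g s by auto
    define F where "F j = (if j = 0 then (\<lambda>x. \<bar>f x\<bar> powr (s / 2)) else if j = 1 then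
        (\<lambda>x. \<bar>g x\<bar> powr (s / 2))
      else if j = 2 then (\<lambda>x. \<bar>f x\<bar> powr v) else (\<lambda>x. \<bar>g x\<bar> powr v))" for j :: nat
    define T where "T h J = dlen J * ((hcoef h J)\<^sup>2 * A h J powr (s - 2))" for h J
    define a where "a J = sqrt (T f J) * sqrt (T g J)" for J
    have T0: "0 \<le> T h J" for h J by (simp add: T_def)
    have sT: "sqrt (T h J) = sqrt (dlen J) * (\<bar>hcoef h J\<bar> * A h J powr (- v))" for h J
    proof -
      have "A h J powr (s - 2) = (A h J powr (- v))\<^sup>2"
        using A0[of h J] by (simp add: power2_eq_square v_def flip: powr_add)
      then show ?thesis by (simp add: T_def real_sqrt_mult real_sqrt_abs)
    qed
    have canc: "\<bar>hcoef h J\<bar> * A h J powr (- v) * A h J powr v = \<bar>hcoef h J\<bar>" if "Lloc s h" for h J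
    proof (cases "A h J = 0")
      case True
      have "\<bar>hcoef h J\<bar> \<le> A h J" unfolding A_def using Lloc_one[OF that] s by (intro abs_hcoef_le) auto
      with True show ?thesis by simp
    next
      case False
      then show ?thesis using A0[of h J] by (simp flip: powr_add)
    qed
    have S2: "S - {0, 1} = {2, 3}" by (auto simp: S_def)
    have L: "lnorm (1 / v) (\<lambda>x. \<bar>h x\<bar> powr v) J = A h J powr v" for h J
      using v by (simp add: lnorm_of_powr lnorm_1 A_def)
    have "tsum (\<lambda>J. a J * (\<Prod>j\<in>S-{0,1}. lnorm (\<tau> j) (F j) J)) d Q \<le> C * stein_const s
        * (dlen Q * (\<Prod>j\<in>S. lnorm (p j) (F j) Q))"
    proof (rule C')
      have e: "s / 2 * (2 * t1 / s) = t1" "s / 2 * (2 * t2 / s) = t2" "v * (t1 / v) = t1" "v * (t2 / v) = t2"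
        using s v by auto
      show "\<forall>j\<in>S. Lloc (p j) (F j)"
        using f g e by (auto simp: S_def p_def F_def intro!: Lloc_powr)
      show "\<forall>J. 0 \<le> a J" using T0 by (simp add: a_def)
      show "0 \<le> stein_const s" using s by (simp add: stein_const_def)
      show "\<forall>J d'. dint J \<subseteq> dint Q \<longrightarrow>
        tsum a d' J \<le> stein_const s * (dlen J * (lnorm (\<tau> 0) (F 0) J * lnorm (\<tau> 1) (F 1) J))"
      proof (intro allI impI)
        fix J d'
        have "tsum a d' J \<le> sqrt (tsum (T f) d' J) * sqrt (tsum (T g) d' J)"
          unfolding a_def using T0 by (intro tsum_Cauchy_Schwarz) auto
        also have "\<dots> \<le> sqrt (stein_const s * dinteg (\<lambda>x. \<bar>f x\<bar> powr s) J) * sqrt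
            (stein_const s * dinteg (\<lambda>x. \<bar>g x\<bar> powr s) J)"
          using stein[OF s(1) _ fs(1), of d' J] stein[OF s(1) _ fs(2), of d' J] s(1,2)
          by (intro mult_mono real_sqrt_le_mono) (auto simp: T_def[abs_def] A_def intro!: tsum_nonneg
              dinteg_nonneg mult_nonneg_nonneg divide_nonneg_pos simp: stein_const_def)
        also have "\<dots> = stein_const s * (dlen J * (lnorm (\<tau> 0) (F 0) J * lnorm (\<tau> 1) (F 1) J))"
        proof -
          have n: "lnorm 2 (\<lambda>x. \<bar>h x\<bar> powr (s / 2)) J = sqrt (avg (\<lambda>x. \<bar>h
              x\<bar> powr s) J)" for h
            by (simp add: lnorm_def powr_powr powr_half_sqrt avg_nonneg)
          have "sqrt (stein_const s) * sqrt (stein_const s) = stein_const s" "sqrt (dlen J) * sqrt (dlen J) = dlen J"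
            using s by (simp_all add: stein_const_def)
          then show ?thesis
            by (simp add: dinteg_eq_avg real_sqrt_mult \<tau>_def F_def n algebra_simps)
        qed
        finally show "tsum a d' J \<le> stein_const s * (dlen J * (lnorm (\<tau> 0) (F 0) J * lnorm (\<tau> 1)
            (F 1) J))" .
      qed
    qed
    moreover have "(\<Prod>j\<in>S. lnorm (p j) (F j) Q) = lnorm t1 f Q * lnorm t2 g Q"
    proof -
      have n: "lnorm (2 * t / s) (\<lambda>x. \<bar>h x\<bar> powr (s / 2)) Q * lnorm (t / v) (\<lambda>x.
          \<bar>h x\<bar> powr v) Q = lnorm t h Q"
        if "0 < t" for t h
      proof -
        have "lnorm (2 * t / s) (\<lambda>x. \<bar>h x\<bar> powr (s / 2)) Q = lnorm t h Q powr (s / 2)"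
          using that s by (simp add: lnorm_of_powr)
        moreover have "lnorm (t / v) (\<lambda>x. \<bar>h x\<bar> powr v) Q = lnorm t h Q powr v"
          using that v by (simp add: lnorm_of_powr)
        moreover have "s / 2 + v = 1" by (simp add: v_def field_simps)
        ultimately show ?thesis by (simp flip: powr_add)
      qed
      have "(\<Prod>j\<in>S. lnorm (p j) (F j) Q) = (lnorm (2 * t1 / s) (\<lambda>x. \<bar>f x\<bar> powr (s /
          2)) Q * lnorm (t1 / v) (\<lambda>x. \<bar>f x\<bar> powr v) Q)
         * (lnorm (2 * t2 / s) (\<lambda>x. \<bar>g x\<bar> powr (s / 2)) Q * lnorm (t2 / v) (\<lambda>x.
             \<bar>g x\<bar> powr v) Q)"
        by (simp add: S_def p_def F_def mult_ac)
      also have "\<dots> = lnorm t1 f Q * lnorm t2 g Q" using n t by simp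
      finally show ?thesis .
    qed
    moreover have "a J * (\<Prod>j\<in>S-{0,1}. lnorm (\<tau> j) (F j) J) = dlen J * (\<bar>hcoef f J\<bar> *
        \<bar>hcoef g J\<bar>)" for J
    proof -
      have "a J * (\<Prod>j\<in>S-{0,1}. lnorm (\<tau> j) (F j) J)
        = (sqrt (dlen J) * sqrt (dlen J)) * ((\<bar>hcoef f J\<bar> * A f J powr (- v) * A f J powr v) *
            (\<bar>hcoef g J\<bar> * A g J powr (- v) * A g J powr v))"
        unfolding S2 a_def sT by (simp add: \<tau>_def F_def L mult_ac)
      also have "\<dots> = dlen J * (\<bar>hcoef f J\<bar> * \<bar>hcoef g J\<bar>)" unfolding canc[OF fs(1)]
          canc[OF fs(2)] by simp
      finally show ?thesis .
    qed
    ultimately show ?thesis by simp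
  qed
  then show ?thesis using C s by (intro exI[of _ "C * stein_const s"]) (auto simp: stein_const_def)
qed

text \<open>Multiplying both exponents by \<open>\<sigma> = 1 / t1 + 1 / t2\<close> makes their
  reciprocals add up to exactly 1 and lowers them, since \<open>\<sigma> \<le> 1\<close>. They stay
  above 1 because \<open>t1 * \<sigma> = 1 + t1 / t2\<close>, and local norms are monotone in the
  exponent.\<close>

lemma pair_bound:
  assumes t: "1 < t1" "1 < t2" "1 / t1 + 1 / t2 \<le> 1"
  shows "\<exists>C\<ge>0. \<forall>f g Q d. Lloc t1 f \<longrightarrow> Lloc t2 g \<longrightarrow>
    tsum (\<lambda>J. dlen J * (\<bar>hcoef f J\<bar> * \<bar>hcoef g J\<bar>)) d Q \<le> C * (dlen Q * (lnorm
        t1 f Q * lnorm t2 g Q))"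
proof -
  define \<sigma> where "\<sigma> = 1 / t1 + 1 / t2"
  have \<sigma>: "0 < \<sigma>" "\<sigma> \<le> 1" "t1 * \<sigma> = 1 + t1 / t2" "t2 * \<sigma> = 1 + t2 / t1"
      using t by (auto simp: \<sigma>_def field_simps add_pos_pos)
  have g1: "1 < t1 * \<sigma>" "1 < t2 * \<sigma>" unfolding \<sigma>(3,4) using t by auto
  have "1 / (t1 * \<sigma>) + 1 / (t2 * \<sigma>) = (1 / t1 + 1 / t2) / \<sigma>"
    by (simp add: add_divide_distrib)
  also have "\<dots> = 1" using \<sigma> by (simp add: \<sigma>_def)
  finally have "1 / (t1 * \<sigma>) + 1 / (t2 * \<sigma>) = 1" .
  from pair_bound_eq[OF g1 this] obtain C where C: "0 \<le> C"
    and C': "\<And>f g Q d. Lloc (t1 * \<sigma>) f \<Longrightarrow> Lloc (t2 * \<sigma>) g \<Longrightarrow>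
    tsum (\<lambda>J. dlen J * (\<bar>hcoef f J\<bar> * \<bar>hcoef g J\<bar>)) d Q \<le> C * (dlen Q * (lnorm
        (t1 * \<sigma>) f Q * lnorm (t2 * \<sigma>) g Q))"
    by blast
  have le: "t1 * \<sigma> \<le> t1" "t2 * \<sigma> \<le> t2" using mult_left_mono[OF \<sigma>(2), of t1]
      mult_left_mono[OF \<sigma>(2), of t2] t by auto
  have "tsum (\<lambda>J. dlen J * (\<bar>hcoef f J\<bar> * \<bar>hcoef g J\<bar>)) d Q \<le> C * (dlen Q *
      (lnorm t1 f Q * lnorm t2 g Q))"
    if "Lloc t1 f" "Lloc t2 g" for f g Q d
  proof -
    have "tsum (\<lambda>J. dlen J * (\<bar>hcoef f J\<bar> * \<bar>hcoef g J\<bar>)) d Q \<le> C * (dlen Q *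
        (lnorm (t1 * \<sigma>) f Q * lnorm (t2 * \<sigma>) g Q))"
      using g1 by (intro C' Lloc_mono[OF that(1) _ le(1)] Lloc_mono[OF that(2) _ le(2)]) auto
    also have "\<dots> \<le> C * (dlen Q * (lnorm t1 f Q * lnorm t2 g Q))"
      using C g1 by (intro mult_left_mono mult_mono lnorm_mono[OF that(1) _ le(1)] lnorm_mono[OF that(2) _
          le(2)]) auto
    finally show ?thesis .
  qed
  then show ?thesis using C by blast
qed

section \<open>Dyadic differentiation and the John--Nirenberg inequality\<close>

lemma fatou_real:
  fixes F :: "nat \<Rightarrow> 'a \<Rightarrow> real"
  assumes i: "\<And>n. integrable M (F n)" and nn: "\<And>n x. 0 \<le> F n x" and K: "\<And>n. (\<integral>x. F
      n x \<partial>M) \<le> K"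
    and lim: "AE x in M. (\<lambda>n. F n x) \<longlonglongrightarrow> f x" and f: "f \<in> borel_measurable M"
  shows "integrable M f" "(\<integral>x. f x \<partial>M) \<le> K"
proof -
  have "0 \<le> (\<integral>x. F 0 x \<partial>M)" using nn by (intro integral_nonneg_AE) auto
  then have K0: "0 \<le> K" using K[of 0] by linarith
  have f0: "AE x in M. 0 \<le> f x"
    using lim by eventually_elim (metis LIMSEQ_le_const nn)
  have "(\<integral>\<^sup>+x. ennreal (f x) \<partial>M) = (\<integral>\<^sup>+x. liminf (\<lambda>n. ennreal
      (F n x)) \<partial>M)"
  proof (rule nn_integral_cong_AE)
    show "AE x in M. ennreal (f x) = liminf (\<lambda>n. ennreal (F n x))"
      using lim by eventually_elim (metis lim_imp_Liminf sequentially_bot tendsto_ennrealI)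
  qed
  also have "\<dots> \<le> liminf (\<lambda>n. \<integral>\<^sup>+x. ennreal (F n x) \<partial>M)"
    using i by (intro nn_integral_liminf) auto
  also have "\<dots> \<le> liminf (\<lambda>n. ennreal K)"
  proof (intro Liminf_mono always_eventually allI)
    fix n
    have "(\<integral>\<^sup>+x. ennreal (F n x) \<partial>M) = ennreal (\<integral>x. F n x \<partial>M)"
      using i nn by (intro nn_integral_eq_integral) auto
    then show "(\<integral>\<^sup>+x. ennreal (F n x) \<partial>M) \<le> ennreal K" using K[of n] by (simp add:
        ennreal_leI)
  qed
  also have "\<dots> = ennreal K" by (simp add: Liminf_const)
  finally have le: "(\<integral>\<^sup>+x. ennreal (f x) \<partial>M) \<le> ennreal K" .
  show int: "integrable M f"
    using f f0 le by (intro integrableI_nonneg) (auto simp: less_top[symmetric] top_unique)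
  have "ennreal (\<integral>x. f x \<partial>M) \<le> ennreal K"
    using le nn_integral_eq_integral[OF int f0] by simp
  then show "(\<integral>x. f x \<partial>M) \<le> K" using K0 by simp
qed

lemma abs_diff_le_two_max:
  fixes x y z :: real shows "\<bar>x - z\<bar> \<le> 2 * max \<bar>x - y\<bar> \<bar>y - z\<bar>"
proof -
  have "\<bar>x - z\<bar> \<le> \<bar>x - y\<bar> + \<bar>y - z\<bar>" by linarith
  also have "\<dots> \<le> 2 * max \<bar>x - y\<bar> \<bar>y - z\<bar>" unfolding mult_2 by (intro add_mono) auto
  finally show ?thesis .
qed

lemma Lloc_1_Icc:
  assumes "Lloc 1 f" shows "set_integrable lborel {a..b} f"
proof -
  obtain N :: nat where N: "max \<bar>a\<bar> \<bar>b\<bar> < 2 ^ N"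
    using real_arch_pow[of 2 "max \<bar>a\<bar> \<bar>b\<bar>"] by auto
  have "set_integrable lborel (dint (0, - int N) \<union> dint (-1, - int N)) f"
    using Lloc_one[OF assms] by (intro set_integrable_Un) auto
  then show ?thesis
    by (rule set_integrable_subset) (use N in \<open>auto simp: dint_dtrunc_top\<close>)
qed

lemma dlen_dyad: "dlen (dyad n x) = 2 powi (- n)"
  by (simp add: dlen_def)

text \<open>A point cuts each dyadic interval around it into a piece on its left and a piece on its
  right. One-sided differentiation for \<open>f\<close> controls the right pieces and, applied to
  the reflection of \<open>f\<close>, the left ones; the errors add up in proportion to the lengths.
  The offset \<open>k\<close> permits any starting generation.\<close>

lemma dyadic_differentiation:
  assumes f: "Lloc 1 f"
  shows "AE x in lborel. \<forall>k::int. (\<lambda>n. avg f (dyad (k + int n) x)) \<longlonglongrightarrow> f x"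
proof -
  have io: "f integrable_on cbox a b" for a b
    using set_borel_integral_eq_integral(1)[OF Lloc_1_Icc[OF f]] by simp
  then have ir: "(\<lambda>x. f (- x)) integrable_on cbox a b" for a b
    using Henstock_Kurzweil_Integration.integrable_reflect_real[of f "-a" "-b"] by simp
  obtain N1 where N1: "negligible N1" "\<And>x e. x \<notin> N1 \<Longrightarrow> 0 < e \<Longrightarrow>
     \<exists>d>0. \<forall>h. 0 < h \<and> h < d \<longrightarrow> norm (integral (cbox x (x + h *\<^sub>R
         One)) f /\<^sub>R h ^ DIM(real) - f x) < e"
    using integrable_ccontinuous_explicit[OF io] by blast
  obtain N2 where N2: "negligible N2" "\<And>x e. x \<notin> N2 \<Longrightarrow> 0 < e \<Longrightarrow>
     \<exists>d>0. \<forall>h. 0 < h \<and> h < d \<longrightarrow> norm (integral (cbox x (x + h *\<^sub>R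
         One)) (\<lambda>x. f (- x)) /\<^sub>R h ^ DIM(real) - f (- x)) < e"
    using integrable_ccontinuous_explicit[OF ir] by blast
  have "negligible (uminus ` N2)"
    using N2(1) by (intro negligible_differentiable_image_negligible) (auto intro!: derivative_intros)
  then have neg: "negligible (N1 \<union> uminus ` N2)" using N1(1) by (rule negligible_Un[rotated])
  have conv: "(\<lambda>n. avg f (dyad (k + int n) x)) \<longlonglongrightarrow> f x" if x: "x \<notin> N1
      \<union> uminus ` N2" for x k
  proof (rule LIMSEQ_I)
    fix r :: real assume r: "0 < r"
    have mx: "- x \<notin> N2" using x by force
    have box: "integral (cbox y (y + h *\<^sub>R One)) g /\<^sub>R h ^ DIM(real) = integral {y..y+h} g / h" for
        y h and g :: "real \<Rightarrow> real"
      by (simp add: divide_inverse mult.commute)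
    have "x \<notin> N1" "0 < r / 2" using x r by auto
    from N1(2)[OF this] obtain d1 where d1: "0 < d1" "\<And>h. 0 < h \<Longrightarrow> h < d1 \<Longrightarrow>
        \<bar>integral {x..x+h} f / h - f x\<bar> < r / 2"
      unfolding box real_norm_def by blast
    from N2(2)[OF mx \<open>0 < r / 2\<close>] obtain d2 where d2: "0 < d2"
      "\<And>h. 0 < h \<Longrightarrow> h < d2 \<Longrightarrow> \<bar>integral {-x..-x+h} (\<lambda>y. f (-
          y)) / h - f x\<bar> < r / 2"
      unfolding box real_norm_def minus_minus by blast
    have R: "\<bar>integral {x..x+h} f - h * f x\<bar> \<le> r / 2 * h" if "0 \<le> h" "h < d1" for h
    proof (cases "h = 0")
      case False
      then have h: "0 < h" using that by simp
      have "\<bar>integral {x..x+h} f - h * f x\<bar> = \<bar>integral {x..x+h} f / h - f x\<bar> * h"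
        using h by (simp add: field_simps flip: abs_mult_pos)
      also have "\<dots> \<le> r / 2 * h" using d1(2)[OF h that(2)] h by (intro mult_right_mono) auto
      finally show ?thesis .
    qed simp
    have L: "\<bar>integral {x-h..x} f - h * f x\<bar> \<le> r / 2 * h" if "0 \<le> h" "h < d2" for h
    proof (cases "h = 0")
      case False
      then have h: "0 < h" using that by simp
      have e: "integral {-x..-x+h} (\<lambda>y. f (- y)) = integral {x-h..x} f"
        using Henstock_Kurzweil_Integration.integral_reflect_real[of x "x - h" f] by simp
      have "\<bar>integral {x-h..x} f - h * f x\<bar> = \<bar>integral {x-h..x} f / h - f x\<bar> * h"
        using h by (simp add: field_simps flip: abs_mult_pos)
      also have "\<dots> \<le> r / 2 * h" using d2(2)[OF h that(2)] h unfolding e by (intro mult_right_mono) auto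
      finally show ?thesis .
    qed simp
    have "(\<lambda>n. 2 powi (- k) * (1 / 2::real) ^ n) \<longlonglongrightarrow> 2 powi (- k) * 0"
      by (intro tendsto_intros) auto
    then have "eventually (\<lambda>n. 2 powi (- k) * (1 / 2::real) ^ n < min d1 d2) sequentially"
      using d1(1) d2(1) by (intro order_tendstoD(2)) auto
    then obtain n0 where n0: "\<And>n. n \<ge> n0 \<Longrightarrow> 2 powi (- k) * (1 / 2::real) ^ n < min d1 d2"
      by (auto simp: eventually_sequentially)
    show "\<exists>n0. \<forall>n\<ge>n0. norm (avg f (dyad (k + int n) x) - f x) < r"
    proof (intro exI allI impI)
      fix n assume n: "n \<ge> n0"
      define I where "I = dyad (k + int n) x"
      define s where "s = real_of_int (fst I) * dlen I"
      define e where "e = real_of_int (fst I + 1) * dlen I"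
      have es: "e - s = dlen I" by (simp add: s_def e_def algebra_simps)
      have "dlen I = 2 powi (- k) * (1 / 2) ^ n"
        unfolding I_def dlen_dyad by (simp add: power_int_diff power_one_over field_simps)
      then have small: "dlen I < d1" "dlen I < d2" using n0[OF n] by auto
      have "x \<in> dint I" by (simp add: I_def)
      then have xse: "s \<le> x" "x < e" by (auto simp: dint_def s_def e_def)
      have "dinteg f I = set_lebesgue_integral lborel {s..e} f"
        by (rule set_integral_discrete_difference[where X = "{e}"]) (auto simp: dint_def s_def e_def)
      also have "\<dots> = integral {s..e} f"
        using set_borel_integral_eq_integral(2)[OF Lloc_1_Icc[OF f]] .
      also have "\<dots> = integral {s..x} f + integral {x..e} f"
        using xse io[of s e] by (intro Henstock_Kurzweil_Integration.integral_combine[symmetric]) auto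
      finally have "\<bar>dinteg f I - dlen I * f x\<bar> \<le> \<bar>integral {s..x} f - (x - s) * f x\<bar> +
          \<bar>integral {x..e} f - (e - x) * f x\<bar>"
        unfolding es[symmetric] by (simp add: algebra_simps)
      also have "\<dots> \<le> r / 2 * (x - s) + r / 2 * (e - x)"
        using R[of "e - x"] L[of "x - s"] xse small es by (intro add_mono) auto
      also have "\<dots> = r / 2 * dlen I" unfolding es[symmetric] by (simp add: field_simps)
      finally have "\<bar>avg f I - f x\<bar> * dlen I \<le> r / 2 * dlen I"
        by (simp add: dinteg_eq_avg abs_mult mult.commute flip: right_diff_distrib)
      then have "\<bar>avg f I - f x\<bar> \<le> r / 2" by simp
      then show "norm (avg f (dyad (k + int n) x) - f x) < r" using r by (simp add: I_def)
    qed
  qed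
  have "N1 \<union> uminus ` N2 \<in> null_sets lebesgue" using neg by (simp add: negligible_iff_null_sets)
  then have "AE x in lebesgue. \<forall>k::int. (\<lambda>n. avg f (dyad (k + int n) x))
      \<longlonglongrightarrow> f x"
    by (rule AE_I') (use conv in blast)
  then show ?thesis by (simp add: AE_completion_iff)
qed

section \<open>Higher integrability of functions of bounded mean oscillation\<close>

lemma dbounded_dyad: "dbounded (\<lambda>x. c (dyad (snd Q + int d) x)) Q"
proof (induction d arbitrary: Q)
  case 0
  have "\<forall>x\<in>dint Q. \<bar>c (dyad (snd Q) x)\<bar> \<le> \<bar>c Q\<bar>" by (simp add: dyad_eqI)
  then show ?case unfolding dbounded_def by auto
next
  case (Suc d)
  have "dbounded (\<lambda>x. c (dyad (snd Q + 1 + int d) x)) Q"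
    using Suc[of "dleft Q"] Suc[of "dright Q"] by (simp add: dbounded_children)
  then show ?case by (simp add: algebra_simps)
qed

text \<open>A strictly positive bound \<open>B\<close> takes the place of the norm, because the
  stopping argument divides by it; the norm itself, possibly 0, is recovered by letting
  \<open>B\<close> decrease to it.\<close>

definition bmo_le :: "(real \<Rightarrow> real) \<Rightarrow> real \<Rightarrow> bool" where
  "bmo_le b B \<longleftrightarrow> Lloc 1 b \<and> 0 < B \<and> (\<forall>J. avg (\<lambda>x. \<bar>b x - avg
      b J\<bar>) J \<le> B)"

text \<open>Chosen so that \<open>2 powr q * B / (jn_level q * B) = 1 / 2\<close>: a restart then
  costs only half of the constant being proved.\<close>

definition jn_level :: "real \<Rightarrow> real" where "jn_level q = 2 powr (q + 1)"

text \<open>The solution \<open>K\<close> of the fixed point equation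
  \<open>K = L + (K + M) / 2\<close> with \<open>L = jn_level q powr q\<close> and
  \<open>M = (jn_level q + 2) powr q\<close>; the constant of the induction has to reproduce
  itself.\<close>

definition jn_const :: "real \<Rightarrow> real" where "jn_const q = 2 * jn_level q powr q + (jn_level q + 2) powr q"

text \<open>
  The induction runs down the tree until the average leaves the \<open>jn_level q * B\<close> neighbourhood
  of \<open>\<beta>\<close>; there it restarts with the new average, at a cost that the last integral pays for.
\<close>

lemma jn_depth:
  assumes q: "1 \<le> q" and b: "bmo_le b B"
  shows "\<bar>avg b Q - \<beta>\<bar> \<le> jn_level q * B \<Longrightarrow>
    dinteg (\<lambda>x. \<bar>avg b (dyad (snd Q + int d) x) - \<beta>\<bar> powr q) Q
    \<le> (jn_level q * B) powr q * dlen Q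
      + (2 powr q * (jn_const q * B powr q + ((jn_level q + 2) * B) powr q) / (jn_level q * B)) * dinteg
          (\<lambda>x. \<bar>b x - \<beta>\<bar>) Q"
proof (induction d arbitrary: Q \<beta>)
  case 0
  have B: "0 < B" and b1: "Lloc 1 b" using b by (auto simp: bmo_le_def)
  have l: "0 < jn_level q * B" using B by (simp add: jn_level_def)
  have "dinteg (\<lambda>x. \<bar>avg b (dyad (snd Q + int 0) x) - \<beta>\<bar> powr q) Q = dinteg
      (\<lambda>x. \<bar>avg b Q - \<beta>\<bar> powr q) Q"
    by (rule dinteg_cong) (simp add: dyad_eqI)
  also have "\<dots> = \<bar>avg b Q - \<beta>\<bar> powr q * dlen Q" by simp
  also have "\<dots> \<le> (jn_level q * B) powr q * dlen Q" using 0 q by (intro mult_right_mono powr_mono2) auto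
  finally show ?case using l
    by (auto intro!: add_increasing2 mult_nonneg_nonneg divide_nonneg_pos dinteg_nonneg simp: jn_const_def)
next
  case (Suc d)
  define l where "l = jn_level q * B"
  define K where "K = jn_const q * B powr q"
  define M where "M = ((jn_level q + 2) * B) powr q"
  define D where "D = 2 powr q * (K + M) / l"
  have B: "0 < B" and b1: "Lloc 1 b" and osc: "\<And>J. avg (\<lambda>x. \<bar>b x - avg b J\<bar>) J \<le> B"
    using b by (auto simp: bmo_le_def)
  have l: "0 < l" using B by (simp add: jn_level_def l_def)
  have K0: "0 \<le> K" "0 \<le> M" by (auto simp: K_def M_def jn_const_def)
  have D: "0 \<le> D" using l K0 by (simp add: D_def)
  have ib: "dintegrable (\<lambda>x. \<bar>b x - \<beta>\<bar>) J" for J \<beta>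
    using Lloc_one[OF b1] by (intro set_integrable_abs set_integral_diff) auto
  have lq: "l powr q + D * B = K"
  proof -
    have "D * B = (K + M) / 2"
      using B by (simp add: D_def l_def jn_level_def powr_add field_simps)
    moreover have "l powr q = jn_level q powr q * B powr q" "M = (jn_level q + 2) powr q * B powr q"
      using B by (simp_all add: l_def M_def powr_mult jn_level_def)
    ultimately show ?thesis by (simp add: K_def jn_const_def algebra_simps)
  qed
  have IH: "dinteg (\<lambda>x. \<bar>avg b (dyad (snd R + int d) x) - \<gamma>\<bar> powr q) R \<le> l powr q
      * dlen R + D * dinteg (\<lambda>x. \<bar>b x - \<gamma>\<bar>) R"
    if "\<bar>avg b R - \<gamma>\<bar> \<le> l" for R \<gamma>
    using Suc.IH[of R \<gamma>] that by (simp add: l_def K_def M_def D_def)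
  \<comment> \<open>Centred at its own average, \<open>R\<close> has a last integral of at most
    \<open>dlen R * B\<close>, and \<open>lq\<close> turns the sum of both terms into
    \<open>K * dlen R\<close>.\<close>
  have IHK: "dinteg (\<lambda>x. \<bar>avg b (dyad (snd R + int d) x) - avg b R\<bar> powr q) R \<le> K * dlen
      R" for R
  proof -
    have "dinteg (\<lambda>x. \<bar>avg b (dyad (snd R + int d) x) - avg b R\<bar> powr q) R \<le> l powr q *
        dlen R + D * dinteg (\<lambda>x. \<bar>b x - avg b R\<bar>) R"
      using l by (intro IH) auto
    also have "\<dots> \<le> l powr q * dlen R + D * (dlen R * B)"
      unfolding dinteg_eq_avg using D osc[of R] by (intro add_left_mono mult_left_mono) auto
    also have "\<dots> = K * dlen R" by (simp add: lq[symmetric] algebra_simps)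
    finally show ?thesis .
  qed
  have child: "dinteg (\<lambda>x. \<bar>avg b (dyad (snd R + int d) x) - \<beta>\<bar> powr q) R \<le> l powr
      q * dlen R + D * dinteg (\<lambda>x. \<bar>b x - \<beta>\<bar>) R"
    if R: "R = dleft Q \<or> R = dright Q" for R
  proof (cases "\<bar>avg b R - \<beta>\<bar> \<le> l")
    case True
    then show ?thesis by (rule IH)
  next
    case False
    have dR: "dlen R = dlen Q / 2" and subR: "dint R \<subseteq> dint Q" using R dint_child_subset[of Q] by auto
    \<comment> \<open>The jump to a child costs a factor 2 because the child has half the measure;
      hence the overshoot \<open>jn_level q + 2\<close> in \<open>M\<close>.\<close>
    have "\<bar>avg b R - avg b Q\<bar> \<le> 2 * B"
    proof -
      have "\<bar>avg b R - avg b Q\<bar> = \<bar>avg (\<lambda>x. b x - avg b Q) R\<bar>" using Lloc_one[OF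
          b1] by (simp add: avg_diff)
      also have "\<dots> \<le> avg (\<lambda>x. \<bar>b x - avg b Q\<bar>) R" using Lloc_one[OF b1] by (intro
          abs_avg_le set_integral_diff) auto
      also have "\<dots> \<le> 2 * avg (\<lambda>x. \<bar>b x - avg b Q\<bar>) Q"
      proof -
        have "0 \<le> avg (\<lambda>x. \<bar>b x - avg b Q\<bar>) (dleft Q)" "0 \<le> avg (\<lambda>x. \<bar>b
            x - avg b Q\<bar>) (dright Q)"
          by (auto intro: avg_nonneg)
        then show ?thesis using R by (auto simp: avg_split[OF ib[where J=Q]])
      qed
      also have "\<dots> \<le> 2 * B" using osc[of Q] by simp
      finally show ?thesis .
    qed
    then have up: "\<bar>avg b R - \<beta>\<bar> \<le> (jn_level q + 2) * B" using Suc.prems by (simp add: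
        algebra_simps abs_le_iff)
    have "dinteg (\<lambda>x. \<bar>avg b (dyad (snd R + int d) x) - \<beta>\<bar> powr q) R
       \<le> dinteg (\<lambda>x. 2 powr q * (\<bar>avg b (dyad (snd R + int d) x) - avg b R\<bar> powr q + M)) R"
    proof (rule set_integral_mono)
      show "dintegrable (\<lambda>x. \<bar>avg b (dyad (snd R + int d) x) - \<beta>\<bar> powr q) R"
        by (rule dbounded_dintegrable[OF dbounded_dyad[where c = "\<lambda>J. \<bar>avg b J - \<beta>\<bar> powr q"]])
      show "dintegrable (\<lambda>x. 2 powr q * (\<bar>avg b (dyad (snd R + int d) x) - avg b R\<bar> powr q + M)) R"
        by (rule dbounded_dintegrable[OF dbounded_dyad[where c = "\<lambda>J. 2 powr q * (\<bar>avg b J - avg b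
            R\<bar> powr q + M)"]])
      fix x
      define u where "u = \<bar>avg b (dyad (snd R + int d) x) - avg b R\<bar>"
      define v where "v = \<bar>avg b R - \<beta>\<bar>"
      have "\<bar>avg b (dyad (snd R + int d) x) - \<beta>\<bar> \<le> 2 * max u v" unfolding u_def v_def by
          (rule abs_diff_le_two_max)
      then have "\<bar>avg b (dyad (snd R + int d) x) - \<beta>\<bar> powr q \<le> (2 * max u v) powr q"
        using q by (intro powr_mono2) auto
      also have "\<dots> = 2 powr q * max u v powr q" by (simp add: powr_mult u_def v_def)
      also have "\<dots> \<le> 2 powr q * (u powr q + M)"
      proof (intro mult_left_mono)
        have "v powr q \<le> M" unfolding M_def v_def using up q by (intro powr_mono2) auto
        moreover have "max u v powr q \<le> u powr q + v powr q" by (simp add: max_def)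
        ultimately show "max u v powr q \<le> u powr q + M" by linarith
      qed simp
      finally show "\<bar>avg b (dyad (snd R + int d) x) - \<beta>\<bar> powr q \<le> 2 powr q * (\<bar>avg b
          (dyad (snd R + int d) x) - avg b R\<bar> powr q + M)"
        by (simp add: u_def)
    qed
    also have "\<dots> = 2 powr q * (dinteg (\<lambda>x. \<bar>avg b (dyad (snd R + int d) x) - avg b R\<bar>
        powr q) R + M * dlen R)"
      using dbounded_dintegrable[OF dbounded_dyad[where c = "\<lambda>J. \<bar>avg b J - avg b R\<bar> powr
          q"]] by simp
    also have "\<dots> \<le> 2 powr q * (K * dlen R + M * dlen R)"
      using IHK[of R] by (intro mult_left_mono add_right_mono) auto
    also have "\<dots> = D * (l * dlen R)" using l by (simp add: D_def field_simps)
    \<comment> \<open>\<open>R\<close> is a stopping interval: its average is further than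
      \<open>l\<close> from \<open>\<beta>\<close>, so its length is paid for by the integral of
      \<open>\<bar>b x - \<beta>\<bar>\<close> over \<open>R\<close>.\<close>
    also have "\<dots> \<le> D * dinteg (\<lambda>x. \<bar>b x - \<beta>\<bar>) R"
    proof (rule mult_left_mono[OF _ D])
      have "\<bar>avg b R - \<beta>\<bar> = \<bar>avg (\<lambda>x. b x - \<beta>) R\<bar>" using Lloc_one[OF
          b1] by (simp add: avg_diff)
      also have "\<dots> \<le> avg (\<lambda>x. \<bar>b x - \<beta>\<bar>) R" using Lloc_one[OF b1] by (intro
          abs_avg_le set_integral_diff) auto
      finally have "l \<le> avg (\<lambda>x. \<bar>b x - \<beta>\<bar>) R" using False by simp
      then show "l * dlen R \<le> dinteg (\<lambda>x. \<bar>b x - \<beta>\<bar>) R"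
        unfolding dinteg_eq_avg by (simp add: mult.commute)
    qed
    finally show ?thesis by (simp add: add_increasing)
  qed
  have e: "snd Q + int (Suc d) = snd Q + 1 + int d" by simp
  have "dinteg (\<lambda>x. \<bar>avg b (dyad (snd Q + int (Suc d)) x) - \<beta>\<bar> powr q) Q =
      dinteg (\<lambda>x. \<bar>avg b (dyad (snd (dleft Q) + int d) x) - \<beta>\<bar> powr q) (dleft Q)
      + dinteg (\<lambda>x. \<bar>avg b (dyad (snd (dright Q) + int d) x) - \<beta>\<bar> powr q) (dright Q)"
    using dinteg_split[OF dbounded_dintegrable[OF dbounded_dyad[where c = "\<lambda>J. \<bar>avg b J -
        \<beta>\<bar> powr q" and Q = Q and d = "Suc d"]]]
    unfolding e by simp
  also have "\<dots> \<le> l powr q * dlen Q + D * dinteg (\<lambda>x. \<bar>b x - \<beta>\<bar>) Q"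
    using child[of "dleft Q"] child[of "dright Q"] dinteg_split[OF ib[where J=Q]]
    by (simp add: algebra_simps)
  finally show ?case by (simp add: l_def K_def M_def D_def)
qed

text \<open>With \<open>\<beta> = avg b Q\<close> the bound of \<open>jn_depth\<close> does not
  depend on the depth. The averages at increasing depth converge to \<open>b\<close> almost
  everywhere, so Fatou's lemma carries the bound over to \<open>b\<close> itself.\<close>

lemma john_nirenberg:
  assumes q: "1 \<le> q" and b: "bmo_le b B"
  shows "Lloc q (\<lambda>x. b x - c)" "lnorm q (\<lambda>x. b x - avg b Q) Q \<le> jn_const q powr (1 / q) * B"
proof -
  have B: "0 < B" and b1: "Lloc 1 b" and osc: "\<And>J. avg (\<lambda>x. \<bar>b x - avg b J\<bar>) J \<le> B"
    using b by (auto simp: bmo_le_def)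
  have bm [measurable]: "b \<in> borel_measurable borel" using b1 by (rule Lloc_measurable)
  have int: "dintegrable (\<lambda>x. \<bar>b x - avg b Q\<bar> powr q) Q \<and> dinteg (\<lambda>x. \<bar>b x
      - avg b Q\<bar> powr q) Q \<le> jn_const q * B powr q * dlen Q" for Q
  proof -
    let ?F = "\<lambda>d x. indicator (dint Q) x *\<^sub>R (\<bar>avg b (dyad (snd Q + int d) x) - avg b
        Q\<bar> powr q)"
    let ?f = "\<lambda>x. indicator (dint Q) x *\<^sub>R (\<bar>b x - avg b Q\<bar> powr q)"
    have i: "integrable lborel (?F d)" for d
      using dbounded_dintegrable[OF dbounded_dyad[where c = "\<lambda>J. \<bar>avg b J - avg b Q\<bar> powr q"
          and Q = Q and d = d]]
      unfolding set_integrable_def .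
    have "(\<integral>x. ?F d x \<partial>lborel) \<le> jn_const q * B powr q * dlen Q" for d
    proof -
      have "dinteg (\<lambda>x. \<bar>avg b (dyad (snd Q + int d) x) - avg b Q\<bar> powr q) Q
        \<le> (jn_level q * B) powr q * dlen Q
          + (2 powr q * (jn_const q * B powr q + ((jn_level q + 2) * B) powr q) / (jn_level q * B)) * dinteg
              (\<lambda>x. \<bar>b x - avg b Q\<bar>) Q"
        using B by (intro jn_depth q b) (simp add: jn_level_def)
      also have "\<dots> \<le> (jn_level q * B) powr q * dlen Q
          + (2 powr q * (jn_const q * B powr q + ((jn_level q + 2) * B) powr q) / (jn_level q * B)) * (dlen Q * B)"
        unfolding dinteg_eq_avg using B osc[of Q]
        by (intro add_left_mono mult_left_mono) (auto simp: jn_level_def jn_const_def intro!: divide_nonneg_pos)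
      also have "\<dots> = jn_const q * B powr q * dlen Q"
      proof -
        have 1: "2 powr q * X / (jn_level q * B) * (dlen Q * B) = X / 2 * dlen Q" for X
          using B by (simp add: jn_level_def powr_add field_simps)
        have 2: "(jn_level q * B) powr q = jn_level q powr q * B powr q" "((jn_level q + 2) * B) powr q =
            (jn_level q + 2) powr q * B powr q"
          using B by (simp_all add: powr_mult jn_level_def)
        show ?thesis unfolding 1 2 by (simp add: jn_const_def algebra_simps)
      qed
      finally show ?thesis by (simp add: set_lebesgue_integral_def)
    qed
    note K = this
    have lim: "AE x in lborel. (\<lambda>d. ?F d x) \<longlonglongrightarrow> ?f x"
      using dyadic_differentiation[OF b1]
    proof eventually_elim
      case (elim x)
      then have "(\<lambda>n. avg b (dyad (snd Q + int n) x)) \<longlonglongrightarrow> b x" by blast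
      then show ?case using q by (intro tendsto_intros) auto
    qed
    show ?thesis
      using fatou_real[OF i _ K lim] unfolding set_integrable_def set_lebesgue_integral_def by auto
  qed
  show "Lloc q (\<lambda>x. b x - c)"
    unfolding Lloc_def
  proof (intro conjI allI)
    fix Q
    define m where "m = \<bar>avg b Q - c\<bar>"
    have "dintegrable (\<lambda>x. 2 powr q * (\<bar>b x - avg b Q\<bar> powr q + m powr q)) Q"
      using int[of Q] by (intro set_integrable_mult_right set_integral_add) auto
    then show "dintegrable (\<lambda>x. \<bar>b x - c\<bar> powr q) Q"
    proof (rule dintegrable_bound)
      fix x
      define u where "u = \<bar>b x - avg b Q\<bar>"
      have "\<bar>b x - c\<bar> \<le> 2 * max u m" unfolding u_def m_def by (rule abs_diff_le_two_max)
      then have "\<bar>b x - c\<bar> powr q \<le> (2 * max u m) powr q"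
        using q by (intro powr_mono2) auto
      also have "\<dots> = 2 powr q * max u m powr q" by (simp add: powr_mult u_def m_def)
      also have "\<dots> \<le> 2 powr q * (u powr q + m powr q)" by (simp add: max_def)
      finally show "\<bar>\<bar>b x - c\<bar> powr q\<bar> \<le> \<bar>2 powr q * (\<bar>b x - avg b Q\<bar>
          powr q + m powr q)\<bar>"
        by (simp add: u_def)
    qed simp
  qed simp
  have "avg (\<lambda>x. \<bar>b x - avg b Q\<bar> powr q) Q \<le> jn_const q * B powr q"
    using int[of Q] unfolding avg_def by (simp add: pos_divide_le_eq)
  then have "lnorm q (\<lambda>x. b x - avg b Q) Q \<le> (jn_const q * B powr q) powr (1 / q)"
    unfolding lnorm_def using q by (intro powr_mono2) (auto intro: avg_nonneg)
  also have "\<dots> = jn_const q powr (1 / q) * B"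
    using B q by (simp add: powr_mult powr_powr jn_const_def)
  finally show "lnorm q (\<lambda>x. b x - avg b Q) Q \<le> jn_const q powr (1 / q) * B" .
qed

section \<open>Multilinear dyadic forms with a BMO symbol\<close>

lemma lnorm_mult:
  assumes u: "0 < u" "0 < q" "0 < t" "1 / u = 1 / q + 1 / t" and f: "Lloc q \<phi>" "Lloc t f"
  shows "Lloc u (\<lambda>x. \<phi> x * f x)" "lnorm u (\<lambda>x. \<phi> x * f x) Q \<le> 2 powr (1 / u) *
      (lnorm q \<phi> Q * lnorm t f Q)"
proof -
  \<comment> \<open>Hoelder for two factors, indexed by the booleans and applied to the powers of
    exponent \<open>u\<close>. The factor \<open>card\<close> is then 2 and becomes
    \<open>2 powr (1 / u)\<close> after taking the root.\<close>
  define F where "F j = (if j then (\<lambda>x. \<bar>\<phi> x\<bar> powr u) else (\<lambda>x. \<bar>f x\<bar>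
      powr u))" for j
  define p where "p j = (if j then q / u else t / u)" for j
  have m [measurable]: "\<phi> \<in> borel_measurable borel" "f \<in> borel_measurable borel"
    using f Lloc_measurable by auto
  have e: "u * (q / u) = q" "u * (t / u) = t" using u by auto
  have "1 / p True + 1 / p False = u * (1 / q + 1 / t)" by (simp add: p_def algebra_simps)
  also have "\<dots> = 1" using u by (simp flip: u(4))
  finally have sp: "(\<Sum>j\<in>UNIV. 1 / p j) = 1" by (simp add: UNIV_bool)
  have H: "dintegrable (\<lambda>x. \<Prod>j\<in>UNIV. \<bar>F j x\<bar>) Q"
    "avg (\<lambda>x. \<Prod>j\<in>UNIV. \<bar>F j x\<bar>) Q \<le> card (UNIV :: bool set) *
        (\<Prod>j\<in>UNIV. lnorm (p j) (F j) Q)" for Q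
  proof -
    have a: "0 < p j" "F j \<in> borel_measurable borel" "dintegrable (\<lambda>x. \<bar>F j x\<bar> powr p j)
        Q" for j
      using u Lloc_dintegrable[OF f(1), of Q] Lloc_dintegrable[OF f(2), of Q] by (cases j; simp add: p_def
          F_def powr_powr e)+
    show "dintegrable (\<lambda>x. \<Prod>j\<in>UNIV. \<bar>F j x\<bar>) Q"
      "avg (\<lambda>x. \<Prod>j\<in>UNIV. \<bar>F j x\<bar>) Q \<le> card (UNIV :: bool set) *
          (\<Prod>j\<in>UNIV. lnorm (p j) (F j) Q)"
      by (rule hoelder_avg[OF finite a(1) sp a(2) a(3)])+
  qed
  have pr: "(\<Prod>j\<in>UNIV. \<bar>F j x\<bar>) = \<bar>\<phi> x * f x\<bar> powr u" for x
    by (simp add: UNIV_bool F_def abs_mult powr_mult mult.commute)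
  show L: "Lloc u (\<lambda>x. \<phi> x * f x)" unfolding Lloc_def using H(1) unfolding pr by simp
  have n1: "lnorm (q / u) (\<lambda>x. \<bar>\<phi> x\<bar> powr u) Q = lnorm q \<phi> Q powr u" using u by
      (simp add: lnorm_of_powr)
  have n2: "lnorm (t / u) (\<lambda>x. \<bar>f x\<bar> powr u) Q = lnorm t f Q powr u" using u by (simp add:
      lnorm_of_powr)
  have "avg (\<lambda>x. \<bar>\<phi> x * f x\<bar> powr u) Q \<le> 2 * (lnorm q \<phi> Q powr u * lnorm t f Q
      powr u)"
    using H(2)[of Q] unfolding pr by (simp add: UNIV_bool p_def F_def n1 n2 mult.commute)
  then have "lnorm u (\<lambda>x. \<phi> x * f x) Q \<le> (2 * (lnorm q \<phi> Q powr u * lnorm t f Q powr u))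
      powr (1 / u)"
    unfolding lnorm_def using u by (intro powr_mono2) (auto intro: avg_nonneg)
  also have "\<dots> = 2 powr (1 / u) * (lnorm q \<phi> Q * lnorm t f Q)"
    using u(1) by (simp add: powr_mult powr_powr)
  finally show "lnorm u (\<lambda>x. \<phi> x * f x) Q \<le> 2 powr (1 / u) * (lnorm q \<phi> Q * lnorm t f Q)" .
qed

text \<open>The centre \<open>avg b J\<close> moves with \<open>J\<close>. With
  \<open>\<beta> = b - avg b Q\<close> for the fixed root, the coefficient splits into that of
  \<open>\<beta> * f\<close>, an ordinary pair with exponent \<open>u\<close> in the first slot, and
  \<open>avg \<beta> J\<close> times that of \<open>f\<close>, where \<open>\<beta>\<close> acts as
  a third slot of a Carleson sum. Strict inequality for the exponents leaves room for
  \<open>\<beta>\<close> in \<open>L^q\<close>.\<close>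

lemma pair_bound_bmo:
  assumes t: "1 < t1" "1 < t2" "1 / t1 + 1 / t2 < 1"
  shows "\<exists>C\<ge>0. \<forall>b B f g Q d. bmo_le b B \<longrightarrow> Lloc t1 f \<longrightarrow> Lloc
      t2 g \<longrightarrow>
    tsum (\<lambda>J. dlen J * (\<bar>hcoef (\<lambda>x. (b x - avg b J) * f x) J\<bar> * \<bar>hcoef g
        J\<bar>)) d Q \<le> C * B * (dlen Q * (lnorm t1 f Q * lnorm t2 g Q))"
proof -
  define q where "q = 1 / (1 - 1 / t1 - 1 / t2)"
  have q1: "1 / q = 1 - 1 / t1 - 1 / t2" by (simp add: q_def)
  have "0 < 1 / t1" "0 < 1 / t2" using t by auto
  then have q: "1 < q" using t(3) unfolding q_def by (subst less_divide_eq_1) linarith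
  define u where "u = 1 / (1 - 1 / t2)"
  have u1: "1 / u = 1 - 1 / t2" by (simp add: u_def)
  have u: "1 < u" using t by (simp add: u_def)
  have uqt: "1 / u = 1 / q + 1 / t1" using u1 q1 by simp
  have "1 / u + 1 / t2 \<le> 1" using u1 by simp
  from pair_bound[OF u t(2) this] obtain C1 where C1: "0 \<le> C1"
    and P1: "\<And>f g Q d. Lloc u f \<Longrightarrow> Lloc t2 g \<Longrightarrow>
      tsum (\<lambda>J. dlen J * (\<bar>hcoef f J\<bar> * \<bar>hcoef g J\<bar>)) d Q \<le> C1 * (dlen Q *
          (lnorm u f Q * lnorm t2 g Q))" by blast
  \<comment> \<open>Shrinking by \<open>\<sigma> < 1\<close> yields a pair bound at exponents
    strictly below \<open>t1\<close> and \<open>t2\<close>, the gap required by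
    \<open>carleson_multilinear\<close>.\<close>
  define \<sigma> where "\<sigma> = 1 / t1 + 1 / t2"
  have \<sigma>: "0 < \<sigma>" "\<sigma> < 1" "t1 * \<sigma> = 1 + t1 / t2" "t2 * \<sigma> = 1 + t2 / t1"
      using t by (auto simp: \<sigma>_def field_simps add_pos_pos)
  have g1: "1 < t1 * \<sigma>" "1 < t2 * \<sigma>" unfolding \<sigma>(3,4) using t by auto
  have "1 / (t1 * \<sigma>) + 1 / (t2 * \<sigma>) = (1 / t1 + 1 / t2) / \<sigma>" by (simp add: add_divide_distrib)
  also have "\<dots> = 1" using \<sigma> by (simp add: \<sigma>_def)
  finally have "1 / (t1 * \<sigma>) + 1 / (t2 * \<sigma>) \<le> 1" by simp
  from pair_bound[OF g1 this] obtain C2 where C2: "0 \<le> C2"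
    and P2: "\<And>f g Q d. Lloc (t1 * \<sigma>) f \<Longrightarrow> Lloc (t2 * \<sigma>) g \<Longrightarrow>
      tsum (\<lambda>J. dlen J * (\<bar>hcoef f J\<bar> * \<bar>hcoef g J\<bar>)) d Q \<le> C2 * (dlen Q *
          (lnorm (t1 * \<sigma>) f Q * lnorm (t2 * \<sigma>) g Q))" by blast
  have le: "t1 * \<sigma> < t1" "t2 * \<sigma> < t2" using mult_strict_left_mono[OF \<sigma>(2), of t1]
      mult_strict_left_mono[OF \<sigma>(2), of t2] t by auto
  define S where "S = {0, 1, 2::nat}"
  define \<tau> where "\<tau> j = (if j = 0 then t1 * \<sigma> else if j = 1 then t2 * \<sigma> else 1)" for j :: nat
  define p where "p j = (if j = 0 then t1 else if j = 1 then t2 else q)" for j :: nat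
  have "\<exists>C\<ge>0. \<forall>a f K Q d. (\<forall>j\<in>S. Lloc (p j) (f j)) \<longrightarrow>
      (\<forall>J. 0 \<le> a J) \<longrightarrow> 0 \<le> K \<longrightarrow>
    (\<forall>J d'. dint J \<subseteq> dint Q \<longrightarrow> tsum a d' J \<le> K * (dlen J * (lnorm (\<tau>
        0) (f 0) J * lnorm (\<tau> 1) (f 1) J))) \<longrightarrow>
    tsum (\<lambda>J. a J * (\<Prod>j\<in>S-{0,1}. lnorm (\<tau> j) (f j) J)) d Q \<le> C * K * (dlen Q *
        (\<Prod>j\<in>S. lnorm (p j) (f j) Q))"
  proof (rule carleson_multilinear)
    show "(\<Sum>j\<in>S. 1 / p j) = 1" using q1 by (simp add: S_def p_def)
  qed (use g1 le q in \<open>auto simp: S_def \<tau>_def p_def\<close>)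
  then obtain C3 where C3: "0 \<le> C3" and C3'': "\<forall>a f K Q d. (\<forall>j\<in>S. Lloc (p j) (f j))
      \<longrightarrow> (\<forall>J. 0 \<le> a J) \<longrightarrow> 0 \<le> K \<longrightarrow>
    (\<forall>J d'. dint J \<subseteq> dint Q \<longrightarrow> tsum a d' J \<le> K * (dlen J * (lnorm (\<tau>
        0) (f 0) J * lnorm (\<tau> 1) (f 1) J))) \<longrightarrow>
    tsum (\<lambda>J. a J * (\<Prod>j\<in>S-{0,1}. lnorm (\<tau> j) (f j) J)) d Q \<le> C3 * K * (dlen Q *
        (\<Prod>j\<in>S. lnorm (p j) (f j) Q))"
    by (elim exE conjE) (rule that)
  note P3 = C3''[THEN spec, THEN spec, THEN spec, THEN spec, THEN spec, THEN mp, THEN mp, THEN mp, THEN mp]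
  define jn where "jn = jn_const q powr (1 / q)"
  have jn: "0 \<le> jn" by (simp add: jn_def)
  have main: "tsum (\<lambda>J. dlen J * (\<bar>hcoef (\<lambda>x. (b x - avg b J) * f x) J\<bar> * \<bar>hcoef
      g J\<bar>)) d Q
     \<le> (C1 * 2 powr (1 / u) * jn + C3 * C2 * jn) * B * (dlen Q * (lnorm t1 f Q * lnorm t2 g Q))"
    if b: "bmo_le b B" and f: "Lloc t1 f" and g: "Lloc t2 g" for b B f g Q d
  proof -
    define \<beta> where "\<beta> x = b x - avg b Q" for x
    have \<beta>L: "Lloc q \<beta>" and \<beta>n: "lnorm q \<beta> Q \<le> jn * B"
      using john_nirenberg[OF _ b, of q] q by (auto simp: \<beta>_def[abs_def] jn_def)
    have B: "0 < B" and b1: "Lloc 1 b" using b by (auto simp: bmo_le_def)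
    have bfL: "Lloc u (\<lambda>x. \<beta> x * f x)" and bfn: "lnorm u (\<lambda>x. \<beta> x * f x) Q \<le> 2
        powr (1 / u) * (lnorm q \<beta> Q * lnorm t1 f Q)"
      using lnorm_mult[OF _ _ _ uqt \<beta>L f] u q t by auto
    have n0: "0 \<le> dlen Q * (lnorm t1 f Q * lnorm t2 g Q)" by simp
    have dec: "\<bar>hcoef (\<lambda>x. (b x - avg b J) * f x) J\<bar> \<le> \<bar>hcoef (\<lambda>x. \<beta> x
        * f x) J\<bar> + \<bar>avg \<beta> J\<bar> * \<bar>hcoef f J\<bar>" for J
    proof -
      have e: "avg \<beta> J = avg b J - avg b Q" unfolding \<beta>_def using Lloc_one[OF b1] by (simp add: avg_diff)
      have "(\<lambda>x. (b x - avg b J) * f x) = (\<lambda>x. \<beta> x * f x - avg \<beta> J * f x)"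
        unfolding e by (simp add: \<beta>_def algebra_simps)
      then have "hcoef (\<lambda>x. (b x - avg b J) * f x) J = hcoef (\<lambda>x. \<beta> x * f x) J - avg
          \<beta> J * hcoef f J"
        using Lloc_one[OF bfL] Lloc_one[OF f] u t by (simp add: hcoef_diff hcoef_cmult)
      then show ?thesis by (simp add: abs_mult[symmetric])
    qed
    have "tsum (\<lambda>J. dlen J * (\<bar>hcoef (\<lambda>x. (b x - avg b J) * f x) J\<bar> * \<bar>hcoef g
        J\<bar>)) d Q
      \<le> tsum (\<lambda>J. dlen J * (\<bar>hcoef (\<lambda>x. \<beta> x * f x) J\<bar> * \<bar>hcoef g
          J\<bar>) + dlen J * (\<bar>hcoef f J\<bar> * \<bar>hcoef g J\<bar>) * lnorm 1 \<beta> J) d Q"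
    proof (rule tsum_mono)
      fix J
      have "\<bar>avg \<beta> J\<bar> \<le> lnorm 1 \<beta> J" unfolding lnorm_1 using Lloc_one[OF \<beta>L] q
          by (intro abs_avg_le) auto
      then have "\<bar>hcoef (\<lambda>x. (b x - avg b J) * f x) J\<bar> \<le> \<bar>hcoef (\<lambda>x. \<beta>
          x * f x) J\<bar> + lnorm 1 \<beta> J * \<bar>hcoef f J\<bar>"
        using dec[of J] mult_right_mono[of "\<bar>avg \<beta> J\<bar>" "lnorm 1 \<beta> J" "\<bar>hcoef f
            J\<bar>"] by simp
      then have "dlen J * (\<bar>hcoef (\<lambda>x. (b x - avg b J) * f x) J\<bar> * \<bar>hcoef g J\<bar>)
         \<le> dlen J * ((\<bar>hcoef (\<lambda>x. \<beta> x * f x) J\<bar> + lnorm 1 \<beta> J * \<bar>hcoef f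
             J\<bar>) * \<bar>hcoef g J\<bar>)"
        by (intro mult_left_mono mult_right_mono) auto
      then show "dlen J * (\<bar>hcoef (\<lambda>x. (b x - avg b J) * f x) J\<bar> * \<bar>hcoef g J\<bar>)
         \<le> dlen J * (\<bar>hcoef (\<lambda>x. \<beta> x * f x) J\<bar> * \<bar>hcoef g J\<bar>) + dlen J *
             (\<bar>hcoef f J\<bar> * \<bar>hcoef g J\<bar>) * lnorm 1 \<beta> J"
        by (simp add: algebra_simps)
    qed
    also have "\<dots> = tsum (\<lambda>J. dlen J * (\<bar>hcoef (\<lambda>x. \<beta> x * f x) J\<bar> *
        \<bar>hcoef g J\<bar>)) d Q
       + tsum (\<lambda>J. dlen J * (\<bar>hcoef f J\<bar> * \<bar>hcoef g J\<bar>) * lnorm 1 \<beta> J) d Q"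
      by (rule tsum_add)
    also have "\<dots> \<le> C1 * (dlen Q * ((2 powr (1 / u) * (jn * B * lnorm t1 f Q)) * lnorm t2 g Q))
       + C3 * C2 * (dlen Q * (lnorm t1 f Q * lnorm t2 g Q * (jn * B)))"
    proof (rule add_mono)
      have "tsum (\<lambda>J. dlen J * (\<bar>hcoef (\<lambda>x. \<beta> x * f x) J\<bar> * \<bar>hcoef g
          J\<bar>)) d Q
        \<le> C1 * (dlen Q * (lnorm u (\<lambda>x. \<beta> x * f x) Q * lnorm t2 g Q))"
        by (rule P1[OF bfL g])
      also have "\<dots> \<le> C1 * (dlen Q * ((2 powr (1 / u) * (jn * B * lnorm t1 f Q)) * lnorm t2 g Q))"
        using C1 \<beta>n by (intro mult_left_mono mult_right_mono order_trans[OF bfn]) auto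
      finally show "tsum (\<lambda>J. dlen J * (\<bar>hcoef (\<lambda>x. \<beta> x * f x) J\<bar> * \<bar>hcoef
          g J\<bar>)) d Q
        \<le> C1 * (dlen Q * ((2 powr (1 / u) * (jn * B * lnorm t1 f Q)) * lnorm t2 g Q))" .
    next
      define F where "F j = (if j = 0 then f else if j = 1 then g else \<beta>)" for j :: nat
      have "tsum (\<lambda>J. dlen J * (\<bar>hcoef f J\<bar> * \<bar>hcoef g J\<bar>) * (\<Prod>j\<in>S-{0,1}.
          lnorm (\<tau> j) (F j) J)) d Q
          \<le> C3 * C2 * (dlen Q * (\<Prod>j\<in>S. lnorm (p j) (F j) Q))"
      proof (rule P3)
        show "\<forall>j\<in>S. Lloc (p j) (F j)" using f g \<beta>L by (auto simp: S_def p_def F_def)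
        show "\<forall>J. 0 \<le> dlen J * (\<bar>hcoef f J\<bar> * \<bar>hcoef g J\<bar>)" by simp
        show "\<forall>J d'. dint J \<subseteq> dint Q \<longrightarrow> tsum (\<lambda>J. dlen J *
            (\<bar>hcoef f J\<bar> * \<bar>hcoef g J\<bar>)) d' J
          \<le> C2 * (dlen J * (lnorm (\<tau> 0) (F 0) J * lnorm (\<tau> 1) (F 1) J))"
          using P2[OF Lloc_mono[OF f] Lloc_mono[OF g]] le g1 \<sigma>(2) by (simp add: \<tau>_def F_def)
      qed (rule C2)
      moreover have "S - {0, 1} = {2}" by (auto simp: S_def)
      ultimately have "tsum (\<lambda>J. dlen J * (\<bar>hcoef f J\<bar> * \<bar>hcoef g J\<bar>) * lnorm 1
          \<beta> J) d Q
         \<le> C3 * C2 * (dlen Q * (lnorm t1 f Q * lnorm t2 g Q * lnorm q \<beta> Q))"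
        by (simp add: S_def \<tau>_def F_def p_def mult.assoc)
      also have "\<dots> \<le> C3 * C2 * (dlen Q * (lnorm t1 f Q * lnorm t2 g Q * (jn * B)))"
        using C3 C2 \<beta>n by (intro mult_left_mono) auto
      finally show "tsum (\<lambda>J. dlen J * (\<bar>hcoef f J\<bar> * \<bar>hcoef g J\<bar>) * lnorm 1
          \<beta> J) d Q
         \<le> C3 * C2 * (dlen Q * (lnorm t1 f Q * lnorm t2 g Q * (jn * B)))" .
    qed
    also have "\<dots> = (C1 * 2 powr (1 / u) * jn + C3 * C2 * jn) * B * (dlen Q * (lnorm t1 f Q * lnorm t2 g Q))"
      by (simp add: algebra_simps)
    finally show ?thesis .
  qed
  have "0 \<le> C1 * 2 powr (1 / u) * jn + C3 * C2 * jn" using C1 C2 C3 jn by simp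
  with main show ?thesis by blast
qed

section \<open>Forms with arbitrarily many slots\<close>

definition scoef :: "(real \<Rightarrow> real) \<Rightarrow> int \<times> int \<Rightarrow> nat \<Rightarrow>
    real" where
  "scoef f J a = (if a = 0 then hcoef f J else avg f J)"

lemma abs_scoef_le: "dintegrable f J \<Longrightarrow> \<bar>scoef f J a\<bar> \<le> avg (\<lambda>x. \<bar>f
    x\<bar>) J"
  by (simp add: scoef_def abs_avg_le abs_hcoef_le)

text \<open>Two Haar slots supply the Carleson family and all other slots are bounded by local
  norms. If the symbol sits in one of the two, \<open>pair_bound_bmo\<close> gives the Carleson
  bound. Otherwise the symbol slot is one of the remaining factors, and John-Nirenberg with Hoelder
  turns it into a local norm of \<open>f i\<close> times \<open>B\<close>.\<close>

lemma form_bound: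
  fixes p :: "nat \<Rightarrow> real" and \<alpha> :: "nat \<Rightarrow> nat"
  assumes fin: "finite S" and card: "3 \<le> card S" and i: "i \<in> S" and kl: "k \<in> S" "l \<in> S" "k
      \<noteq> l" "\<alpha> k = 0" "\<alpha> l = 0"
    and p: "\<And>j. j \<in> S \<Longrightarrow> 1 < p j" and sp: "(\<Sum>j\<in>S. 1 / p j) = 1"
  shows "\<exists>C\<ge>0. \<forall>b B f Q d. bmo_le b B \<longrightarrow> (\<forall>j\<in>S. Lloc (p j) (f
      j)) \<longrightarrow>
    tsum (\<lambda>J. dlen J * (\<bar>scoef (\<lambda>x. (b x - avg b J) * f i x) J (\<alpha> i)\<bar> *
        (\<Prod>j\<in>S-{i}. \<bar>scoef (f j) J (\<alpha> j)\<bar>))) d Q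
      \<le> C * B * (dlen Q * (\<Prod>j\<in>S. lnorm (p j) (f j) Q))"
proof -
  \<comment> \<open>Relabelled so that the symbol slot \<open>i\<close> is either the first of the
    two Haar slots or neither of them.\<close>
  define k' where "k' = (if i = k \<or> i = l then i else k)"
  define l' where "l' = (if i = l then k else l)"
  have kl': "k' \<in> S" "l' \<in> S" "k' \<noteq> l'" "\<alpha> k' = 0" "\<alpha> l' = 0" "l' \<noteq> i" "i
      \<noteq> k' \<Longrightarrow> i \<notin> {k', l'}"
    using kl i by (auto simp: k'_def l'_def)
  define \<sigma> where "\<sigma> = 1 / p k' + 1 / p l'"
  have \<sigma>: "0 < \<sigma>" "\<sigma> < 1"
  proof -
    show "0 < \<sigma>" using p[OF kl'(1)] p[OF kl'(2)] by (simp add: \<sigma>_def add_pos_pos)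
    \<comment> \<open>A third slot takes a positive share of the total 1, so the two Haar slots use
      up strictly less.\<close>
    have "card {k', l'} < card S" using card kl' by simp
    then have "\<not> S \<subseteq> {k', l'}" by (metis card_mono finite.emptyI finite.insertI not_less)
    then obtain n where n: "n \<in> S" "n \<noteq> k'" "n \<noteq> l'" by auto
    have "\<sigma> + 1 / p n = (\<Sum>j\<in>{k', l', n}. 1 / p j)" using n kl' by (simp add: \<sigma>_def)
    also have "\<dots> \<le> (\<Sum>j\<in>S. 1 / p j)"
      using fin n kl' p by (intro sum_mono2) (auto intro: order_trans[OF zero_le_one less_imp_le])
    finally show "\<sigma> < 1" using sp p[OF n(1)] by (smt (verit) zero_less_divide_1_iff)
  qed
  \<comment> \<open>Any \<open>\<theta>\<close> strictly between 1 and \<open>A\<close> works: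
    \<open>\<theta> < p j\<close> keeps the lowered exponents \<open>p j / \<theta>\<close> above 1,
    and \<open>\<theta> * \<sigma> < 1\<close> keeps the Haar pair within the reach of the pair
    bounds.\<close>
  define A where "A = Min (insert (1 / \<sigma>) (p ` S))"
  have A: "1 < A" unfolding A_def using fin \<sigma> p by (subst Min_gr_iff) auto
  define \<theta> where "\<theta> = (1 + A) / 2"
  have \<theta>: "1 < \<theta>" "\<theta> < A" using A by (auto simp: \<theta>_def)
  have \<theta>p: "\<theta> < p j" if "j \<in> S" for j
    using \<theta>(2) that fin by (auto simp: A_def)
  have \<theta>\<sigma>: "\<theta> * \<sigma> < 1"
  proof -
    have "\<theta> < 1 / \<sigma>" using \<theta>(2) fin by (auto simp: A_def)
    then show ?thesis using \<sigma> by (simp add: field_simps)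
  qed
  define \<tau> where "\<tau> j = p j / \<theta>" for j
  have \<tau>: "1 < \<tau> j" "\<tau> j < p j" if "j \<in> S" for j
    using \<theta> \<theta>p[OF that] p[OF that] by (auto simp: \<tau>_def field_simps)
  have \<tau>kl: "1 / \<tau> k' + 1 / \<tau> l' < 1" using \<theta>\<sigma> by (simp add: \<tau>_def
      \<sigma>_def distrib_left)
  have "\<exists>C\<ge>0. \<forall>a f K Q d. (\<forall>j\<in>S. Lloc (p j) (f j)) \<longrightarrow>
      (\<forall>J. 0 \<le> a J) \<longrightarrow> 0 \<le> K \<longrightarrow>
    (\<forall>J d'. dint J \<subseteq> dint Q \<longrightarrow> tsum a d' J \<le> K * (dlen J * (lnorm (\<tau>
        k') (f k') J * lnorm (\<tau> l') (f l') J))) \<longrightarrow>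
    tsum (\<lambda>J. a J * (\<Prod>j\<in>S-{k',l'}. lnorm (\<tau> j) (f j) J)) d Q \<le> C * K * (dlen Q *
        (\<Prod>j\<in>S. lnorm (p j) (f j) Q))"
    using \<tau> by (intro carleson_multilinear fin kl' sp) force+
  then obtain C0 where C0: "0 \<le> C0" and C0'': "\<forall>a f K Q d. (\<forall>j\<in>S. Lloc (p j) (f j))
      \<longrightarrow> (\<forall>J. 0 \<le> a J) \<longrightarrow> 0 \<le> K \<longrightarrow>
    (\<forall>J d'. dint J \<subseteq> dint Q \<longrightarrow> tsum a d' J \<le> K * (dlen J * (lnorm (\<tau>
        k') (f k') J * lnorm (\<tau> l') (f l') J))) \<longrightarrow>
    tsum (\<lambda>J. a J * (\<Prod>j\<in>S-{k',l'}. lnorm (\<tau> j) (f j) J)) d Q \<le> C0 * K * (dlen Q *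
        (\<Prod>j\<in>S. lnorm (p j) (f j) Q))"
    by (elim exE conjE) (rule that)
  note P0 = C0''[THEN spec, THEN spec, THEN spec, THEN spec, THEN spec, THEN mp, THEN mp, THEN mp, THEN mp]
  have ncn: "\<bar>scoef (f j) J a\<bar> \<le> lnorm (\<tau> j) (f j) J" if "j \<in> S" "Lloc (p j) (f j)" for f j J a
  proof -
    have L: "Lloc (\<tau> j) (f j)" using \<tau>[OF that(1)] Lloc_mono[OF that(2), of "\<tau> j"] by auto
    have "\<bar>scoef (f j) J a\<bar> \<le> lnorm 1 (f j) J" unfolding lnorm_1 using Lloc_one[OF L] \<tau>[OF
        that(1)] by (intro abs_scoef_le) auto
    also have "\<dots> \<le> lnorm (\<tau> j) (f j) J" using \<tau>[OF that(1)] by (intro lnorm_mono[OF L]) auto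
    finally show ?thesis .
  qed
  show ?thesis
  proof (cases "i = k'")
    case True
    obtain C1 where C1: "0 \<le> C1" and P1: "\<And>b B f g Q d. bmo_le b B \<Longrightarrow> Lloc (\<tau> k')
        f \<Longrightarrow> Lloc (\<tau> l') g \<Longrightarrow>
      tsum (\<lambda>J. dlen J * (\<bar>hcoef (\<lambda>x. (b x - avg b J) * f x) J\<bar> * \<bar>hcoef g
          J\<bar>)) d Q \<le> C1 * B * (dlen Q * (lnorm (\<tau> k') f Q * lnorm (\<tau> l') g Q))"
      using pair_bound_bmo[OF \<tau>(1)[OF kl'(1)] \<tau>(1)[OF kl'(2)] \<tau>kl] by blast
    have "tsum (\<lambda>J. dlen J * (\<bar>scoef (\<lambda>x. (b x - avg b J) * f i x) J (\<alpha> i)\<bar> *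
        (\<Prod>j\<in>S-{i}. \<bar>scoef (f j) J (\<alpha> j)\<bar>))) d Q
      \<le> (C0 * C1) * B * (dlen Q * (\<Prod>j\<in>S. lnorm (p j) (f j) Q))"
      if b: "bmo_le b B" and f: "\<forall>j\<in>S. Lloc (p j) (f j)" for b B f Q d
    proof -
      define a where "a J = dlen J * (\<bar>hcoef (\<lambda>x. (b x - avg b J) * f k' x) J\<bar> * \<bar>hcoef
          (f l') J\<bar>)" for J
      have Sl: "(\<Prod>j\<in>S-{i}. \<bar>scoef (f j) J (\<alpha> j)\<bar>) = \<bar>hcoef (f l') J\<bar> *
          (\<Prod>j\<in>S-{k',l'}. \<bar>scoef (f j) J (\<alpha> j)\<bar>)" for J
      proof -
        have "(\<Prod>j\<in>S-{i}. \<bar>scoef (f j) J (\<alpha> j)\<bar>) = \<bar>scoef (f l') J (\<alpha>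
            l')\<bar> * (\<Prod>j\<in>S-{i}-{l'}. \<bar>scoef (f j) J (\<alpha> j)\<bar>)"
          using fin kl' by (intro prod.remove) auto
        moreover have "S - {i} - {l'} = S - {k', l'}" using True by auto
        ultimately show ?thesis using kl' by (simp add: scoef_def)
      qed
      have "tsum (\<lambda>J. dlen J * (\<bar>scoef (\<lambda>x. (b x - avg b J) * f i x) J (\<alpha> i)\<bar>
          * (\<Prod>j\<in>S-{i}. \<bar>scoef (f j) J (\<alpha> j)\<bar>))) d Q
        = tsum (\<lambda>J. a J * (\<Prod>j\<in>S-{k',l'}. \<bar>scoef (f j) J (\<alpha> j)\<bar>)) d Q"
        unfolding Sl using True kl' by (simp add: a_def scoef_def mult.assoc)
      also have "\<dots> \<le> tsum (\<lambda>J. a J * (\<Prod>j\<in>S-{k',l'}. lnorm (\<tau> j) (f j) J)) d Q"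
        using f by (intro tsum_mono mult_left_mono prod_mono) (auto intro: ncn simp: a_def)
      also have "\<dots> \<le> C0 * (C1 * B) * (dlen Q * (\<Prod>j\<in>S. lnorm (p j) (f j) Q))"
      proof (rule P0[OF f])
        show "\<forall>J. 0 \<le> a J" by (simp add: a_def)
        show "0 \<le> C1 * B" using C1 b by (simp add: bmo_le_def)
        have "Lloc (\<tau> k') (f k')" "Lloc (\<tau> l') (f l')"
          using \<tau>[OF kl'(1)] \<tau>[OF kl'(2)] f kl' Lloc_mono[of "p k'" "f k'" "\<tau> k'"] Lloc_mono[of
              "p l'" "f l'" "\<tau> l'"] by auto
        then show "\<forall>J d'. dint J \<subseteq> dint Q \<longrightarrow> tsum a d' J \<le> C1 * B * (dlen
            J * (lnorm (\<tau> k') (f k') J * lnorm (\<tau> l') (f l') J))"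
          unfolding a_def using P1[OF b] by blast
      qed
      finally show ?thesis by (simp add: mult.assoc)
    qed
    then show ?thesis using C0 C1 by (intro exI[of _ "C0 * C1"]) auto
  next
    case False
    have "1 / \<tau> k' + 1 / \<tau> l' \<le> 1" using \<tau>kl by simp
    from pair_bound[OF \<tau>(1)[OF kl'(1)] \<tau>(1)[OF kl'(2)] this] obtain C1 where C1: "0 \<le> C1"
      and P1: "\<And>f g Q d. Lloc (\<tau> k') f \<Longrightarrow> Lloc (\<tau> l') g \<Longrightarrow>
      tsum (\<lambda>J. dlen J * (\<bar>hcoef f J\<bar> * \<bar>hcoef g J\<bar>)) d Q \<le> C1 * (dlen Q *
          (lnorm (\<tau> k') f Q * lnorm (\<tau> l') g Q))" by blast
    define q where "q = 1 / (1 - 1 / \<tau> i)"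
    have q1: "1 / 1 = 1 / q + 1 / \<tau> i" by (simp add: q_def)
    have q: "1 < q" using \<tau>[OF i] by (simp add: q_def)
    define jn where "jn = 2 * jn_const q powr (1 / q)"
    have jn: "0 \<le> jn" by (simp add: jn_def)
    have "tsum (\<lambda>J. dlen J * (\<bar>scoef (\<lambda>x. (b x - avg b J) * f i x) J (\<alpha> i)\<bar> *
        (\<Prod>j\<in>S-{i}. \<bar>scoef (f j) J (\<alpha> j)\<bar>))) d Q
      \<le> (C0 * C1 * jn) * B * (dlen Q * (\<Prod>j\<in>S. lnorm (p j) (f j) Q))"
      if b: "bmo_le b B" and f: "\<forall>j\<in>S. Lloc (p j) (f j)" for b B f Q d
    proof -
      have B: "0 < B" using b by (simp add: bmo_le_def)
      define a where "a J = dlen J * (\<bar>hcoef (f k') J\<bar> * \<bar>hcoef (f l') J\<bar>)" for J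
      define R where "R = S - {k', l'} - {i}"
      have SR: "S - {k', l'} = insert i R" "i \<notin> R" "finite R" "S - {i} = insert k' (insert l' R)" "k'
          \<notin> insert l' R" "l' \<notin> R"
        using False fin kl' i by (auto simp: R_def)
      have Li: "Lloc (\<tau> i) (f i)" using \<tau>[OF i] f i Lloc_mono[of "p i" "f i" "\<tau> i"] by auto
      have bi: "\<bar>scoef (\<lambda>x. (b x - avg b J) * f i x) J (\<alpha> i)\<bar> \<le> jn * B * lnorm
          (\<tau> i) (f i) J" for J
      proof -
        note jnb = john_nirenberg[OF less_imp_le[OF q] b]
        have t0: "0 < \<tau> i" "0 < q" using \<tau>[OF i] q by auto
        note m = lnorm_mult[OF _ t0(2) t0(1) q1 jnb(1)[of "avg b J"] Li]
        have "\<bar>scoef (\<lambda>x. (b x - avg b J) * f i x) J (\<alpha> i)\<bar> \<le> lnorm 1 (\<lambda>x.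
            (b x - avg b J) * f i x) J"
          unfolding lnorm_1 using Lloc_one[OF m(1)] by (intro abs_scoef_le) auto
        also have "\<dots> \<le> 2 * (lnorm q (\<lambda>x. b x - avg b J) J * lnorm (\<tau> i) (f i) J)" using
            m(2)[of J] by simp
        also have "\<dots> \<le> 2 * ((jn_const q powr (1 / q) * B) * lnorm (\<tau> i) (f i) J)"
          using jnb(2)[of J] by (intro mult_left_mono mult_right_mono) auto
        finally show ?thesis by (simp add: jn_def mult_ac)
      qed
      have "tsum (\<lambda>J. dlen J * (\<bar>scoef (\<lambda>x. (b x - avg b J) * f i x) J (\<alpha> i)\<bar>
          * (\<Prod>j\<in>S-{i}. \<bar>scoef (f j) J (\<alpha> j)\<bar>))) d Q
        \<le> tsum (\<lambda>J. (jn * B) * (a J * (\<Prod>j\<in>S-{k',l'}. lnorm (\<tau> j) (f j) J))) d Q"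
      proof (rule tsum_mono)
        fix J
        have "(\<Prod>j\<in>R. \<bar>scoef (f j) J (\<alpha> j)\<bar>) \<le> (\<Prod>j\<in>R. lnorm (\<tau> j)
            (f j) J)"
          using f by (intro prod_mono) (auto intro: ncn simp: R_def)
        then have "\<bar>scoef (\<lambda>x. (b x - avg b J) * f i x) J (\<alpha> i)\<bar> * (\<Prod>j\<in>R.
            \<bar>scoef (f j) J (\<alpha> j)\<bar>)
          \<le> (jn * B * lnorm (\<tau> i) (f i) J) * (\<Prod>j\<in>R. lnorm (\<tau> j) (f j) J)"
          using bi[of J] jn B by (intro mult_mono) (auto intro!: prod_nonneg)
        then have "a J * (\<bar>scoef (\<lambda>x. (b x - avg b J) * f i x) J (\<alpha> i)\<bar> *
            (\<Prod>j\<in>R. \<bar>scoef (f j) J (\<alpha> j)\<bar>))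
          \<le> a J * ((jn * B * lnorm (\<tau> i) (f i) J) * (\<Prod>j\<in>R. lnorm (\<tau> j) (f j) J))"
          by (intro mult_left_mono) (auto simp: a_def)
        then show "dlen J * (\<bar>scoef (\<lambda>x. (b x - avg b J) * f i x) J (\<alpha> i)\<bar> *
            (\<Prod>j\<in>S-{i}. \<bar>scoef (f j) J (\<alpha> j)\<bar>))
          \<le> (jn * B) * (a J * (\<Prod>j\<in>S-{k',l'}. lnorm (\<tau> j) (f j) J))"
          using SR kl' by (simp add: a_def scoef_def[of "f k'"] scoef_def[of "f l'"] mult_ac)
      qed
      also have "\<dots> = (jn * B) * tsum (\<lambda>J. a J * (\<Prod>j\<in>S-{k',l'}. lnorm (\<tau> j) (f j) J)) d Q"
        by (rule tsum_cmult)
      also have "\<dots> \<le> (jn * B) * (C0 * C1 * (dlen Q * (\<Prod>j\<in>S. lnorm (p j) (f j) Q)))"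
      proof (rule mult_left_mono)
        show "tsum (\<lambda>J. a J * (\<Prod>j\<in>S-{k',l'}. lnorm (\<tau> j) (f j) J)) d Q \<le> C0 * C1 *
            (dlen Q * (\<Prod>j\<in>S. lnorm (p j) (f j) Q))"
        proof (rule P0[OF f _ C1])
          show "\<forall>J. 0 \<le> a J" by (simp add: a_def)
          have "Lloc (\<tau> k') (f k')" "Lloc (\<tau> l') (f l')"
            using \<tau>[OF kl'(1)] \<tau>[OF kl'(2)] f kl' Lloc_mono[of "p k'" "f k'" "\<tau> k'"]
                Lloc_mono[of "p l'" "f l'" "\<tau> l'"] by auto
          then show "\<forall>J d'. dint J \<subseteq> dint Q \<longrightarrow> tsum a d' J \<le> C1 * (dlen J
              * (lnorm (\<tau> k') (f k') J * lnorm (\<tau> l') (f l') J))"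
            unfolding a_def using P1 by blast
        qed
      qed (use jn B in auto)
      finally show ?thesis by (simp add: mult_ac)
    qed
    then show ?thesis using C0 C1 jn by (intro exI[of _ "C0 * C1 * jn"]) auto
  qed
qed

section \<open>Almost everywhere convergence of Haar series\<close>

text \<open>Each \<open>J\<close> spreads its value \<open>c J\<close> over its own points; read
  pointwise, the tree sum becomes a sum along the branch through \<open>x\<close>.\<close>

lemma tsum_integral:
  "tsum (\<lambda>J. dlen J * c J) d Q = dinteg (\<lambda>x. \<Sum>k<d. c (dyad (snd Q + int k) x)) Q"
proof (induction d arbitrary: Q)
  case (Suc d)
  let ?g = "\<lambda>x. \<Sum>k<d. c (dyad (snd Q + 1 + int k) x)"
  have i: "dintegrable ?g Q"
  proof (rule dintegrable_sum)
    fix k show "dintegrable (\<lambda>x. c (dyad (snd Q + 1 + int k) x)) Q"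
      using dbounded_dintegrable[OF dbounded_dyad[of c Q "Suc k"]] by (simp add: algebra_simps)
  qed
  have "dinteg (\<lambda>x. \<Sum>k<Suc d. c (dyad (snd Q + int k) x)) Q = dinteg (\<lambda>x. c Q + ?g x) Q"
  proof (rule dinteg_cong)
    fix x assume "x \<in> dint Q"
    then show "(\<Sum>k<Suc d. c (dyad (snd Q + int k) x)) = c Q + ?g x"
      unfolding sum.lessThan_Suc_shift by (simp add: dyad_eqI algebra_simps)
  qed
  also have "\<dots> = c Q * dlen Q + dinteg ?g Q" using i by simp
  also have "\<dots> = tsum (\<lambda>J. dlen J * c J) (Suc d) Q"
    using Suc[of "dleft Q"] Suc[of "dright Q"] dinteg_split[OF i] by simp
  finally show ?case by simp
qed simp

text \<open>A convergent sequence is bounded, so differentiation of \<open>\<bar>f\<bar>\<close>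
  gives the finiteness of the maximal function over small intervals, without a weak type
  estimate.\<close>

lemma avg_bounded_AE:
  assumes "Lloc s f" "1 \<le> s"
  shows "AE x in lborel. \<exists>M>0. \<forall>k::nat. avg (\<lambda>x. \<bar>f x\<bar>) (dyad (int k) x) \<le> M"
proof -
  have "Lloc 1 (\<lambda>x. \<bar>f x\<bar>)"
    using Lloc_one[OF assms] Lloc_measurable[OF assms(1)] by (simp add: Lloc_1_iff)
  from dyadic_differentiation[OF this] show ?thesis
  proof eventually_elim
    case (elim x)
    then have "(\<lambda>n. avg (\<lambda>x. \<bar>f x\<bar>) (dyad (0 + int n) x)) \<longlonglongrightarrow>
        \<bar>f x\<bar>" by blast
    then have "Bseq (\<lambda>n. avg (\<lambda>x. \<bar>f x\<bar>) (dyad (int n) x))"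
      by (intro convergent_imp_Bseq) (auto simp: convergent_def)
    then obtain M where "0 < M" and M: "\<And>n. norm (avg (\<lambda>x. \<bar>f x\<bar>) (dyad (int n) x)) \<le> M"
      by (auto simp: Bseq_def)
    have "avg (\<lambda>x. \<bar>f x\<bar>) (dyad (int n) x) \<le> M" for n using M[of n] by simp
    with \<open>0 < M\<close> show ?case by blast
  qed
qed

text \<open>Tree sums below a unit interval are integrals of partial sums along branches. Monotone
  convergence makes the full sum integrable, hence finite almost everywhere, and countably many unit
  intervals cover the line.\<close>

lemma summable_AE_of_tsum_bounded:
  assumes c: "\<And>J. 0 \<le> c J" and K: "\<And>d Q. snd Q = 0 \<Longrightarrow> tsum (\<lambda>J. dlen J * c
      J) d Q \<le> K Q"
  shows "AE x in lborel. summable (\<lambda>k. c (dyad (int k) x))"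
proof -
  have one: "AE x in lborel. x \<in> dint (n, 0) \<longrightarrow> summable (\<lambda>k. c (dyad (int k) x))" for n
  proof -
    let ?Q = "(n, 0) :: int \<times> int"
    let ?u = "\<lambda>k x. ennreal (indicator (dint ?Q) x * c (dyad (int k) x))"
    have i: "dintegrable (\<lambda>x. c (dyad (int k) x)) ?Q" for k
      using dbounded_dintegrable[OF dbounded_dyad[of c ?Q k]] by simp
    have u: "(\<integral>\<^sup>+x. ?u k x \<partial>lborel) = ennreal (dinteg (\<lambda>x. c (dyad (int k) x))
        ?Q)" for k
      using i[of k] c unfolding set_integrable_def set_lebesgue_integral_def
      by (subst nn_integral_eq_integral) auto
    have "(\<Sum>k<d. \<integral>\<^sup>+x. ?u k x \<partial>lborel) \<le> ennreal (K ?Q)" for d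
    proof -
      have "(\<Sum>k<d. \<integral>\<^sup>+x. ?u k x \<partial>lborel) = ennreal (\<Sum>k<d. dinteg
          (\<lambda>x. c (dyad (int k) x)) ?Q)"
        unfolding u by (intro sum_ennreal dinteg_nonneg c)
      also have "(\<Sum>k<d. dinteg (\<lambda>x. c (dyad (int k) x)) ?Q) = dinteg (\<lambda>x. \<Sum>k<d. c
          (dyad (int k) x)) ?Q"
        using i unfolding set_integrable_def set_lebesgue_integral_def scaleR_sum_right
        by (subst Bochner_Integration.integral_sum) auto
      also have "\<dots> = tsum (\<lambda>J. dlen J * c J) d ?Q" by (simp add: tsum_integral)
      also have "\<dots> \<le> K ?Q" by (rule K) simp
      finally show ?thesis by (simp add: ennreal_leI)
    qed
    then have "(\<Sum>k. \<integral>\<^sup>+x. ?u k x \<partial>lborel) \<le> ennreal (K ?Q)"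
      by (intro suminf_le_const) auto
    also have "(\<Sum>k. \<integral>\<^sup>+x. ?u k x \<partial>lborel) = (\<integral>\<^sup>+x. (\<Sum>k. ?u k
        x) \<partial>lborel)"
      by (rule nn_integral_suminf[symmetric]) simp
    finally have "(\<integral>\<^sup>+x. (\<Sum>k. ?u k x) \<partial>lborel) \<noteq> \<infinity>" by (auto
        simp: top_unique)
    then have "AE x in lborel. (\<Sum>k. ?u k x) \<noteq> \<infinity>"
      by (intro nn_integral_noteq_infinite) auto
    then show ?thesis
    proof eventually_elim
      case (elim x)
      show ?case
      proof
        assume "x \<in> dint ?Q"
        with elim have "(\<Sum>k. ennreal (c (dyad (int k) x))) \<noteq> top" by simp
        then show "summable (\<lambda>k. c (dyad (int k) x))" using c by (intro summable_suminf_not_top) auto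
      qed
    qed
  qed
  then have "AE x in lborel. \<forall>n. x \<in> dint (n, 0) \<longrightarrow> summable (\<lambda>k. c (dyad
      (int k) x))"
    unfolding AE_all_countable by blast
  then show ?thesis
  proof eventually_elim
    case (elim x)
    have "x \<in> dint (fst (dyad 0 x), 0)" using mem_dint_dyad[of x 0] by (simp add: dyad_def)
    with elim show ?case by blast
  qed
qed

lemma square_function_AE:
  assumes s: "1 < s" "s \<le> 2" and f: "Lloc s f"
  shows "AE x in lborel. summable (\<lambda>k. (hcoef f (dyad (int k) x))\<^sup>2)"
proof -
  let ?A = "avg (\<lambda>x. \<bar>f x\<bar>)"
  have "AE x in lborel. summable (\<lambda>k. (hcoef f (dyad (int k) x))\<^sup>2 * (?A (dyad (int k) x)) powr
      (s - 2))"
    by (rule summable_AE_of_tsum_bounded[where c = "\<lambda>J. (hcoef f J)\<^sup>2 * (?A J) powr (s - 2)"])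
      (use stein[OF s f] in auto)
  moreover have "AE x in lborel. \<exists>M>0. \<forall>k::nat. ?A (dyad (int k) x) \<le> M"
    using s by (intro avg_bounded_AE[OF f]) auto
  ultimately show ?thesis
  proof eventually_elim
    case (elim x)
    then obtain M where M: "0 < M" "\<And>k::nat. ?A (dyad (int k) x) \<le> M" by blast
    have "summable (\<lambda>k. M powr (2 - s) * ((hcoef f (dyad (int k) x))\<^sup>2 * (?A (dyad (int k) x))
        powr (s - 2)))"
      using elim(1) by (rule summable_mult)
    then show ?case
    proof (rule summable_comparison_test'[where N = 0])
      fix k :: nat
      define J where "J = dyad (int k) x"
      have h: "\<bar>hcoef f J\<bar> \<le> ?A J" using Lloc_one[OF f] s by (intro abs_hcoef_le) auto
      have A0: "0 \<le> ?A J" by (rule avg_nonneg) auto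
      have "(hcoef f J)\<^sup>2 \<le> M powr (2 - s) * ((hcoef f J)\<^sup>2 * ?A J powr (s - 2))"
      proof (cases "?A J = 0")
        case True
        with h show ?thesis by simp
      next
        case False
        have "1 = M powr (2 - s) * M powr (s - 2)" using M by (simp flip: powr_add)
        also have "\<dots> \<le> M powr (2 - s) * ?A J powr (s - 2)"
          using M(2)[of k] False A0 s by (intro mult_left_mono powr_mono2') (auto simp: J_def)
        finally have "(hcoef f J)\<^sup>2 * 1 \<le> (hcoef f J)\<^sup>2 * (M powr (2 - s) * ?A J powr (s - 2))"
          by (rule mult_left_mono) simp
        then show ?thesis by (simp only: mult_ac mult_1_left)
      qed
      then show "norm ((hcoef f (dyad (int k) x))\<^sup>2) \<le> M powr (2 - s) * ((hcoef f (dyad (int k)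
          x))\<^sup>2 * (?A (dyad (int k) x)) powr (s - 2))"
        by (simp add: J_def)
    qed
  qed
qed

section \<open>Haar series as dyadic martingales\<close>

definition hsgn :: "int \<times> int \<Rightarrow> real \<Rightarrow> real" where
  "hsgn I x = indicator (dint (dright I)) x - indicator (dint (dleft I)) x"

lemma hsgn_left: "x \<in> dint (dleft I) \<Longrightarrow> hsgn I x = -1"
  using dint_halves_disjoint[of I] by (auto simp: hsgn_def indicator_def)

lemma hsgn_right: "x \<in> dint (dright I) \<Longrightarrow> hsgn I x = 1"
  using dint_halves_disjoint[of I] by (auto simp: hsgn_def indicator_def)

lemma hsgn_outside: "x \<notin> dint I \<Longrightarrow> hsgn I x = 0"
  using dint_halves[of I] by (auto simp: hsgn_def indicator_def)

lemma abs_hsgn_le: "\<bar>hsgn I x\<bar> \<le> 1"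
  by (auto simp: hsgn_def indicator_def)

definition hpsum :: "(int \<times> int \<Rightarrow> real) \<Rightarrow> int \<Rightarrow> nat \<Rightarrow>
    real \<Rightarrow> real" where
  "hpsum A n j x = (\<Sum>k<j. A (dyad (n + int k) x) * hsgn (dyad (n + int k) x) x)"

text \<open>The sign at generation \<open>n\<close> is decided by whether the next interval around
  \<open>x\<close> is a left or a right child, so it is a function of two floors.\<close>

lemma hsgn_dyad_measurable [measurable]: "(\<lambda>x. hsgn (dyad n x) x) \<in> borel_measurable borel"
proof -
  have e: "hsgn (dyad n x) x = (if fst (dyad (n + 1) x) = 2 * fst (dyad n x) then -1 else 1)" for x
  proof -
    from dyad_child_cases[of n x] show ?thesis
    proof
      assume a: "dyad (n + 1) x = dleft (dyad n x)"
      then have "x \<in> dint (dleft (dyad n x))" using mem_dint_dyad[of x "n + 1"] by simp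
      then show ?thesis unfolding a by (simp add: hsgn_left dleft_def)
    next
      assume a: "dyad (n + 1) x = dright (dyad n x)"
      then have "x \<in> dint (dright (dyad n x))" using mem_dint_dyad[of x "n + 1"] by simp
      then show ?thesis unfolding a by (simp add: hsgn_right dright_def)
    qed
  qed
  have "(\<lambda>x. if fst (dyad (n + 1) x) = 2 * fst (dyad n x) then -1 else 1 :: real) \<in>
      borel_measurable borel"
    unfolding dyad_def fst_conv by measurable
  then show ?thesis unfolding e .
qed

lemma hpsum_measurable [measurable]: "hpsum A n j \<in> borel_measurable borel"
  unfolding hpsum_def by measurable

lemma hpsum_Suc:
  "hpsum A n (Suc j) x = A (dyad n x) * hsgn (dyad n x) x + hpsum A (n + 1) j x"
  unfolding hpsum_def sum.lessThan_Suc_shift by (simp add: algebra_simps)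

lemma kolmogorov_ineq_start:
  assumes \<delta>: "0 < \<delta>" and v: "\<delta> \<le> \<bar>v\<bar>"
  shows "emeasure lborel {x\<in>dint Q. \<exists>j\<le>d. \<delta> \<le> \<bar>v + hpsum A (snd Q) j x\<bar>}
     \<le> ennreal ((v\<^sup>2 * dlen Q + tsum (\<lambda>J. dlen J * (A J)\<^sup>2) d Q) / \<delta>\<^sup>2)"
proof -
  have "emeasure lborel {x\<in>dint Q. \<exists>j\<le>d. \<delta> \<le> \<bar>v + hpsum A (snd Q) j x\<bar>}
      \<le> emeasure lborel (dint Q)"
    by (intro emeasure_mono) auto
  also have "\<dots> = ennreal (dlen Q)" by (rule emeasure_dint)
  also have "\<dots> \<le> ennreal ((v\<^sup>2 * dlen Q + tsum (\<lambda>J. dlen J * (A J)\<^sup>2) d Q) /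
      \<delta>\<^sup>2)"
  proof (rule ennreal_leI)
    have "\<delta>\<^sup>2 \<le> v\<^sup>2" using v \<delta> by (metis abs_le_square_iff abs_of_pos)
    then have "\<delta>\<^sup>2 * dlen Q \<le> v\<^sup>2 * dlen Q" by (rule mult_right_mono) simp
    moreover have "0 \<le> tsum (\<lambda>J. dlen J * (A J)\<^sup>2) d Q" by (rule tsum_nonneg) simp
    ultimately have "dlen Q * \<delta>\<^sup>2 \<le> v\<^sup>2 * dlen Q + tsum (\<lambda>J. dlen J * (A
        J)\<^sup>2) d Q"
      by (simp only: mult.commute)
    then show "dlen Q \<le> (v\<^sup>2 * dlen Q + tsum (\<lambda>J. dlen J * (A J)\<^sup>2) d Q) / \<delta>\<^sup>2"
      using \<delta> by (subst pos_le_divide_eq) auto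
  qed
  finally show ?thesis .
qed

text \<open>The starting value \<open>v\<close> is what makes the induction close: the halves start
  at \<open>v - A Q\<close> and \<open>v + A Q\<close>, whose squares average to the sum of the
  squares of \<open>v\<close> and \<open>A Q\<close>, so the right-hand side is preserved. Once
  \<open>\<bar>v\<bar>\<close> reaches \<open>\<delta>\<close> the recursion stops and the whole
  interval is counted.\<close>

lemma kolmogorov_ineq:
  assumes \<delta>: "0 < \<delta>"
  shows "emeasure lborel {x\<in>dint Q. \<exists>j\<le>d. \<delta> \<le> \<bar>v + hpsum A (snd Q) j x\<bar>}
     \<le> ennreal ((v\<^sup>2 * dlen Q + tsum (\<lambda>J. dlen J * (A J)\<^sup>2) d Q) / \<delta>\<^sup>2)"
proof (induction d arbitrary: Q v)
  case 0
  show ?case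
  proof (cases "\<delta> \<le> \<bar>v\<bar>")
    case False
    then show ?thesis by (simp add: hpsum_def)
  qed (rule kolmogorov_ineq_start[OF \<delta>])
next
  case (Suc d)
  show ?case
  proof (cases "\<delta> \<le> \<bar>v\<bar>")
    case False
    define EL where "EL = {x\<in>dint (dleft Q). \<exists>j\<le>d. \<delta> \<le> \<bar>(v - A Q) + hpsum A
        (snd (dleft Q)) j x\<bar>}"
    define ER where "ER = {x\<in>dint (dright Q). \<exists>j\<le>d. \<delta> \<le> \<bar>(v + A Q) + hpsum A
        (snd (dright Q)) j x\<bar>}"
    have sub: "{x\<in>dint Q. \<exists>j\<le>Suc d. \<delta> \<le> \<bar>v + hpsum A (snd Q) j x\<bar>}
        \<subseteq> EL \<union> ER"
    proof
      fix x assume "x \<in> {x\<in>dint Q. \<exists>j\<le>Suc d. \<delta> \<le> \<bar>v + hpsum A (snd Q) j x\<bar>}"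
      then obtain j where x: "x \<in> dint Q" and j: "j \<le> Suc d" "\<delta> \<le> \<bar>v + hpsum A (snd Q)
          j x\<bar>" by auto
      have "j \<noteq> 0"
      proof
        assume "j = 0"
        then show False using j(2) False by (simp add: hpsum_def)
      qed
      then obtain i where i: "j = Suc i" "i \<le> d" using j(1) by (cases j) auto
      have e: "v + hpsum A (snd Q) j x = v + A Q * hsgn Q x + hpsum A (snd Q + 1) i x"
        unfolding i hpsum_Suc using x by (simp add: dyad_eqI)
      from x consider "x \<in> dint (dleft Q)" | "x \<in> dint (dright Q)" using dint_halves by blast
      then show "x \<in> EL \<union> ER"
      proof cases
        case 1
        then show ?thesis using j(2) i(2) unfolding e EL_def by (auto simp: hsgn_left)
      next
        case 2
        then show ?thesis using j(2) i(2) unfolding e ER_def by (auto simp: hsgn_right)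
      qed
    qed
    have meas: "EL \<in> sets lborel" "ER \<in> sets lborel" unfolding EL_def ER_def by measurable
    have "emeasure lborel {x\<in>dint Q. \<exists>j\<le>Suc d. \<delta> \<le> \<bar>v + hpsum A (snd Q) j
        x\<bar>} \<le> emeasure lborel (EL \<union> ER)"
      using sub meas by (intro emeasure_mono) auto
    also have "\<dots> \<le> emeasure lborel EL + emeasure lborel ER" using meas by (rule emeasure_subadditive)
    also have "\<dots> \<le> ennreal (((v - A Q)\<^sup>2 * dlen (dleft Q) + tsum (\<lambda>J. dlen J * (A
        J)\<^sup>2) d (dleft Q)) / \<delta>\<^sup>2)
       + ennreal (((v + A Q)\<^sup>2 * dlen (dright Q) + tsum (\<lambda>J. dlen J * (A J)\<^sup>2) d (dright
           Q)) / \<delta>\<^sup>2)"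
      unfolding EL_def ER_def by (intro add_mono Suc.IH)
    also have "\<dots> = ennreal (((v - A Q)\<^sup>2 * dlen (dleft Q) + tsum (\<lambda>J. dlen J * (A
        J)\<^sup>2) d (dleft Q)) / \<delta>\<^sup>2
       + ((v + A Q)\<^sup>2 * dlen (dright Q) + tsum (\<lambda>J. dlen J * (A J)\<^sup>2) d (dright Q)) /
           \<delta>\<^sup>2)"
      by (intro ennreal_plus[symmetric] divide_nonneg_nonneg add_nonneg_nonneg tsum_nonneg) auto
    also have "((v - A Q)\<^sup>2 * dlen (dleft Q) + tsum (\<lambda>J. dlen J * (A J)\<^sup>2) d (dleft Q)) /
        \<delta>\<^sup>2
       + ((v + A Q)\<^sup>2 * dlen (dright Q) + tsum (\<lambda>J. dlen J * (A J)\<^sup>2) d (dright Q)) /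
           \<delta>\<^sup>2
       = (v\<^sup>2 * dlen Q + tsum (\<lambda>J. dlen J * (A J)\<^sup>2) (Suc d) Q) / \<delta>\<^sup>2"
      by (simp add: add_divide_distrib[symmetric] power2_eq_square algebra_simps)
    finally show ?thesis .
  qed (rule kolmogorov_ineq_start[OF \<delta>])
qed

text \<open>The energies \<open>D n\<close> increase to a limit \<open>L\<close>, so the tails have
  energy at most \<open>L - D n\<close>, which tends to 0. Kolmogorov's inequality for the tails
  shows that points oscillating by \<open>\<delta>\<close> after every generation form a null set;
  countably many \<open>\<delta>\<close> give the Cauchy property.\<close>

lemma hpsum_convergent_of_L2:
  assumes K: "\<And>d. tsum (\<lambda>J. dlen J * (A J)\<^sup>2) d Q \<le> K"
  shows "AE x in lborel. x \<in> dint Q \<longrightarrow> convergent (\<lambda>j. hpsum A (snd Q) j x)"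
proof -
  define D where "D d = tsum (\<lambda>J. dlen J * (A J)\<^sup>2) d Q" for d
  have tree_mono: "dtree n Q \<subseteq> dtree d Q" if "n \<le> d" for n d
    using dtree_bounds[of _ n Q] dtreeI[of _ Q d] that by fastforce
  have "incseq D" unfolding D_def tsum_eq_sum incseq_def
    using tree_mono by (auto intro!: sum_mono2)
  moreover have "bdd_above (range D)" using K by (auto simp: D_def intro!: bdd_aboveI)
  ultimately obtain L where L: "D \<longlonglongrightarrow> L" using LIMSEQ_incseq_SUP by blast
  then have DL: "D d \<le> L" for d using \<open>incseq D\<close> incseq_le by blast
  \<comment> \<open>Zeroing the generations before the \<open>n\<close>-th keeps the root
    \<open>Q\<close>, and the partial sums from there on are the increments after generation
    \<open>n\<close>.\<close>
  define T where "T n J = (if snd Q + int n \<le> snd J then A J else 0)" for n J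
  have tail: "tsum (\<lambda>J. dlen J * (T n J)\<^sup>2) d Q \<le> L - D n" for n d
  proof -
    have fin: "finite (dtree (max n d) Q)" by simp
    have "tsum (\<lambda>J. dlen J * (T n J)\<^sup>2) d Q \<le> (\<Sum>J\<in>dtree (max n d) Q. dlen J * (T n
        J)\<^sup>2)"
      unfolding tsum_eq_sum using tree_mono[of d "max n d"] by (intro sum_mono2) auto
    also have "\<dots> = (\<Sum>J\<in>dtree (max n d) Q - dtree n Q. dlen J * (T n J)\<^sup>2)"
    proof (rule sum.mono_neutral_right)
      show "\<forall>J\<in>dtree (max n d) Q - (dtree (max n d) Q - dtree n Q). dlen J * (T n J)\<^sup>2 = 0"
        using dtree_bounds[of _ n Q] by (force simp: T_def)
    qed auto
    also have "\<dots> \<le> (\<Sum>J\<in>dtree (max n d) Q - dtree n Q. dlen J * (A J)\<^sup>2)"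
      by (intro sum_mono) (auto simp: T_def)
    also have "\<dots> = D (max n d) - D n"
      unfolding D_def tsum_eq_sum using tree_mono[of n "max n d"] by (simp add: sum_diff)
    also have "\<dots> \<le> L - D n" using DL by simp
    finally show ?thesis .
  qed
  have Thps: "hpsum (T n) (snd Q) j x = hpsum A (snd Q) j x - hpsum A (snd Q) n x" if "n \<le> j" for n j x
  proof -
    have "hpsum (T n) (snd Q) j x = (\<Sum>k\<in>{n..<j}. A (dyad (snd Q + int k) x) * hsgn (dyad (snd Q + int
        k) x) x)"
      unfolding hpsum_def by (rule sum.mono_neutral_cong_right) (auto simp: T_def)
    also have "\<dots> = hpsum A (snd Q) j x - hpsum A (snd Q) n x"
      unfolding hpsum_def using that by (simp add: lessThan_atLeast0 sum_diff_nat_ivl)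
    finally show ?thesis .
  qed
  define Bad where "Bad \<delta> n = {x\<in>dint Q. \<exists>j. \<delta> \<le> \<bar>0 + hpsum (T n) (snd Q) j
      x\<bar>}" for \<delta> n
  have Bm [measurable]: "Bad \<delta> n \<in> sets lborel" for \<delta> n unfolding Bad_def by measurable
  have Bad: "emeasure lborel (Bad \<delta> n) \<le> ennreal ((L - D n) / \<delta>\<^sup>2)" if \<delta>: "0 <
      \<delta>" for \<delta> n
  proof -
    define E where "E d = {x\<in>dint Q. \<exists>j\<le>d. \<delta> \<le> \<bar>0 + hpsum (T n) (snd Q) j
        x\<bar>}" for d
    have Em: "E d \<in> sets lborel" for d unfolding E_def by measurable
    have BE: "Bad \<delta> n = (\<Union>d. E d)" unfolding Bad_def E_def by auto
    have "incseq E" unfolding incseq_def E_def by (auto intro: order_trans)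
    then have "emeasure lborel (Bad \<delta> n) = (SUP d. emeasure lborel (E d))"
      unfolding BE using Em by (intro SUP_emeasure_incseq[symmetric]) auto
    also have "\<dots> \<le> ennreal ((L - D n) / \<delta>\<^sup>2)"
    proof (rule SUP_least)
      fix d
      have "emeasure lborel (E d) \<le> ennreal ((0\<^sup>2 * dlen Q + tsum (\<lambda>J. dlen J * (T n
          J)\<^sup>2) d Q) / \<delta>\<^sup>2)"
        unfolding E_def by (rule kolmogorov_ineq[OF \<delta>])
      also have "\<dots> \<le> ennreal ((L - D n) / \<delta>\<^sup>2)"
        using tail[of n d] by (intro ennreal_leI divide_right_mono) auto
      finally show "emeasure lborel (E d) \<le> ennreal ((L - D n) / \<delta>\<^sup>2)" .
    qed
    finally show ?thesis .
  qed
  have null: "(\<Inter>n. Bad \<delta> n) \<in> null_sets lborel" if \<delta>: "0 < \<delta>" for \<delta>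
  proof -
    have le: "emeasure lborel (\<Inter>n. Bad \<delta> n) \<le> ennreal ((L - D n) / \<delta>\<^sup>2)" for n
      by (rule order_trans[OF emeasure_mono Bad[OF \<delta>]]) (use Bm[of \<delta> n] in auto)
    have "(\<lambda>n. ennreal ((L - D n) / \<delta>\<^sup>2)) \<longlonglongrightarrow> ennreal ((L - L) /
        \<delta>\<^sup>2)"
      using L \<delta> by (intro tendsto_intros) auto
    then have "emeasure lborel (\<Inter>n. Bad \<delta> n) \<le> ennreal ((L - L) / \<delta>\<^sup>2)"
      by (rule LIMSEQ_le_const) (use le in auto)
    moreover have "(\<Inter>n. Bad \<delta> n) \<in> sets lborel" using Bm by (intro sets.countable_INT) auto
    ultimately show ?thesis by (intro null_setsI) auto
  qed
  have "AE x in lborel. \<forall>l::nat. x \<notin> (\<Inter>n. Bad (1 / real (Suc l)) n)"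
    unfolding AE_all_countable by (intro allI AE_not_in null) simp
  then show ?thesis
  proof eventually_elim
    case (elim x)
    show ?case
    proof
      assume x: "x \<in> dint Q"
      have "Cauchy (\<lambda>j. hpsum A (snd Q) j x)"
        unfolding Cauchy_altdef2
      proof (intro allI impI)
        fix e :: real assume "0 < e"
        then obtain l :: nat where l: "1 / real (Suc l) < e" using nat_approx_posE by blast
        from elim obtain n where "x \<notin> Bad (1 / real (Suc l)) n" by blast
        then have n: "\<bar>hpsum (T n) (snd Q) j x\<bar> < 1 / real (Suc l)" for j
          using x unfolding Bad_def by (auto simp: not_le)
        have "\<forall>j\<ge>n. dist (hpsum A (snd Q) j x) (hpsum A (snd Q) n x) < e"
          using n l by (metis Thps dist_real_def less_trans)
        then show "\<exists>N. \<forall>j\<ge>N. dist (hpsum A (snd Q) j x) (hpsum A (snd Q) N x) < e" by blast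
      qed
      then show "convergent (\<lambda>j. hpsum A (snd Q) j x)" by (simp add: Cauchy_convergent_iff)
    qed
  qed
qed

text \<open>Partial sums of nonnegative terms increase, so the surviving terms form an initial
  segment, and its total is the last partial sum still below \<open>L\<close>.\<close>

lemma stopped_sum_le:
  fixes a :: "nat \<Rightarrow> real"
  assumes "\<And>k. 0 \<le> a k" "0 \<le> L"
  shows "(\<Sum>k<d. if (\<Sum>i\<le>k. a i) \<le> L then a k else 0) \<le> L"
proof (induction d)
  case (Suc d)
  show ?case
  proof (cases "(\<Sum>i\<le>d. a i) \<le> L")
    case True
    have "(\<Sum>k<Suc d. if (\<Sum>i\<le>k. a i) \<le> L then a k else 0) \<le> (\<Sum>k<Suc d. a k)"
      using assms by (intro sum_mono) auto
    also have "\<dots> \<le> L" using True by (simp add: lessThan_Suc_atMost)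
    finally show ?thesis .
  qed (use Suc in simp)
qed (use assms in simp)

text \<open>The coefficients are stopped once the square function exceeds a level; the stopped series is
  bounded in mean square, and almost every point is never stopped for some level.\<close>

lemma hpsum_convergent_AE:
  assumes sq: "AE x in lborel. summable (\<lambda>k. (A (dyad (int k) x))\<^sup>2)"
  shows "AE x in lborel. convergent (\<lambda>j. hpsum A 0 j x)"
proof -
  \<comment> \<open>Stopping must be a condition on \<open>J\<close> rather than on a point. The
    ancestors of \<open>J\<close> are the same for all its points, so its left endpoint can
    represent it.\<close>
  define pt where "pt J = real_of_int (fst J) * dlen J" for J
  have pt: "pt J \<in> dint J" for J
    by (simp add: pt_def dint_def)
  define cond where "cond L J \<longleftrightarrow> (\<Sum>i\<le>nat (snd J). (A (dyad (int i) (pt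
      J)))\<^sup>2) \<le> L" for L J
  define S where "S L J = (if cond L J then A J else 0)" for L J
  have cond_dyad: "cond L (dyad (int k) x) \<longleftrightarrow> (\<Sum>i\<le>k. (A (dyad (int i) x))\<^sup>2)
      \<le> L" for L k x
  proof -
    have "dyad (int k) (pt (dyad (int k) x)) = dyad (int k) x"
      using pt[of "dyad (int k) x"] by (simp add: mem_dint_iff)
    then have "dyad (int i) (pt (dyad (int k) x)) = dyad (int i) x" if "i \<le> k" for i
      using dyad_coarsen that by (meson of_nat_le_iff)
    then show ?thesis by (simp add: cond_def)
  qed
  have "AE x in lborel. x \<in> dint (n, 0) \<longrightarrow> convergent (\<lambda>j. hpsum (S (real l)) 0 j
      x)" for n and l :: nat
  proof -
    have "AE x in lborel. x \<in> dint (n, 0) \<longrightarrow> convergent (\<lambda>j. hpsum (S (real l)) (snd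
        (n, 0::int)) j x)"
    proof (rule hpsum_convergent_of_L2)
      fix d
      have "tsum (\<lambda>J. dlen J * (S (real l) J)\<^sup>2) d (n, 0) = dinteg (\<lambda>x. \<Sum>k<d. (S
          (real l) (dyad (int k) x))\<^sup>2) (n, 0)"
        by (simp add: tsum_integral)
      also have "\<dots> \<le> dinteg (\<lambda>x. real l) (n, 0)"
      proof (rule set_integral_mono)
        show "dintegrable (\<lambda>x. \<Sum>k<d. (S (real l) (dyad (int k) x))\<^sup>2) (n, 0)"
          using dbounded_dintegrable[OF dbounded_dyad[of "\<lambda>J. (S (real l) J)\<^sup>2" "(n, 0)"]] by
              (intro dintegrable_sum) simp
        fix x
        have "(\<Sum>k<d. (S (real l) (dyad (int k) x))\<^sup>2)
           = (\<Sum>k<d. if (\<Sum>i\<le>k. (A (dyad (int i) x))\<^sup>2) \<le> real l then (A (dyad (int k)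
               x))\<^sup>2 else 0)"
          by (intro sum.cong) (auto simp: S_def cond_dyad)
        also have "\<dots> \<le> real l" by (rule stopped_sum_le) auto
        finally show "(\<Sum>k<d. (S (real l) (dyad (int k) x))\<^sup>2) \<le> real l" .
      qed simp
      finally show "tsum (\<lambda>J. dlen J * (S (real l) J)\<^sup>2) d (n, 0) \<le> dinteg (\<lambda>x. real
          l) (n, 0)" .
    qed
    then show ?thesis by simp
  qed
  then have "AE x in lborel. \<forall>n. \<forall>l::nat. x \<in> dint (n, 0) \<longrightarrow> convergent
      (\<lambda>j. hpsum (S (real l)) 0 j x)"
    unfolding AE_all_countable by blast
  with sq show ?thesis
  proof eventually_elim
    case (elim x)
    obtain l :: nat where l: "(\<Sum>k. (A (dyad (int k) x))\<^sup>2) \<le> real l" using real_arch_simple by blast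
    have "S (real l) (dyad (int k) x) = A (dyad (int k) x)" for k
    proof -
      have "(\<Sum>i\<le>k. (A (dyad (int i) x))\<^sup>2) \<le> (\<Sum>k. (A (dyad (int k) x))\<^sup>2)"
        using elim(1) by (intro sum_le_suminf) auto
      then show ?thesis using l by (simp add: S_def cond_dyad)
    qed
    then have e: "hpsum (S (real l)) 0 j x = hpsum A 0 j x" for j by (simp add: hpsum_def)
    have "x \<in> dint (fst (dyad 0 x), 0)" using mem_dint_dyad[of x 0] by (simp add: dyad_def)
    then have "convergent (\<lambda>j. hpsum (S (real l)) 0 j x)" using elim(2) by blast
    then show ?case by (simp add: e)
  qed
qed

section \<open>Convergence of the operator\<close>

lemma haar_eq: "haar I x = dlen I powr (- 1 / 2) * hsgn I x"
  by (simp add: haar_def hsgn_def)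

lemma hsgn_pairing:
  assumes "dintegrable f I"
  shows "integrable lborel (\<lambda>x. f x * hsgn I x)" "(\<integral>x. f x * hsgn I x \<partial>lborel) =
      dlen I * hcoef f I"
proof -
  have i: "integrable lborel (\<lambda>x. indicator (dint (dright I)) x *\<^sub>R f x)"
    "integrable lborel (\<lambda>x. indicator (dint (dleft I)) x *\<^sub>R f x)"
    using dintegrable_child[OF assms] unfolding set_integrable_def by auto
  have e: "(\<lambda>x. f x * hsgn I x) = (\<lambda>x. indicator (dint (dright I)) x *\<^sub>R f x - indicator
      (dint (dleft I)) x *\<^sub>R f x)"
    by (simp add: hsgn_def algebra_simps fun_eq_iff)
  show "integrable lborel (\<lambda>x. f x * hsgn I x)" unfolding e using i by (rule
      Bochner_Integration.integrable_diff)
  have "(\<integral>x. f x * hsgn I x \<partial>lborel) = dinteg f (dright I) - dinteg f (dleft I)"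
    unfolding e using i by (subst Bochner_Integration.integral_diff) (auto simp: set_lebesgue_integral_def)
  also have "\<dots> = dlen I * hcoef f I" by (simp add: dinteg_eq_avg hcoef_def algebra_simps)
  finally show "(\<integral>x. f x * hsgn I x \<partial>lborel) = dlen I * hcoef f I" .
qed

lemma hsgn_power_even: "even s \<Longrightarrow> 0 < s \<Longrightarrow> hsgn I x ^ s = indicator (dint I) x"
proof -
  assume s: "even s" "0 < s"
  consider "x \<notin> dint I" | "x \<in> dint (dleft I)" | "x \<in> dint (dright I)" using dint_halves[of I] by blast
  then show ?thesis
  proof cases
    case 1
    then show ?thesis using s by (simp add: hsgn_outside)
  next
    case 2
    then show ?thesis using s dint_child_subset[of I] by (auto simp: hsgn_left)
  next
    case 3
    then show ?thesis using s dint_child_subset[of I] by (auto simp: hsgn_right)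
  qed
qed

lemma hsgn_power_odd: "odd s \<Longrightarrow> hsgn I x ^ s = hsgn I x"
proof -
  assume s: "odd s"
  then have s0: "0 < s" by (simp add: odd_pos)
  consider "x \<notin> dint I" | "x \<in> dint (dleft I)" | "x \<in> dint (dright I)" using dint_halves[of I] by blast
  then show ?thesis using s s0 by cases (simp_all add: hsgn_left hsgn_right hsgn_outside)
qed

text \<open>Powers of the sign function are again that function or the indicator of
  \<open>I\<close>. A test function therefore enters as one more slot, of Haar type for odd
  \<open>s\<close> and of average type for even \<open>s\<close>.\<close>

lemma hsgn_power_pairing:
  assumes "dintegrable f I" "0 < s"
  shows "integrable lborel (\<lambda>x. f x * hsgn I x ^ s)"
    "(\<integral>x. f x * hsgn I x ^ s \<partial>lborel) = dlen I * scoef f I (if odd s then 0 else 1)"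
proof -
  show "integrable lborel (\<lambda>x. f x * hsgn I x ^ s)"
    using assms hsgn_pairing(1)[OF assms(1)]
    by (cases "odd s") (simp_all add: hsgn_power_odd hsgn_power_even set_integrable_def mult.commute)
  show "(\<integral>x. f x * hsgn I x ^ s \<partial>lborel) = dlen I * scoef f I (if odd s then 0 else 1)"
  proof (cases "odd s")
    case True
    then show ?thesis using hsgn_pairing(2)[OF assms(1)] by (simp add: hsgn_power_odd scoef_def)
  next
    case False
    have "(\<integral>x. f x * indicator (dint I) x \<partial>lborel) = dinteg f I"
      by (simp add: set_lebesgue_integral_def mult.commute)
    then show ?thesis using False assms(2) by (simp add: hsgn_power_even scoef_def dinteg_eq_avg)
  qed
qed

lemma coef_eq:
  assumes "dintegrable f I"
  shows "coef f I a = (if a = 0 then dlen I powr (1 / 2) else 1) * scoef f I a"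
proof (cases "a = 0")
  case True
  have "(\<integral>x. f x * haar I x \<partial>lborel) = (\<integral>x. dlen I powr (- 1 / 2) * (f x * hsgn I
      x) \<partial>lborel)"
    by (simp add: haar_eq mult_ac)
  also have "\<dots> = dlen I powr (- 1 / 2) * (dlen I * hcoef f I)"
    using hsgn_pairing[OF assms] by simp
  also have "\<dots> = (dlen I powr (- 1 / 2) * dlen I powr 1) * hcoef f I" by simp
  also have "\<dots> = dlen I powr (1 / 2) * hcoef f I" by (simp only: powr_add[symmetric]) simp
  finally show ?thesis using True by (simp add: coef_def scoef_def)
next
  case False
  then show ?thesis by (simp add: coef_def scoef_def avg_def)
qed

text \<open>Each of the \<open>sigma m \<alpha>\<close> Haar slots contributes the square root of
  the length, and each factor \<open>haar I x\<close> its inverse.\<close>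

lemma prod_coef_haar:
  assumes "\<And>j. j \<in> {1..m} \<Longrightarrow> dintegrable (f j) I"
  shows "(\<Prod>j=1..m. coef (f j) I (\<alpha> j)) * haar I x ^ sigma m \<alpha>
     = (\<Prod>j=1..m. scoef (f j) I (\<alpha> j)) * hsgn I x ^ sigma m \<alpha>"
proof -
  define D where "D = dlen I powr (1 / 2)"
  have DD: "D * dlen I powr (- 1 / 2) = 1" unfolding D_def by (simp only: powr_add[symmetric]) simp
  have "(\<Prod>j=1..m. coef (f j) I (\<alpha> j)) = (\<Prod>j=1..m. (if \<alpha> j = 0 then D else 1) * scoef
      (f j) I (\<alpha> j))"
    using assms by (intro prod.cong) (auto simp: coef_eq D_def)
  also have "\<dots> = (\<Prod>j=1..m. if \<alpha> j = 0 then D else 1) * (\<Prod>j=1..m. scoef (f j) I (\<alpha> j))"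
    by (rule prod.distrib)
  also have "(\<Prod>j=1..m. if \<alpha> j = 0 then D else 1) = D ^ sigma m \<alpha>"
    by (subst prod.If_cases) (auto simp: sigma_def Int_def)
  finally have "(\<Prod>j=1..m. coef (f j) I (\<alpha> j)) * haar I x ^ sigma m \<alpha>
     = (D * dlen I powr (- 1 / 2)) ^ sigma m \<alpha> * ((\<Prod>j=1..m. scoef (f j) I (\<alpha> j)) * hsgn I x
         ^ sigma m \<alpha>)"
    unfolding haar_eq by (simp add: power_mult_distrib mult_ac)
  then show ?thesis unfolding DD by simp
qed

definition tcoef :: "(int \<times> int \<Rightarrow> real) \<Rightarrow> nat \<Rightarrow> (nat \<Rightarrow>
    nat) \<Rightarrow> (nat \<Rightarrow> real \<Rightarrow> real) \<Rightarrow> int \<times> int \<Rightarrow>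
    real" where
  "tcoef \<epsilon> m \<alpha> f I = \<epsilon> I * (\<Prod>j=1..m. scoef (f j) I (\<alpha> j))"

lemma Tpart_eq:
  assumes "\<And>j I. j \<in> {1..m} \<Longrightarrow> dintegrable (f j) I"
  shows "Tpart \<epsilon> m \<alpha> f N x = (\<Sum>I\<in>dtrunc N. tcoef \<epsilon> m \<alpha> f I * hsgn I x
      ^ sigma m \<alpha>)"
  unfolding Tpart_def tcoef_def
  by (intro sum.cong refl) (simp only: mult.assoc prod_coef_haar[OF assms])

section \<open>Truncated sums at a point, split into small and large scales\<close>

lemma dtrunc_through_point:
  assumes "\<bar>x\<bar> < 2 ^ N"
  shows "{I\<in>dtrunc N. x \<in> dint I} = (\<lambda>n. dyad n x) ` {- int N .. int N}"
proof (intro equalityI subsetI)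
  fix I assume "I \<in> {I\<in>dtrunc N. x \<in> dint I}"
  then have "dyad (snd I) x = I" "snd I \<in> {- int N .. int N}"
    by (auto simp: dtrunc_def mem_dint_iff)
  then show "I \<in> (\<lambda>n. dyad n x) ` {- int N .. int N}" by force
next
  fix I assume "I \<in> (\<lambda>n. dyad n x) ` {- int N .. int N}"
  then obtain n where n: "I = dyad n x" "- int N \<le> n" "n \<le> int N" by auto
  have "x \<in> dint (0, - int N) \<or> x \<in> dint (-1, - int N)" using assms by (auto simp: dint_dtrunc_top)
  then have "I \<in> dtree (2 * N + 1) (0, - int N) \<or> I \<in> dtree (2 * N + 1) (-1, - int N)"
  proof
    assume a: "x \<in> dint (0, - int N)"
    have "I \<in> dtree (2 * N + 1) (0, - int N)"
      using dint_nested[OF a, of I] n by (intro dtreeI) auto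
    then show ?thesis ..
  next
    assume a: "x \<in> dint (-1, - int N)"
    have "I \<in> dtree (2 * N + 1) (-1, - int N)"
      using dint_nested[OF a, of I] n by (intro dtreeI) auto
    then show ?thesis ..
  qed
  then show "I \<in> {I\<in>dtrunc N. x \<in> dint I}" unfolding dtrunc_eq using n(1) by auto
qed

lemma sum_symmetric_int:
  fixes t :: "int \<Rightarrow> real"
  shows "(\<Sum>n\<in>{- int N .. int N}. t n) = (\<Sum>k<Suc N. t (int k)) + (\<Sum>k<N. t (- 1 - int k))"
proof (induction N)
  case (Suc N)
  have "{- int (Suc N) .. int (Suc N)} = insert (- int (Suc N)) (insert (int (Suc N)) {- int N .. int N})" by auto
  then have "(\<Sum>n\<in>{- int (Suc N) .. int (Suc N)}. t n) = t (- int (Suc N)) + (t (int (Suc N)) +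
      (\<Sum>n\<in>{- int N .. int N}. t n))"
    by simp
  moreover have "t (- int (Suc N)) = t (- 1 - int N)" by (rule arg_cong[of _ _ t]) simp
  ultimately show ?case using Suc by simp
qed simp

text \<open>Once the window contains \<open>x\<close>, the truncation is the sum over the branch of
  \<open>x\<close> from generation \<open>- N\<close> to \<open>N\<close>, so the two ends can be
  treated separately. Generation 0 belongs to the small scales; \<open>- 1 - int k\<close> therefore
  starts at generation -1.\<close>

lemma Tpart_convergentI:
  assumes i: "\<And>j I. j \<in> {1..m} \<Longrightarrow> dintegrable (f j) I" and s: "0 < sigma m \<alpha>"
    and small: "convergent (\<lambda>K. \<Sum>k<K. tcoef \<epsilon> m \<alpha> f (dyad (int k) x) * hsgn (dyad
        (int k) x) x ^ sigma m \<alpha>)"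
    and large: "summable (\<lambda>k. tcoef \<epsilon> m \<alpha> f (dyad (- 1 - int k) x) * hsgn (dyad (- 1 -
        int k) x) x ^ sigma m \<alpha>)"
  shows "convergent (\<lambda>N. Tpart \<epsilon> m \<alpha> f N x)"
proof -
  let ?s = "sigma m \<alpha>"
  define t where "t n = tcoef \<epsilon> m \<alpha> f (dyad n x) * hsgn (dyad n x) x ^ ?s" for n
  obtain N0 :: nat where N0: "\<bar>x\<bar> < 2 ^ N0" using real_arch_pow[of 2 "\<bar>x\<bar>"] by auto
  have eq: "Tpart \<epsilon> m \<alpha> f N x = (\<Sum>k<Suc N. t (int k)) + (\<Sum>k<N. t (- 1 - int k))" if
      "N \<ge> N0" for N
  proof -
    have "(2::real) ^ N0 \<le> 2 ^ N" using that by (intro power_increasing) auto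
    then have xN: "\<bar>x\<bar> < 2 ^ N" using N0 by linarith
    have fin: "finite (dtrunc N)" unfolding dtrunc_eq by simp
    have "Tpart \<epsilon> m \<alpha> f N x = (\<Sum>I\<in>dtrunc N. tcoef \<epsilon> m \<alpha> f I * hsgn I x ^ ?s)"
      by (rule Tpart_eq[OF i])
    also have "\<dots> = (\<Sum>I\<in>{I\<in>dtrunc N. x \<in> dint I}. tcoef \<epsilon> m \<alpha> f I * hsgn
        I x ^ ?s)"
      by (rule sum.mono_neutral_right) (use fin s in \<open>auto simp: hsgn_outside\<close>)
    also have "\<dots> = (\<Sum>n\<in>{- int N .. int N}. t n)"
      unfolding dtrunc_through_point[OF xN]
      by (subst sum.reindex) (auto simp: t_def inj_on_def dyad_def)
    also have "\<dots> = (\<Sum>k<Suc N. t (int k)) + (\<Sum>k<N. t (- 1 - int k))" by (rule sum_symmetric_int)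
    finally show ?thesis .
  qed
  have "convergent (\<lambda>N. (\<Sum>k<Suc N. t (int k)))"
    using small unfolding t_def by (subst convergent_Suc_iff)
  moreover have "convergent (\<lambda>N. (\<Sum>k<N. t (- 1 - int k)))"
    using large unfolding t_def by (simp add: summable_iff_convergent)
  ultimately have "convergent (\<lambda>N. (\<Sum>k<Suc N. t (int k)) + (\<Sum>k<N. t (- 1 - int k)))"
    by (rule convergent_add)
  then obtain L where "(\<lambda>N. (\<Sum>k<Suc N. t (int k)) + (\<Sum>k<N. t (- 1 - int k)))
      \<longlonglongrightarrow> L"
    by (auto simp: convergent_def)
  moreover have "eventually (\<lambda>N. (\<Sum>k<Suc N. t (int k)) + (\<Sum>k<N. t (- 1 - int k)) = Tpart
      \<epsilon> m \<alpha> f N x) sequentially"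
    unfolding eventually_sequentially using eq by (intro exI[of _ N0]) auto
  ultimately have "(\<lambda>N. Tpart \<epsilon> m \<alpha> f N x) \<longlonglongrightarrow> L" by (rule
      Lim_transform_eventually)
  then show ?thesis by (auto simp: convergent_def)
qed

lemma sigma_pos: "j \<in> {1..m} \<Longrightarrow> \<alpha> j = 0 \<Longrightarrow> 0 < sigma m \<alpha>"
  unfolding sigma_def by (subst card_gt_0_iff) auto

lemma sigma_ge_2E:
  assumes "2 \<le> sigma m \<alpha>"
  obtains k l where "k \<in> {1..m}" "l \<in> {1..m}" "\<alpha> k = 0" "\<alpha> l = 0" "k \<noteq> l"
proof -
  have "\<not> card {j \<in> {1..m}. \<alpha> j = 0} \<le> Suc 0" using assms by (simp add: sigma_def)
  then have "\<not> (\<forall>k\<in>{j \<in> {1..m}. \<alpha> j = 0}. \<forall>l\<in>{j \<in> {1..m}. \<alpha>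
      j = 0}. k = l)"
    by (subst (asm) card_le_Suc0_iff_eq) auto
  then show ?thesis using that by blast
qed

text \<open>With a single Haar slot the terms at small scales are only known to be square summable,
  and the cancellation in \<open>hsgn\<close> is needed. With two Haar slots the product of two
  square summable sequences converges absolutely, whatever the parity of
  \<open>sigma m \<alpha>\<close>.\<close>

lemma Tpart_AE_convergent:
  fixes \<alpha> :: "nat \<Rightarrow> nat"
  assumes k0: "k0 \<in> {1..m}" "\<alpha> k0 = 0" and \<epsilon>: "\<And>I. \<bar>\<epsilon> I\<bar> \<le> E"
    and s: "1 < s" "s \<le> 2" and f: "\<And>j. j \<in> {1..m} \<Longrightarrow> Lloc s (f j)"
    and \<rho>: "0 < \<rho>" "\<rho> < 1"
    and dec: "\<And>j. j \<in> {1..m} \<Longrightarrow> \<exists>K. \<forall>n::nat. \<forall>x. avg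
        (\<lambda>y. \<bar>f j y\<bar>) (dyad (- int n) x) \<le> K * \<rho> ^ n"
  shows "AE x in lborel. convergent (\<lambda>N. Tpart \<epsilon> m \<alpha> f N x)"
proof -
  let ?s = "sigma m \<alpha>"
  let ?A = "\<lambda>j J. avg (\<lambda>y. \<bar>f j y\<bar>) J"
  have E: "0 \<le> E" using \<epsilon>[of undefined] by linarith
  have i: "dintegrable (f j) I" if "j \<in> {1..m}" for j I using Lloc_one[OF f[OF that]] s by auto
  have s0: "0 < ?s" using sigma_pos[of k0 m \<alpha>, OF k0] .
  have scoef: "\<bar>scoef (f j) J a\<bar> \<le> ?A j J" if "j \<in> {1..m}" for j J a using i[OF that] by
      (rule abs_scoef_le)
  have large: "summable (\<lambda>k. tcoef \<epsilon> m \<alpha> f (dyad (- 1 - int k) x) * hsgn (dyad (- 1 -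
      int k) x) x ^ ?s)" for x
  proof -
    obtain K where K: "\<And>j n x. j \<in> {1..m} \<Longrightarrow> ?A j (dyad (- int n) x) \<le> K j * \<rho> ^ n"
      using dec by metis
    have "summable (\<lambda>k. (E * (\<Prod>j=1..m. K j)) * (\<rho> ^ m) ^ Suc k)"
      using \<rho> k0 by (intro summable_mult) (simp only: summable_Suc_iff summable_geometric_iff, simp add:
          power_less_one_iff)
    then show ?thesis
    proof (rule summable_comparison_test'[where N = 0])
      fix k :: nat
      let ?J = "dyad (- int (Suc k)) x"
      have e: "- 1 - int k = - int (Suc k)" by simp
      have b: "\<bar>scoef (f j) ?J (\<alpha> j)\<bar> \<le> K j * \<rho> ^ Suc k" if "j \<in> {1..m}" for j
        using scoef[OF that] K[OF that] by (rule order_trans)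
      have "\<bar>tcoef \<epsilon> m \<alpha> f ?J * hsgn ?J x ^ ?s\<bar> = \<bar>\<epsilon> ?J\<bar> *
          (\<Prod>j=1..m. \<bar>scoef (f j) ?J (\<alpha> j)\<bar>) * \<bar>hsgn ?J x\<bar> ^ ?s"
        by (simp only: tcoef_def abs_mult abs_prod power_abs)
      also have "\<dots> \<le> E * (\<Prod>j=1..m. K j * \<rho> ^ Suc k) * 1"
      proof (intro mult_mono)
        show "(\<Prod>j=1..m. \<bar>scoef (f j) ?J (\<alpha> j)\<bar>) \<le> (\<Prod>j=1..m. K j * \<rho> ^ Suc k)"
          by (intro prod_mono conjI b) auto
        show "0 \<le> E * (\<Prod>j=1..m. K j * \<rho> ^ Suc k)"
          by (intro mult_nonneg_nonneg[OF E] prod_nonneg order_trans[OF abs_ge_zero b])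
        show "\<bar>hsgn ?J x\<bar> ^ ?s \<le> 1" by (rule power_le_one[OF abs_ge_zero abs_hsgn_le])
      qed (auto intro: \<epsilon> E prod_nonneg)
      also have "\<dots> = (E * (\<Prod>j=1..m. K j)) * (\<rho> ^ m) ^ Suc k"
        by (simp add: prod.distrib flip: power_mult power_Suc) (simp add: mult.commute)
      finally show "norm (tcoef \<epsilon> m \<alpha> f (dyad (- 1 - int k) x) * hsgn (dyad (- 1 - int k) x) x
          ^ ?s) \<le> (E * (\<Prod>j=1..m. K j)) * (\<rho> ^ m) ^ Suc k"
        unfolding e by simp
    qed
  qed
  have bdd: "AE x in lborel. \<forall>j\<in>{1..m}. \<exists>M>0. \<forall>k::nat. ?A j (dyad (int k) x) \<le> M"
    using s f by (intro AE_finite_allI) (auto intro!: avg_bounded_AE[of s])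
  have sq: "AE x in lborel. \<forall>j\<in>{1..m}. summable (\<lambda>k. (hcoef (f j) (dyad (int k) x))\<^sup>2)"
    using square_function_AE[OF s f] by (intro AE_finite_allI) auto
  \<comment> \<open>\<open>Z\<close> lists the Haar slots whose coefficients are kept; every other
    slot is replaced by the bound for its averages along the branch.\<close>
  have bnd: "\<exists>M\<ge>0. \<forall>k::nat. \<bar>tcoef \<epsilon> m \<alpha> f (dyad (int k) x)\<bar>
      \<le> M * (\<Prod>j\<in>Z. \<bar>hcoef (f j) (dyad (int k) x)\<bar>)"
    if Z: "Z \<subseteq> {1..m}" "\<And>j. j \<in> Z \<Longrightarrow> \<alpha> j = 0" and b:
        "\<forall>j\<in>{1..m}. \<exists>M>0. \<forall>k::nat. ?A j (dyad (int k) x) \<le> M" for x Z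
  proof -
    obtain M where M: "\<And>j. j \<in> {1..m} \<Longrightarrow> 0 < M j" "\<And>j k. j \<in> {1..m}
        \<Longrightarrow> ?A j (dyad (int k) x) \<le> M j"
      using b by metis
    show ?thesis
    proof (intro exI[of _ "E * (\<Prod>j\<in>{1..m}-Z. M j)"] conjI allI)
      show M0: "0 \<le> E * (\<Prod>j\<in>{1..m}-Z. M j)" using E M(1) by (intro mult_nonneg_nonneg
          prod_nonneg) (auto intro: less_imp_le)
      fix k :: nat
      let ?J = "dyad (int k) x"
      have b: "\<bar>scoef (f j) ?J (\<alpha> j)\<bar> \<le> M j" if "j \<in> {1..m}" for j
        using scoef[OF that] M(2)[OF that] by (rule order_trans)
      have "\<bar>tcoef \<epsilon> m \<alpha> f ?J\<bar> = \<bar>\<epsilon> ?J\<bar> * (\<Prod>j=1..m.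
          \<bar>scoef (f j) ?J (\<alpha> j)\<bar>)" by (simp add: tcoef_def abs_mult abs_prod)
      also have "(\<Prod>j=1..m. \<bar>scoef (f j) ?J (\<alpha> j)\<bar>) = (\<Prod>j\<in>{1..m}-Z. \<bar>scoef
          (f j) ?J (\<alpha> j)\<bar>) * (\<Prod>j\<in>Z. \<bar>scoef (f j) ?J (\<alpha> j)\<bar>)"
        using Z(1) by (intro prod.subset_diff) auto
      also have "(\<Prod>j\<in>Z. \<bar>scoef (f j) ?J (\<alpha> j)\<bar>) = (\<Prod>j\<in>Z. \<bar>hcoef (f j)
          ?J\<bar>)"
        using Z(2) by (intro prod.cong) (auto simp: scoef_def)
      also have "\<bar>\<epsilon> ?J\<bar> * ((\<Prod>j\<in>{1..m}-Z. \<bar>scoef (f j) ?J (\<alpha> j)\<bar>)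
          * (\<Prod>j\<in>Z. \<bar>hcoef (f j) ?J\<bar>))
         \<le> E * ((\<Prod>j\<in>{1..m}-Z. M j) * (\<Prod>j\<in>Z. \<bar>hcoef (f j) ?J\<bar>))"
        using \<epsilon>[of ?J] E M(1) b by (intro mult_mono mult_right_mono prod_mono prod_nonneg)
          (auto intro!: mult_nonneg_nonneg prod_nonneg intro: less_imp_le)
      finally show "\<bar>tcoef \<epsilon> m \<alpha> f ?J\<bar> \<le> E * (\<Prod>j\<in>{1..m}-Z. M j) *
          (\<Prod>j\<in>Z. \<bar>hcoef (f j) ?J\<bar>)" by (simp add: mult.assoc)
    qed
  qed
  have "AE x in lborel. convergent (\<lambda>K. \<Sum>k<K. tcoef \<epsilon> m \<alpha> f (dyad (int k) x) *
      hsgn (dyad (int k) x) x ^ ?s)"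
  proof (cases "?s = 1")
    case True
    have "AE x in lborel. summable (\<lambda>k. (tcoef \<epsilon> m \<alpha> f (dyad (int k) x))\<^sup>2)"
      using bdd sq
    proof eventually_elim
      case (elim x)
      obtain M where M: "0 \<le> M" "\<And>k::nat. \<bar>tcoef \<epsilon> m \<alpha> f (dyad (int k) x)\<bar>
          \<le> M * \<bar>hcoef (f k0) (dyad (int k) x)\<bar>"
        using bnd[of "{k0}" x] k0 elim(1) by auto
      have "summable (\<lambda>k. M\<^sup>2 * (hcoef (f k0) (dyad (int k) x))\<^sup>2)" using elim(2) k0 by
          (intro summable_mult) auto
      then show ?case
      proof (rule summable_comparison_test'[where N = 0])
        fix k :: nat
        have "\<bar>tcoef \<epsilon> m \<alpha> f (dyad (int k) x)\<bar>\<^sup>2 \<le> (M * \<bar>hcoef (f k0)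
            (dyad (int k) x)\<bar>)\<^sup>2"
          by (rule power_mono[OF M(2)]) simp
        then show "norm ((tcoef \<epsilon> m \<alpha> f (dyad (int k) x))\<^sup>2) \<le> M\<^sup>2 * (hcoef (f
            k0) (dyad (int k) x))\<^sup>2"
          by (simp add: power_mult_distrib)
      qed
    qed
    from hpsum_convergent_AE[OF this] show ?thesis unfolding hpsum_def True by simp
  next
    case False
    then have "2 \<le> ?s" using s0 by linarith
    then obtain k l where kl: "k \<in> {1..m}" "l \<in> {1..m}" "\<alpha> k = 0" "\<alpha> l = 0" "k \<noteq> l"
      by (rule sigma_ge_2E)
    show ?thesis using bdd sq
    proof eventually_elim
      case (elim x)
      obtain M where M: "0 \<le> M" "\<And>k'::nat. \<bar>tcoef \<epsilon> m \<alpha> f (dyad (int k') x)\<bar>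
          \<le> M * (\<bar>hcoef (f k) (dyad (int k') x)\<bar> * \<bar>hcoef (f l) (dyad (int k') x)\<bar>)"
        using bnd[of "{k, l}" x] kl elim(1) by auto
      have "summable (\<lambda>k'. M * ((hcoef (f k) (dyad (int k') x))\<^sup>2 + (hcoef (f l) (dyad (int k')
          x))\<^sup>2))"
        using elim(2) kl by (intro summable_mult summable_add) auto
      then have "summable (\<lambda>k. tcoef \<epsilon> m \<alpha> f (dyad (int k) x) * hsgn (dyad (int k) x) x ^ ?s)"
      proof (rule summable_comparison_test'[where N = 0])
        fix n :: nat
        let ?J = "dyad (int n) x"
        have "\<bar>tcoef \<epsilon> m \<alpha> f ?J * hsgn ?J x ^ ?s\<bar> = \<bar>tcoef \<epsilon> m \<alpha>
            f ?J\<bar> * \<bar>hsgn ?J x\<bar> ^ ?s"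
          by (simp add: abs_mult power_abs)
        also have "\<dots> \<le> \<bar>tcoef \<epsilon> m \<alpha> f ?J\<bar> * 1"
          using abs_hsgn_le[of ?J x] by (intro mult_left_mono power_le_one) auto
        also have "\<dots> \<le> M * (\<bar>hcoef (f k) ?J\<bar> * \<bar>hcoef (f l) ?J\<bar>)" using M(2) by simp
        also have "\<dots> \<le> M * ((hcoef (f k) ?J)\<^sup>2 + (hcoef (f l) ?J)\<^sup>2)"
        proof (rule mult_left_mono[OF _ M(1)])
          have "2 * (\<bar>hcoef (f k) ?J\<bar> * \<bar>hcoef (f l) ?J\<bar>) \<le> (hcoef (f k) ?J)\<^sup>2 +
              (hcoef (f l) ?J)\<^sup>2"
            using sum_squares_bound[of "\<bar>hcoef (f k) ?J\<bar>" "\<bar>hcoef (f l) ?J\<bar>"] by simp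
          moreover have "0 \<le> \<bar>hcoef (f k) ?J\<bar> * \<bar>hcoef (f l) ?J\<bar>" by simp
          ultimately show "\<bar>hcoef (f k) ?J\<bar> * \<bar>hcoef (f l) ?J\<bar> \<le> (hcoef (f k)
              ?J)\<^sup>2 + (hcoef (f l) ?J)\<^sup>2" by linarith
        qed
        finally show "norm (tcoef \<epsilon> m \<alpha> f ?J * hsgn ?J x ^ ?s) \<le> M * ((hcoef (f k)
            ?J)\<^sup>2 + (hcoef (f l) ?J)\<^sup>2)" by simp
      qed
      then show ?case by (simp add: summable_iff_convergent)
    qed
  qed
  then show ?thesis
  proof eventually_elim
    case (elim x)
    show ?case by (rule Tpart_convergentI[OF i s0 elim large])
  qed
qed

section \<open>The commutator by duality\<close>

lemma Lp_Lloc: "in_Lp s f \<Longrightarrow> Lloc s f"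
  unfolding in_Lp_def Lloc_def set_integrable_def
  by (intro conjI allI integrable_mult_indicator) auto

lemma dinteg_le_integral:
  assumes "integrable lborel f" "\<And>x. 0 \<le> f x"
  shows "dinteg f Q \<le> (\<integral>x. f x \<partial>lborel)"
  unfolding set_lebesgue_integral_def
  using assms by (intro integral_mono integrable_mult_indicator) (auto simp: indicator_def)

lemma lnorm_le_Lp_norm:
  assumes "in_Lp s f" "0 < s"
  shows "lnorm s f Q * dlen Q powr (1 / s) \<le> Lp_norm s f"
proof -
  have "lnorm s f Q * dlen Q powr (1 / s) = (avg (\<lambda>x. \<bar>f x\<bar> powr s) Q * dlen Q) powr (1 / s)"
    unfolding lnorm_def by (simp add: powr_mult avg_nonneg)
  also have "avg (\<lambda>x. \<bar>f x\<bar> powr s) Q * dlen Q = dinteg (\<lambda>x. \<bar>f x\<bar> powr s)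
      Q" by (simp add: avg_def)
  also have "(dinteg (\<lambda>x. \<bar>f x\<bar> powr s) Q) powr (1 / s) \<le> Lp_norm s f"
    unfolding Lp_norm_def using assms
    by (intro powr_mono2 dinteg_le_integral dinteg_nonneg) (auto simp: in_Lp_def)
  finally show ?thesis .
qed

lemma prod_lnorm_le_Lp_norm:
  assumes fin: "finite S" and p: "\<And>j. j \<in> S \<Longrightarrow> 0 < p j" "(\<Sum>j\<in>S. 1 / p j) = 1"
      and f: "\<And>j. j \<in> S \<Longrightarrow> in_Lp (p j) (f j)"
  shows "dlen Q * (\<Prod>j\<in>S. lnorm (p j) (f j) Q) \<le> (\<Prod>j\<in>S. Lp_norm (p j) (f j))"
proof -
  have "dlen Q = dlen Q powr (\<Sum>j\<in>S. 1 / p j)" using p by simp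
  also have "\<dots> = (\<Prod>j\<in>S. dlen Q powr (1 / p j))" using fin by (intro powr_sum) auto
  finally have "dlen Q * (\<Prod>j\<in>S. lnorm (p j) (f j) Q) = (\<Prod>j\<in>S. lnorm (p j) (f j) Q * dlen Q
      powr (1 / p j))"
    by (simp add: prod.distrib)
  also have "\<dots> \<le> (\<Prod>j\<in>S. Lp_norm (p j) (f j))"
    using p f by (intro prod_mono conjI lnorm_le_Lp_norm) auto
  finally show ?thesis .
qed

lemma in_BMOd_bmo_le:
  assumes "in_BMOd b"
  shows "0 \<le> bmo_norm b" "bmo_norm b < B \<Longrightarrow> bmo_le b B"
proof -
  have osc: "bmo_osc b J = avg (\<lambda>x. \<bar>b x - avg b J\<bar>) J" for J
    by (simp add: bmo_osc_def avg_def)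
  have le: "bmo_osc b J \<le> bmo_norm b" for J
    unfolding bmo_norm_def using assms by (intro cSUP_upper) (auto simp: in_BMOd_def)
  have "0 \<le> bmo_osc b (0, 0)" unfolding osc by (rule avg_nonneg) auto
  then show n0: "0 \<le> bmo_norm b" using le[of "(0, 0)"] by linarith
  have "Lloc 1 b"
    unfolding Lloc_1_iff
  proof (intro conjI allI)
    show "b \<in> borel_measurable borel" using assms by (simp add: in_BMOd_def)
    fix Q
    have "set_integrable lborel {real_of_int (fst Q) * dlen Q .. real_of_int (fst Q + 1) * dlen Q} b"
      using assms unfolding in_BMOd_def by blast
    then show "dintegrable b Q" by (rule set_integrable_subset) (auto simp: dint_def)
  qed
  then show "bmo_le b B" if "bmo_norm b < B"
    unfolding bmo_le_def
  proof (intro conjI allI)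
    show "avg (\<lambda>x. \<bar>b x - avg b J\<bar>) J \<le> B" for J using le[of J] that by (simp add: osc)
  qed (use that n0 in auto)
qed

lemma scoef_diff_cmult:
  assumes "dintegrable f I" "dintegrable g I" shows "scoef (\<lambda>x. f x - c * g x) I a = scoef f I a - c *
      scoef g I a"
  using assms by (simp add: scoef_def hcoef_diff hcoef_cmult avg_diff avg_cmult)

lemma bmo_mult_dintegrable:
  assumes b: "bmo_le b B" and t: "1 < t" and f: "Lloc t f"
  shows "dintegrable (\<lambda>x. b x * f x) I"
proof -
  define q where "q = 1 / (1 - 1 / t)"
  have q1: "1 / 1 = 1 / q + 1 / t" by (simp add: q_def)
  have q: "1 < q" using t by (simp add: q_def)
  have "Lloc q b" using john_nirenberg(1)[OF less_imp_le[OF q] b, of 0] by simp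
  then have "Lloc 1 (\<lambda>x. b x * f x)" using q t f by (intro lnorm_mult(1)[OF _ _ _ q1]) auto
  then show ?thesis using Lloc_one by auto
qed

section \<open>Truncated operators against a test function\<close>

lemma Tpart_pairing:
  assumes i: "\<And>j I. j \<in> {1..m} \<Longrightarrow> dintegrable (f j) I" and s: "0 < sigma m \<alpha>"
      and \<phi>: "\<And>I. dintegrable \<phi> I"
  shows "integrable lborel (\<lambda>x. Tpart \<epsilon> m \<alpha> f N x * \<phi> x)"
    "(\<integral>x. Tpart \<epsilon> m \<alpha> f N x * \<phi> x \<partial>lborel)
     = (\<Sum>I\<in>dtrunc N. tcoef \<epsilon> m \<alpha> f I * (dlen I * scoef \<phi> I (if odd (sigma m
         \<alpha>) then 0 else 1)))"
proof -
  have e: "(\<lambda>x. Tpart \<epsilon> m \<alpha> f N x * \<phi> x) = (\<lambda>x. \<Sum>I\<in>dtrunc N.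
      tcoef \<epsilon> m \<alpha> f I * (\<phi> x * hsgn I x ^ sigma m \<alpha>))"
  proof
    fix x
    have T: "Tpart \<epsilon> m \<alpha> f N x = (\<Sum>I\<in>dtrunc N. tcoef \<epsilon> m \<alpha> f I * hsgn
        I x ^ sigma m \<alpha>)"
      by (rule Tpart_eq) (rule i)
    show "Tpart \<epsilon> m \<alpha> f N x * \<phi> x = (\<Sum>I\<in>dtrunc N. tcoef \<epsilon> m \<alpha> f I
        * (\<phi> x * hsgn I x ^ sigma m \<alpha>))"
      unfolding T sum_distrib_right by (simp add: mult_ac)
  qed
  show "integrable lborel (\<lambda>x. Tpart \<epsilon> m \<alpha> f N x * \<phi> x)"
    unfolding e using hsgn_power_pairing(1)[OF \<phi> s] by (intro Bochner_Integration.integrable_sum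
        integrable_mult_right)
  show "(\<integral>x. Tpart \<epsilon> m \<alpha> f N x * \<phi> x \<partial>lborel)
     = (\<Sum>I\<in>dtrunc N. tcoef \<epsilon> m \<alpha> f I * (dlen I * scoef \<phi> I (if odd (sigma m
         \<alpha>) then 0 else 1)))"
    unfolding e using hsgn_power_pairing[OF \<phi> s]
    by (subst Bochner_Integration.integral_sum) simp_all
qed

lemma Tpart_measurable [measurable]: "Tpart \<epsilon> m \<alpha> f N \<in> borel_measurable borel"
proof -
  have [measurable]: "haar I \<in> borel_measurable borel" for I
    unfolding haar_def by measurable
  show ?thesis unfolding Tpart_def by measurable
qed

text \<open>Convergence is expressed by the Cauchy property, a countable condition on measurable
  partial sums; the default value 0 on the complement then does no harm.\<close>

lemma Top_measurable [measurable]: "Top \<epsilon> m \<alpha> f \<in> borel_measurable borel"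
proof -
  have "Measurable.pred borel (\<lambda>x. convergent (\<lambda>N. Tpart \<epsilon> m \<alpha> f N x))"
    unfolding Cauchy_convergent_iff[symmetric] by measurable
  then show ?thesis unfolding Top_def by measurable
qed


text \<open>The test function \<open>g\<close> becomes slot \<open>m + 1\<close> with the conjugate
  exponent of \<open>r\<close>, so all reciprocals add up to 1. The two halves of the commutator put
  the symbol into slot \<open>i\<close> and, after moving the multiplication onto \<open>g\<close>,
  into slot \<open>m + 1\<close>.\<close>

lemma commut_part_dual:
  fixes p :: "nat \<Rightarrow> real" and \<alpha> :: "nat \<Rightarrow> nat"
  assumes m: "2 \<le> m" and k0: "k0 \<in> {1..m}" "\<alpha> k0 = 0" and i: "i \<in> {1..m}" and \<epsilon>:
      "\<And>I. \<bar>\<epsilon> I\<bar> \<le> E"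
    and p: "\<And>j. j \<in> {1..m} \<Longrightarrow> 1 < p j" and r: "1 < r" and sp: "(\<Sum>j=1..m. 1 / p j)
        = 1 / r"
  shows "\<exists>C\<ge>0. \<forall>b B f g N. bmo_le b B \<longrightarrow> (\<forall>j\<in>{1..m}. in_Lp (p j)
      (f j)) \<longrightarrow> in_Lp (r / (r - 1)) g \<longrightarrow>
    \<bar>\<integral>x. (Tpart \<epsilon> m \<alpha> (f(i := (\<lambda>y. b y * f i y))) N x - b x * Tpart
        \<epsilon> m \<alpha> f N x) * g x \<partial>lborel\<bar>
      \<le> C * B * ((\<Prod>j=1..m. Lp_norm (p j) (f j)) * Lp_norm (r / (r - 1)) g)"
proof -
  define r' where "r' = r / (r - 1)"
  have r': "1 < r'" "1 / r + 1 / r' = 1" using r by (auto simp: r'_def field_simps)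
  define s where "s = sigma m \<alpha>"
  have s0: "0 < s" unfolding s_def using sigma_pos[of k0 m \<alpha>, OF k0] .
  define a' :: nat where "a' = (if odd s then 0 else 1)"
  define S where "S = {1..m + 1}"
  define A where "A = \<alpha>(m + 1 := a')"
  define P where "P = p(m + 1 := r')"
  have E: "0 \<le> E" using \<epsilon>[of undefined] by linarith
  have S: "finite S" "3 \<le> card S" "i \<in> S" "m + 1 \<in> S" "S = insert (m + 1) {1..m}" "m + 1 \<notin> {1..m}"
    using m i by (auto simp: S_def)
  have P: "1 < P j" if "j \<in> S" for j using that p r' by (auto simp: P_def S_def)
  have eqP: "P j = p j" "A j = \<alpha> j" if "j \<in> {1..m}" for j using that by (auto simp: P_def A_def)
  have sP: "(\<Sum>j\<in>S. 1 / P j) = 1"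
  proof -
    have "(\<Sum>j\<in>S. 1 / P j) = 1 / P (m + 1) + (\<Sum>j=1..m. 1 / P j)" unfolding S(5) by simp
    also have "(\<Sum>j=1..m. 1 / P j) = (\<Sum>j=1..m. 1 / p j)" by (intro sum.cong) (auto simp: eqP)
    finally show ?thesis using sp r' by (simp add: P_def)
  qed
  \<comment> \<open>For odd \<open>s\<close> the new slot is of Haar type and joins
    \<open>k0\<close>; for even \<open>s\<close> the value is at least 2 and the original slots
    already contain two.\<close>
  obtain k l where kl: "k \<in> S" "l \<in> S" "k \<noteq> l" "A k = 0" "A l = 0"
  proof (cases "odd s")
    case True
    have "k0 \<in> S" "k0 \<noteq> m + 1" "A k0 = 0" "A (m + 1) = 0" using k0 True by (auto simp: S_def A_def a'_def)
    then show ?thesis using that[of k0 "m + 1"] S(4) by auto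
  next
    case False
    then have "2 \<le> sigma m \<alpha>" using s0 dvd_imp_le[of 2 s] unfolding s_def by simp
    then obtain k l where "k \<in> {1..m}" "l \<in> {1..m}" "\<alpha> k = 0" "\<alpha> l = 0" "k \<noteq> l" by
        (rule sigma_ge_2E)
    then show ?thesis using that[of k l] by (auto simp: S_def A_def)
  qed
  obtain C1 where C1: "0 \<le> C1" and F1: "\<And>b B f Q d. bmo_le b B \<Longrightarrow> (\<forall>j\<in>S.
      Lloc (P j) (f j)) \<Longrightarrow>
    tsum (\<lambda>J. dlen J * (\<bar>scoef (\<lambda>x. (b x - avg b J) * f i x) J (A i)\<bar> *
        (\<Prod>j\<in>S-{i}. \<bar>scoef (f j) J (A j)\<bar>))) d Q
      \<le> C1 * B * (dlen Q * (\<Prod>j\<in>S. lnorm (P j) (f j) Q))"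
    using form_bound[of S i k l A P, OF S(1,2,3) kl P sP] by blast
  obtain C2 where C2: "0 \<le> C2" and F2: "\<And>b B f Q d. bmo_le b B \<Longrightarrow> (\<forall>j\<in>S.
      Lloc (P j) (f j)) \<Longrightarrow>
    tsum (\<lambda>J. dlen J * (\<bar>scoef (\<lambda>x. (b x - avg b J) * f (m + 1) x) J (A (m + 1))\<bar> *
        (\<Prod>j\<in>S-{m + 1}. \<bar>scoef (f j) J (A j)\<bar>))) d Q
      \<le> C2 * B * (dlen Q * (\<Prod>j\<in>S. lnorm (P j) (f j) Q))"
    using form_bound[of S "m + 1" k l A P, OF S(1,2,4) kl P sP] by blast
  \<comment> \<open>\<open>E\<close> bounds the multipliers, the two constants belong to the two
    positions of the symbol, and each factor 2 counts the two trees of the truncation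
    window.\<close>
  define C where "C = E * (2 * C1 + 2 * C2)"
  have C: "0 \<le> C" using E C1 C2 by (simp add: C_def)
  have main: "\<bar>\<integral>x. (Tpart \<epsilon> m \<alpha> (f(i := (\<lambda>y. b y * f i y))) N x - b x *
      Tpart \<epsilon> m \<alpha> f N x) * g x \<partial>lborel\<bar>
      \<le> C * B * ((\<Prod>j=1..m. Lp_norm (p j) (f j)) * Lp_norm r' g)"
    if b: "bmo_le b B" and f: "\<forall>j\<in>{1..m}. in_Lp (p j) (f j)" and g: "in_Lp r' g" for b B f g N
  proof -
    have B: "0 < B" and b1: "Lloc 1 b" using b by (auto simp: bmo_le_def)
    define F where "F = f(m + 1 := g)"
    have FL: "in_Lp (P j) (F j)" if "j \<in> S" for j using that f g by (auto simp: P_def F_def S_def)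
    have Ff: "F j = f j" if "j \<in> {1..m}" for j using that by (simp add: F_def)
    have FLl: "\<forall>j\<in>S. Lloc (P j) (F j)" using FL Lp_Lloc by blast
    have fL: "Lloc (p j) (f j)" if "j \<in> {1..m}" for j using f that Lp_Lloc by blast
    have gL: "Lloc r' g" using g by (rule Lp_Lloc)
    have fi: "dintegrable (f j) I" if "j \<in> {1..m}" for j I using Lloc_one[OF fL[OF that]] p[OF that] by auto
    have gi: "dintegrable g I" for I using Lloc_one[OF gL] r' by auto
    have bfi: "dintegrable (\<lambda>x. b x * f i x) I" for I using bmo_mult_dintegrable[OF b p[OF i] fL[OF i]] .
    have bgi: "dintegrable (\<lambda>x. b x * g x) I" for I using bmo_mult_dintegrable[OF b r'(1) gL] .
    define f' where "f' = f(i := (\<lambda>y. b y * f i y))"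
    have f'i: "dintegrable (f' j) I" if "j \<in> {1..m}" for j I using fi[OF that] bfi by (simp add: f'_def)
    have T1: "integrable lborel (\<lambda>x. Tpart \<epsilon> m \<alpha> f' N x * g x)"
      "(\<integral>x. Tpart \<epsilon> m \<alpha> f' N x * g x \<partial>lborel) = (\<Sum>I\<in>dtrunc N. tcoef
          \<epsilon> m \<alpha> f' I * (dlen I * scoef g I a'))"
      using Tpart_pairing[OF f'i s0[unfolded s_def] gi] by (auto simp: s_def a'_def)
    have T2: "integrable lborel (\<lambda>x. Tpart \<epsilon> m \<alpha> f N x * (b x * g x))"
      "(\<integral>x. Tpart \<epsilon> m \<alpha> f N x * (b x * g x) \<partial>lborel) = (\<Sum>I\<in>dtrunc
          N. tcoef \<epsilon> m \<alpha> f I * (dlen I * scoef (\<lambda>x. b x * g x) I a'))"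
      using Tpart_pairing[OF fi s0[unfolded s_def] bgi] by (auto simp: s_def a'_def)
    define a1 where "a1 J = dlen J * (\<bar>scoef (\<lambda>x. (b x - avg b J) * F i x) J (A i)\<bar> *
        (\<Prod>j\<in>S-{i}. \<bar>scoef (F j) J (A j)\<bar>))" for J
    define a2 where "a2 J = dlen J * (\<bar>scoef (\<lambda>x. (b x - avg b J) * F (m + 1) x) J (A (m +
        1))\<bar> * (\<Prod>j\<in>S-{m + 1}. \<bar>scoef (F j) J (A j)\<bar>))" for J
    have trm: "\<bar>tcoef \<epsilon> m \<alpha> f' I * (dlen I * scoef g I a') - tcoef \<epsilon> m \<alpha> f
        I * (dlen I * scoef (\<lambda>x. b x * g x) I a')\<bar> \<le> E * (a1 I + a2 I)" for I
    proof -
      define \<beta> where "\<beta> = avg b I"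
      define R where "R = (\<Prod>j\<in>{1..m}-{i}. scoef (f j) I (\<alpha> j))"
      define u where "u = scoef (\<lambda>x. (b x - \<beta>) * f i x) I (\<alpha> i)"
      define v where "v = scoef (\<lambda>x. (b x - \<beta>) * g x) I a'"
      define w where "w = scoef (f i) I (\<alpha> i)"
      define G where "G = scoef g I a'"
      have u: "scoef (\<lambda>x. b x * f i x) I (\<alpha> i) = u + \<beta> * w"
        using scoef_diff_cmult[OF bfi fi[OF i], of \<beta> I "\<alpha> i"] by (simp add: u_def w_def
            left_diff_distrib)
      have v: "scoef (\<lambda>x. b x * g x) I a' = v + \<beta> * G"
        using scoef_diff_cmult[OF bgi gi, of \<beta> I a'] by (simp add: v_def G_def left_diff_distrib)
      have t1: "tcoef \<epsilon> m \<alpha> f' I = \<epsilon> I * ((u + \<beta> * w) * R)"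
      proof -
        have "(\<Prod>j=1..m. scoef (f' j) I (\<alpha> j)) = scoef (f' i) I (\<alpha> i) *
            (\<Prod>j\<in>{1..m}-{i}. scoef (f' j) I (\<alpha> j))"
          using i by (intro prod.remove) auto
        also have "(\<Prod>j\<in>{1..m}-{i}. scoef (f' j) I (\<alpha> j)) = R" unfolding R_def by (intro
            prod.cong) (auto simp: f'_def)
        finally show ?thesis using u by (simp add: tcoef_def f'_def)
      qed
      have t2: "tcoef \<epsilon> m \<alpha> f I = \<epsilon> I * (w * R)"
      proof -
        have "(\<Prod>j=1..m. scoef (f j) I (\<alpha> j)) = scoef (f i) I (\<alpha> i) *
            (\<Prod>j\<in>{1..m}-{i}. scoef (f j) I (\<alpha> j))"
          using i by (intro prod.remove) auto
        then show ?thesis by (simp add: tcoef_def w_def R_def)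
      qed
      have "S - {i} = insert (m + 1) ({1..m} - {i})" using i by (auto simp: S_def)
      moreover have "(\<Prod>j\<in>{1..m}-{i}. \<bar>scoef (F j) I (A j)\<bar>) = \<bar>R\<bar>"
        unfolding R_def abs_prod by (intro prod.cong) (auto simp: Ff eqP)
      ultimately have A1: "a1 I = dlen I * (\<bar>u\<bar> * (\<bar>G\<bar> * \<bar>R\<bar>))"
        using i by (simp add: a1_def u_def \<beta>_def Ff eqP G_def) (simp add: A_def F_def)
      have "S - {m + 1} = {1..m}" by (auto simp: S_def)
      moreover have "(\<Prod>j\<in>{1..m}. \<bar>scoef (F j) I (A j)\<bar>) = \<bar>w * R\<bar>"
      proof -
        have "(\<Prod>j\<in>{1..m}. \<bar>scoef (F j) I (A j)\<bar>) = \<bar>\<Prod>j\<in>{1..m}. scoef (f j) I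
            (\<alpha> j)\<bar>"
          unfolding abs_prod by (intro prod.cong) (auto simp: Ff eqP)
        also have "(\<Prod>j\<in>{1..m}. scoef (f j) I (\<alpha> j)) = w * R"
          unfolding w_def R_def using i by (intro prod.remove) auto
        finally show ?thesis .
      qed
      ultimately have A2: "a2 I = dlen I * (\<bar>v\<bar> * \<bar>w * R\<bar>)"
        by (simp add: a2_def v_def \<beta>_def A_def F_def)
      \<comment> \<open>Both halves contain the same term \<open>\<beta> * w * G * R\<close>, which
        cancels; only the coefficients \<open>u\<close> and \<open>v\<close> of the centred symbol
        survive.\<close>
      have "tcoef \<epsilon> m \<alpha> f' I * (dlen I * scoef g I a') - tcoef \<epsilon> m \<alpha> f I *
          (dlen I * scoef (\<lambda>x. b x * g x) I a')
        = \<epsilon> I * (dlen I * (u * (G * R)) - dlen I * (v * (w * R)))"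
        unfolding t1 t2 v G_def[symmetric] by (simp add: algebra_simps)
      also have "\<bar>\<dots>\<bar> = \<bar>\<epsilon> I\<bar> * \<bar>dlen I * (u * (G * R)) - dlen I * (v *
          (w * R))\<bar>" by (rule abs_mult)
      also have "\<dots> \<le> E * (a1 I + a2 I)"
      proof (intro mult_mono)
        have "\<bar>dlen I * (u * (G * R)) - dlen I * (v * (w * R))\<bar> \<le> \<bar>dlen I * (u * (G *
            R))\<bar> + \<bar>dlen I * (v * (w * R))\<bar>"
          by (rule abs_triangle_ineq4)
        then show "\<bar>dlen I * (u * (G * R)) - dlen I * (v * (w * R))\<bar> \<le> a1 I + a2 I"
          unfolding A1 A2 by (simp add: abs_mult)
      qed (use \<epsilon> E in auto)
      finally show ?thesis .
    qed
    define Y where "Y = (\<Prod>j\<in>S. Lp_norm (P j) (F j))"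
    have Yeq: "Y = (\<Prod>j=1..m. Lp_norm (p j) (f j)) * Lp_norm r' g"
    proof -
      have "Y = Lp_norm (P (m + 1)) (F (m + 1)) * (\<Prod>j=1..m. Lp_norm (P j) (F j))" unfolding Y_def S(5) by simp
      also have "(\<Prod>j=1..m. Lp_norm (P j) (F j)) = (\<Prod>j=1..m. Lp_norm (p j) (f j))"
        by (intro prod.cong) (auto simp: eqP Ff)
      finally show ?thesis by (simp add: P_def F_def mult.commute)
    qed
    have QY: "dlen Q * (\<Prod>j\<in>S. lnorm (P j) (F j) Q) \<le> Y" for Q
      unfolding Y_def using P by (intro prod_lnorm_le_Lp_norm S(1) sP FL) (auto intro: less_trans[OF zero_less_one])
    have d1: "tsum a1 d Q \<le> C1 * B * Y" for d Q
      using order_trans[OF F1[OF b FLl] mult_left_mono[OF QY]] C1 B unfolding a1_def by simp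
    have d2: "tsum a2 d Q \<le> C2 * B * Y" for d Q
      using order_trans[OF F2[OF b FLl] mult_left_mono[OF QY]] C2 B unfolding a2_def by simp
    have e: "(\<lambda>x. (Tpart \<epsilon> m \<alpha> f' N x - b x * Tpart \<epsilon> m \<alpha> f N x) * g x)
        = (\<lambda>x. Tpart \<epsilon> m \<alpha> f' N x * g x - Tpart \<epsilon> m \<alpha> f N x * (b x * g x))"
      by (simp add: algebra_simps)
    have "(\<integral>x. (Tpart \<epsilon> m \<alpha> f' N x - b x * Tpart \<epsilon> m \<alpha> f N x) * g x
        \<partial>lborel)
      = (\<Sum>I\<in>dtrunc N. tcoef \<epsilon> m \<alpha> f' I * (dlen I * scoef g I a') - tcoef \<epsilon> m
          \<alpha> f I * (dlen I * scoef (\<lambda>x. b x * g x) I a'))"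
      unfolding e using T1 T2 by (simp add: sum_subtractf)
    also have "\<bar>\<dots>\<bar> \<le> (\<Sum>I\<in>dtrunc N. E * (a1 I + a2 I))"
      by (rule order_trans[OF sum_abs sum_mono[OF trm]])
    also have "\<dots> = E * (sum a1 (dtrunc N) + sum a2 (dtrunc N))"
      by (simp add: sum_distrib_left sum.distrib distrib_left)
    also have "\<dots> \<le> E * ((C1 * B * Y + C1 * B * Y) + (C2 * B * Y + C2 * B * Y))"
      unfolding sum_dtrunc by (intro mult_left_mono add_mono d1 d2 E)
    also have "\<dots> = C * B * Y" by (simp add: C_def algebra_simps)
    finally show ?thesis unfolding Yeq f'_def .
  qed
  show ?thesis using main C unfolding r'_def by blast
qed

text \<open>The cut-off to bounded values and a bounded window makes the integral \<open>Y\<close>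
  finite beforehand. The extremal test function then gives
  \<open>Y \<le> X * Y powr (1 / r')\<close>, and the power of \<open>Y\<close> can be divided
  out.\<close>

lemma truncated_Lr_bound:
  fixes H :: "real \<Rightarrow> real"
  assumes r: "1 < r" and H [measurable]: "H \<in> borel_measurable borel" and X: "0 \<le> X"
    and dual: "\<And>g. in_Lp (r / (r - 1)) g \<Longrightarrow> \<bar>\<integral>x. H x * g x
        \<partial>lborel\<bar> \<le> X * Lp_norm (r / (r - 1)) g"
  shows "integrable lborel (\<lambda>x. indicator {x. \<bar>H x\<bar> \<le> K \<and> x \<in> {-a..<a}} x *
      \<bar>H x\<bar> powr r)"
    "(\<integral>x. indicator {x. \<bar>H x\<bar> \<le> K \<and> x \<in> {-a..<a}} x * \<bar>H x\<bar> powr r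
        \<partial>lborel) \<le> X powr r"
proof -
  define A where "A = {x. \<bar>H x\<bar> \<le> K \<and> x \<in> {-a..<a}}"
  have A [measurable]: "A \<in> sets borel" unfolding A_def by measurable
  let ?h = "\<lambda>x. indicator A x * \<bar>H x\<bar> powr r"
  have int: "integrable lborel ?h"
  proof (rule Bochner_Integration.integrable_bound)
    show "integrable lborel (\<lambda>x. indicator {-a..a} x *\<^sub>R (\<bar>K\<bar> powr r))"
      by (intro integrable_scaleR_left integrable_real_indicator) (auto simp: emeasure_lborel_Icc_eq)
    show "AE x in lborel. norm (?h x) \<le> norm (indicator {-a..a} x *\<^sub>R (\<bar>K\<bar> powr r))"
    proof (rule AE_I2)
      fix x show "norm (?h x) \<le> norm (indicator {-a..a} x *\<^sub>R (\<bar>K\<bar> powr r))"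
      proof (cases "x \<in> A")
        case True
        then have "\<bar>H x\<bar> powr r \<le> \<bar>K\<bar> powr r" "x \<in> {-a..a}"
          using r by (auto simp: A_def intro!: powr_mono2)
        then show ?thesis using True by simp
      qed simp
    qed
  qed measurable
  define r' where "r' = r / (r - 1)"
  have r': "1 < r'" "(r - 1) * r' = r" using r by (auto simp: r'_def)
  define g where "g x = indicator A x * (sgn (H x) * \<bar>H x\<bar> powr (r - 1))" for x
  define Y where "Y = (\<integral>x. ?h x \<partial>lborel)"
  have Y0: "0 \<le> Y" unfolding Y_def by (intro integral_nonneg_AE) auto
  have gr: "\<bar>g x\<bar> powr r' = ?h x" for x
  proof (cases "H x = 0")
    case True
    then show ?thesis using r by (simp add: g_def)
  next
    case False
    then show ?thesis by (simp add: g_def abs_mult indicator_def abs_sgn_eq powr_powr r'(2))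
  qed
  have "g \<in> borel_measurable borel" unfolding g_def by measurable
  then have gL: "in_Lp r' g" unfolding in_Lp_def gr using int by simp
  have "H x * g x = ?h x" for x
  proof -
    have "H x * (sgn (H x) * \<bar>H x\<bar> powr (r - 1)) = \<bar>H x\<bar> powr 1 * \<bar>H x\<bar> powr (r - 1)"
      using abs_sgn[of "H x"] by (simp add: mult.assoc[symmetric])
    also have "\<dots> = \<bar>H x\<bar> powr r" by (simp only: powr_add[symmetric]) simp
    finally show ?thesis by (simp add: g_def)
  qed
  then have "Y = (\<integral>x. H x * g x \<partial>lborel)" by (simp add: Y_def)
  also have "\<dots> \<le> X * Lp_norm r' g" using dual[of g] gL by (simp add: r'_def)
  also have "Lp_norm r' g = Y powr (1 / r')" unfolding Lp_norm_def gr Y_def ..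
  finally have le: "Y \<le> X * Y powr (1 / r')" .
  have "Y \<le> X powr r"
  proof (cases "Y = 0")
    case False
    then have Y: "0 < Y" using Y0 by simp
    have "Y powr (1 / r) * Y powr (1 / r') = Y" using r Y by (simp add: r'_def field_simps flip: powr_add)
    then have "Y powr (1 / r) * Y powr (1 / r') \<le> X * Y powr (1 / r')" using le by simp
    then have "Y powr (1 / r) \<le> X" using Y by simp
    then have "(Y powr (1 / r)) powr r \<le> X powr r" using r by (intro powr_mono2) auto
    then show ?thesis using r Y by (simp add: powr_powr)
  qed simp
  then show "(\<integral>x. indicator {x. \<bar>H x\<bar> \<le> K \<and> x \<in> {-a..<a}} x * \<bar>H x\<bar>
      powr r \<partial>lborel) \<le> X powr r"
    unfolding Y_def A_def .
  show "integrable lborel (\<lambda>x. indicator {x. \<bar>H x\<bar> \<le> K \<and> x \<in> {-a..<a}} x *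
      \<bar>H x\<bar> powr r)"
    using int unfolding A_def .
qed

text \<open>The normalisation costs the length to the power \<open>-1 / s\<close>. The ratio is
  stated with a common upper bound \<open>P\<close> for the exponents, so that all slots decay with
  the same ratio.\<close>

lemma Lp_decay:
  assumes f: "in_Lp s f" and s: "1 \<le> s" "s \<le> P"
  shows "lnorm s f (dyad (- int n) x) \<le> Lp_norm s f * (2 powr (- 1 / P)) ^ n"
proof -
  let ?J = "dyad (- int n) x"
  have d: "dlen ?J = 2 powr (real n)" by (simp add: dlen_dyad powr_realpow)
  have L0: "0 \<le> Lp_norm s f" by (simp add: Lp_norm_def)
  have "lnorm s f ?J = (lnorm s f ?J * dlen ?J powr (1 / s)) * dlen ?J powr (- (1 / s))"
    by (simp add: mult.assoc flip: powr_add)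
  also have "\<dots> \<le> Lp_norm s f * dlen ?J powr (- (1 / s))"
    using lnorm_le_Lp_norm[OF f, of ?J] s by (intro mult_right_mono) auto
  also have "\<dots> \<le> Lp_norm s f * (2 powr (- 1 / P)) ^ n"
  proof (intro mult_left_mono L0)
    have "dlen ?J powr (- (1 / s)) = 2 powr (- (real n / s))" unfolding d by (simp add: powr_powr)
    also have "\<dots> \<le> 2 powr (- (real n / P))" using s by (intro powr_mono) (auto simp: divide_left_mono)
    also have "\<dots> = (2 powr (- 1 / P)) ^ n" by (simp add: powr_powr flip: powr_realpow)
    finally show "dlen ?J powr (- (1 / s)) \<le> (2 powr (- 1 / P)) ^ n" .
  qed
  finally show ?thesis .
qed

text \<open>John-Nirenberg controls \<open>b\<close> only after subtracting its average on the
  interval. On intervals of length at least 1 that average is bounded by the global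
  \<open>L^q\<close> norm of \<open>b\<close>; this is the place where \<open>in_Lp q b\<close>
  enters.\<close>

lemma bmo_mult_decay:
  assumes b: "bmo_le b B" and q: "1 < q" "in_Lp q b" and s: "1 < s" "s \<le> P" and f: "in_Lp s f"
  shows "\<exists>K. \<forall>n::nat. \<forall>x. avg (\<lambda>y. \<bar>b y * f y\<bar>) (dyad (- int n) x)
      \<le> K * (2 powr (- 1 / P)) ^ n"
proof -
  define t where "t = 1 / (1 - 1 / s)"
  have t1: "1 / 1 = 1 / t + 1 / s" by (simp add: t_def)
  have t: "1 < t" using s by (simp add: t_def)
  define jn where "jn = jn_const t powr (1 / t)"
  have fL: "Lloc s f" "Lloc q b" using f q Lp_Lloc by auto
  have "avg (\<lambda>y. \<bar>b y * f y\<bar>) J \<le> (Lp_norm q b + 2 * (jn * B)) * lnorm s f J" if J: "1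
      \<le> dlen J" for J
  proof -
    define \<beta> where "\<beta> = avg b J"
    have "\<bar>\<beta>\<bar> \<le> lnorm 1 b J" unfolding \<beta>_def lnorm_1 using Lloc_one[OF fL(2)] q by
        (intro abs_avg_le) auto
    also have "\<dots> \<le> lnorm q b J" using q fL by (intro lnorm_mono) auto
    also have "\<dots> \<le> lnorm q b J * dlen J powr (1 / q)"
      using mult_left_mono[of 1 "dlen J powr (1 / q)" "lnorm q b J"] J q by (simp add: ge_one_powr_ge_zero)
    also have "\<dots> \<le> Lp_norm q b" using q by (intro lnorm_le_Lp_norm) auto
    finally have \<beta>: "\<bar>\<beta>\<bar> \<le> Lp_norm q b" .
    note jnb = john_nirenberg[OF less_imp_le[OF t] b]
    have s0: "0 < s" "0 < t" using s t by auto
    note m = lnorm_mult[OF _ s0(2) s0(1) t1 jnb(1)[of \<beta>] fL(1)]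
    have i1: "dintegrable (\<lambda>y. \<bar>(b y - \<beta>) * f y\<bar>) J" using Lloc_one(2)[OF m(1)] by auto
    have i2: "dintegrable (\<lambda>y. \<bar>f y\<bar>) J" using Lloc_one[OF fL(1)] s by auto
    have i0: "dintegrable (\<lambda>y. \<bar>b y * f y\<bar>) J" using bmo_mult_dintegrable[OF b s(1) fL(1)] by
        (intro set_integrable_abs)
    have "avg (\<lambda>y. \<bar>b y * f y\<bar>) J \<le> avg (\<lambda>y. \<bar>(b y - \<beta>) * f y\<bar> +
        \<bar>\<beta>\<bar> * \<bar>f y\<bar>) J"
    proof (rule avg_mono[OF i0])
      show "dintegrable (\<lambda>y. \<bar>(b y - \<beta>) * f y\<bar> + \<bar>\<beta>\<bar> * \<bar>f y\<bar>)
          J" using i1 i2 by (intro set_integral_add set_integrable_mult_right)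
      fix y
      have "b y * f y = (b y - \<beta>) * f y + \<beta> * f y" by (simp add: algebra_simps)
      then show "\<bar>b y * f y\<bar> \<le> \<bar>(b y - \<beta>) * f y\<bar> + \<bar>\<beta>\<bar> * \<bar>f
          y\<bar>"
        using abs_triangle_ineq[of "(b y - \<beta>) * f y" "\<beta> * f y"] by (simp only: abs_mult)
    qed
    also have "\<dots> = lnorm 1 (\<lambda>y. (b y - \<beta>) * f y) J + \<bar>\<beta>\<bar> * lnorm 1 f J"
      using i1 i2 by (subst avg_add) (auto simp: lnorm_1 avg_cmult)
    also have "\<dots> \<le> 2 * (jn * B * lnorm s f J) + Lp_norm q b * lnorm s f J"
    proof (intro add_mono mult_mono)
      have "lnorm 1 (\<lambda>y. (b y - \<beta>) * f y) J \<le> 2 * (lnorm t (\<lambda>y. b y - \<beta>) J *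
          lnorm s f J)" using m(2)[of J] by simp
      also have "\<dots> \<le> 2 * (jn * B * lnorm s f J)"
        using jnb(2)[of J] unfolding \<beta>_def jn_def by (intro mult_left_mono mult_right_mono) auto
      finally show "lnorm 1 (\<lambda>y. (b y - \<beta>) * f y) J \<le> 2 * (jn * B * lnorm s f J)" .
      show "lnorm 1 f J \<le> lnorm s f J" using s fL by (intro lnorm_mono) auto
    qed (use \<beta> in \<open>auto simp: Lp_norm_def\<close>)
    finally show ?thesis by (simp add: algebra_simps)
  qed
  note le = this
  have B: "0 < B" using b by (simp add: bmo_le_def)
  have "avg (\<lambda>y. \<bar>b y * f y\<bar>) (dyad (- int n) x) \<le> ((Lp_norm q b + 2 * (jn * B)) *
      Lp_norm s f) * (2 powr (- 1 / P)) ^ n" for n x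
  proof -
    have "1 \<le> dlen (dyad (- int n) x)" by (simp add: dlen_dyad)
    from le[OF this] have "avg (\<lambda>y. \<bar>b y * f y\<bar>) (dyad (- int n) x) \<le> (Lp_norm q b + 2 *
        (jn * B)) * lnorm s f (dyad (- int n) x)" .
    also have "\<dots> \<le> (Lp_norm q b + 2 * (jn * B)) * (Lp_norm s f * (2 powr (- 1 / P)) ^ n)"
      using B s by (intro mult_left_mono Lp_decay f) (auto simp: Lp_norm_def jn_def)
    finally show ?thesis by (simp add: mult.assoc)
  qed
  then show ?thesis by blast
qed

text \<open>Both truncated operators need their own limit, since \<open>Top\<close> is 0 by default
  where none exists. For the modified tuple the exponent \<open>s\<close> is taken strictly below
  every \<open>p j\<close>, which leaves room to place \<open>b * f i\<close> in the local space of
  exponent \<open>s\<close>.\<close>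

lemma commutator_Tpart_AE_convergent:
  fixes \<alpha> :: "nat \<Rightarrow> nat"
  assumes k0: "k0 \<in> {1..m}" "\<alpha> k0 = 0" and i: "i \<in> {1..m}" and \<epsilon>: "\<And>I.
      \<bar>\<epsilon> I\<bar> \<le> E"
    and p: "\<And>j. j \<in> {1..m} \<Longrightarrow> 1 < p j" and b: "bmo_le b B" and q: "1 < q" "in_Lp q b"
    and f: "\<And>j. j \<in> {1..m} \<Longrightarrow> in_Lp (p j) (f j)"
  shows "AE x in lborel. convergent (\<lambda>N. Tpart \<epsilon> m \<alpha> f N x)"
    "AE x in lborel. convergent (\<lambda>N. Tpart \<epsilon> m \<alpha> (f(i := (\<lambda>y. b y * f i y))) N x)"
proof -
  define P where "P = (\<Sum>j=1..m. p j)"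
  have pP: "p j \<le> P" if "j \<in> {1..m}" for j
    unfolding P_def using that p by (intro member_le_sum) (auto intro: less_imp_le order_trans[OF zero_le_one])
  have P: "1 < P" using pP[OF i] p[OF i] by simp
  define \<rho> where "\<rho> = (2::real) powr (- 1 / P)"
  have "\<rho> < 2 powr 0" unfolding \<rho>_def using P by (intro powr_less_mono) auto
  then have \<rho>: "0 < \<rho>" "\<rho> < 1" by (auto simp: \<rho>_def)
  define M where "M = Min (insert 2 (p ` {1..m}))"
  define s where "s = (1 + M) / 2"
  have M: "1 < M" unfolding M_def using p by (subst Min_gr_iff) auto
  have M2: "M \<le> 2" unfolding M_def by simp
  have Mp: "M \<le> p j" if "j \<in> {1..m}" for j unfolding M_def using that by (intro Min_le) auto
  have s: "1 < s" "s \<le> 2" using M M2 by (auto simp: s_def)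
  have sp: "s < p j" if "j \<in> {1..m}" for j using Mp[OF that] p[OF that] by (simp add: s_def)
  have fL: "Lloc (p j) (f j)" if "j \<in> {1..m}" for j using Lp_Lloc[OF f[OF that]] .
  have fs: "Lloc s (f j)" if "j \<in> {1..m}" for j using Lloc_mono[OF fL[OF that]] sp[OF that] s by auto
  have dec: "\<exists>K. \<forall>n::nat. \<forall>x. avg (\<lambda>y. \<bar>f j y\<bar>) (dyad (- int n) x)
      \<le> K * \<rho> ^ n" if j: "j \<in> {1..m}" for j
  proof (intro exI[of _ "Lp_norm (p j) (f j)"] allI)
    fix n x
    have "avg (\<lambda>y. \<bar>f j y\<bar>) (dyad (- int n) x) \<le> lnorm (p j) (f j) (dyad (- int n) x)"
      using lnorm_mono[OF fL[OF j], of 1] p[OF j] by (simp add: lnorm_1)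
    also have "\<dots> \<le> Lp_norm (p j) (f j) * \<rho> ^ n"
      unfolding \<rho>_def using p[OF j] pP[OF j] by (intro Lp_decay f j) auto
    finally show "avg (\<lambda>y. \<bar>f j y\<bar>) (dyad (- int n) x) \<le> Lp_norm (p j) (f j) * \<rho> ^ n" .
  qed
  show "AE x in lborel. convergent (\<lambda>N. Tpart \<epsilon> m \<alpha> f N x)"
    by (rule Tpart_AE_convergent[of k0 m \<alpha>, OF k0 \<epsilon> s fs \<rho> dec])
  \<comment> \<open>The gap between \<open>1 / s\<close> and \<open>1 / p i\<close> is exactly the
    integrability demanded of \<open>b\<close>; it is finite, so John-Nirenberg supplies it.\<close>
  define t where "t = 1 / (1 / s - 1 / p i)"
  have "1 / p i < 1 / s" using sp[OF i] s by (simp add: frac_less2)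
  moreover have "1 / s < 1" "0 < 1 / p i" using s p[OF i] by auto
  ultimately have t: "1 < t" unfolding t_def by (subst less_divide_eq_1) linarith
  have st: "1 / s = 1 / t + 1 / p i" by (simp add: t_def)
  have "Lloc t b" using john_nirenberg(1)[OF less_imp_le[OF t] b, of 0] by simp
  then have bfs: "Lloc s (\<lambda>y. b y * f i y)" using s t p[OF i] fL[OF i] by (intro lnorm_mult(1)[OF _ _ _
      st]) auto
  have bdec: "\<exists>K. \<forall>n::nat. \<forall>x. avg (\<lambda>y. \<bar>b y * f i y\<bar>) (dyad (- int
      n) x) \<le> K * \<rho> ^ n"
    unfolding \<rho>_def by (rule bmo_mult_decay[OF b q p[OF i] pP[OF i] f[OF i]])
  show "AE x in lborel. convergent (\<lambda>N. Tpart \<epsilon> m \<alpha> (f(i := (\<lambda>y. b y * f i y))) N x)"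
  proof (rule Tpart_AE_convergent[of k0 m \<alpha>, OF k0 \<epsilon> s _ \<rho>])
    fix j assume j: "j \<in> {1..m}"
    show "Lloc s ((f(i := (\<lambda>y. b y * f i y))) j)" using fs[OF j] bfs by simp
    show "\<exists>K. \<forall>n::nat. \<forall>x. avg (\<lambda>y. \<bar>(f(i := (\<lambda>y. b y * f i y))) j
        y\<bar>) (dyad (- int n) x) \<le> K * \<rho> ^ n"
      using dec[OF j] bdec by (cases "j = i") auto
  qed
qed

theorem theorem4p2:
  fixes m i :: nat and \<alpha> :: "nat \<Rightarrow> nat" and \<epsilon> :: "int \<times> int \<Rightarrow> real"
    and p :: "nat \<Rightarrow> real" and r :: real
  assumes "m \<ge> 2"
    and "\<forall>j\<in>{1..m}. \<alpha> j \<in> {0, 1}"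
    and "\<exists>j\<in>{1..m}. \<alpha> j = 0"
    and "1 \<le> i" and "i \<le> m"
    and "bdd_above (range (\<lambda>I. \<bar>\<epsilon> I\<bar>))"
    and "\<forall>j\<in>{1..m}. 1 < p j" and "1 < r"
    and "(\<Sum>j=1..m. 1 / p j) = 1 / r"
  shows "\<exists>C. \<forall>b q f. in_BMOd b \<and> 1 < q \<and> in_Lp q b \<and> (\<forall>j\<in>{1..m}.
      in_Lp (p j) (f j)) \<longrightarrow>
           in_Lp r (commut b \<epsilon> m \<alpha> i f) \<and>
           Lp_norm r (commut b \<epsilon> m \<alpha> i f) \<le> C * bmo_norm b * (\<Prod>j=1..m. Lp_norm (p j) (f j))"
proof -
  obtain E where E: "\<And>I. \<bar>\<epsilon> I\<bar> \<le> E" using assms(6) by (auto simp: bdd_above_def)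
  obtain k0 where k0: "k0 \<in> {1..m}" "\<alpha> k0 = 0" using assms(3) by auto
  have i: "i \<in> {1..m}" using assms(4,5) by auto
  have p: "\<And>j. j \<in> {1..m} \<Longrightarrow> 1 < p j" using assms(7) by auto
  note r = assms(8)
  obtain C where C: "0 \<le> C" and dual: "\<And>b B f g N. bmo_le b B \<Longrightarrow>
      (\<forall>j\<in>{1..m}. in_Lp (p j) (f j)) \<Longrightarrow> in_Lp (r / (r - 1)) g \<Longrightarrow>
    \<bar>\<integral>x. (Tpart \<epsilon> m \<alpha> (f(i := (\<lambda>y. b y * f i y))) N x - b x * Tpart
        \<epsilon> m \<alpha> f N x) * g x \<partial>lborel\<bar>
      \<le> C * B * ((\<Prod>j=1..m. Lp_norm (p j) (f j)) * Lp_norm (r / (r - 1)) g)"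
    using commut_part_dual[of m k0 \<alpha> i \<epsilon> E p r, OF assms(1) k0 i E p r assms(9)] by blast
  show ?thesis
  proof (intro exI[of _ C] allI impI)
    fix b q f
    assume h: "in_BMOd b \<and> 1 < q \<and> in_Lp q b \<and> (\<forall>j\<in>{1..m}. in_Lp (p j) (f j))"
    then have bmo: "in_BMOd b" and q: "1 < q" "in_Lp q b" and f: "\<forall>j\<in>{1..m}. in_Lp (p j) (f j)" by auto
    define W where "W = (\<Prod>j=1..m. Lp_norm (p j) (f j))"
    have W: "0 \<le> W" unfolding W_def by (intro prod_nonneg) (auto simp: Lp_norm_def)
    define f' where "f' = f(i := (\<lambda>y. b y * f i y))"
    define F where "F N x = Tpart \<epsilon> m \<alpha> f' N x - b x * Tpart \<epsilon> m \<alpha> f N x" for N x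
    have bm [measurable]: "b \<in> borel_measurable borel" using bmo by (simp add: in_BMOd_def)
    have Fm [measurable]: "F N \<in> borel_measurable borel" for N unfolding F_def by measurable
    have cm [measurable]: "commut b \<epsilon> m \<alpha> i f \<in> borel_measurable borel"
      unfolding commut_def by measurable
    \<comment> \<open>The cut-offs grow with \<open>N\<close>, so wherever \<open>F N x\<close>
      converges the indicator is eventually 1, and Fatou's lemma loses nothing in the limit.\<close>
    define G where "G N x = indicator {x. \<bar>F N x\<bar> \<le> real N \<and> x \<in> {- (2 ^ N)..<2 ^ N}} x
        * \<bar>F N x\<bar> powr r" for N x
    have B0: "bmo_norm b < bmo_norm b + 1" by simp
    note conv = commutator_Tpart_AE_convergent[of k0 m \<alpha> i \<epsilon> E p b _ q f, OF k0 i E _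
        in_BMOd_bmo_le(2)[OF bmo B0] q]
    have c1: "AE x in lborel. convergent (\<lambda>N. Tpart \<epsilon> m \<alpha> f N x)"
      and c2: "AE x in lborel. convergent (\<lambda>N. Tpart \<epsilon> m \<alpha> (f(i := (\<lambda>y. b y * f
          i y))) N x)"
      by (rule conv; use p f in blast)+
    have lim: "AE x in lborel. (\<lambda>N. G N x) \<longlonglongrightarrow> \<bar>commut b \<epsilon> m
        \<alpha> i f x\<bar> powr r"
      using c1 c2
    proof eventually_elim
      case (elim x)
      have "(\<lambda>N. F N x) \<longlonglongrightarrow> commut b \<epsilon> m \<alpha> i f x"
        unfolding F_def commut_def Top_def f'_def using elim
        by (auto intro!: tendsto_intros simp: convergent_LIMSEQ_iff)
      then have 1: "(\<lambda>N. \<bar>F N x\<bar>) \<longlonglongrightarrow> \<bar>commut b \<epsilon> m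
          \<alpha> i f x\<bar>" by (rule tendsto_rabs)
      then have 2: "(\<lambda>N. \<bar>F N x\<bar> powr r) \<longlonglongrightarrow> \<bar>commut b \<epsilon>
          m \<alpha> i f x\<bar> powr r"
        using r by (intro tendsto_powr' tendsto_const) auto
      have e1: "eventually (\<lambda>N. \<bar>F N x\<bar> < \<bar>commut b \<epsilon> m \<alpha> i f x\<bar> +
          1) sequentially"
        using 1 by (intro order_tendstoD(2)) auto
      have e2: "eventually (\<lambda>N. \<bar>commut b \<epsilon> m \<alpha> i f x\<bar> + 1 \<le> real N)
          sequentially"
        using filterlim_real_sequentially by (simp add: filterlim_at_top)
      have e3: "eventually (\<lambda>N. \<bar>x\<bar> < 2 ^ N) sequentially"
      proof -
        obtain N0 :: nat where "\<bar>x\<bar> < 2 ^ N0" using real_arch_pow[of 2 "\<bar>x\<bar>"] by auto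
        moreover have "(2::real) ^ N0 \<le> 2 ^ N" if "N0 \<le> N" for N using that by (intro power_increasing) auto
        ultimately show ?thesis unfolding eventually_sequentially by (meson less_le_trans)
      qed
      have "eventually (\<lambda>N. \<bar>F N x\<bar> powr r = G N x) sequentially"
        using e1 e2 e3 by eventually_elim (auto simp: G_def indicator_def)
      then show ?case using 2 by (rule Lim_transform_eventually[rotated])
    qed
    have bound: "integrable lborel (\<lambda>x. \<bar>commut b \<epsilon> m \<alpha> i f x\<bar> powr r) \<and>
        Lp_norm r (commut b \<epsilon> m \<alpha> i f) \<le> C * B * W" if B: "bmo_norm b < B" for B
    proof -
      have bB: "bmo_le b B" using in_BMOd_bmo_le(2)[OF bmo B] .
      define X where "X = C * B * W"
      have X: "0 \<le> X" using C W in_BMOd_bmo_le(1)[OF bmo] B by (simp add: X_def)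
      have d: "\<bar>\<integral>x. F N x * g x \<partial>lborel\<bar> \<le> X * Lp_norm (r / (r - 1)) g" if
          "in_Lp (r / (r - 1)) g" for g N
        using dual[OF bB f that, of N] unfolding F_def f'_def X_def W_def by (simp add: mult.assoc)
      have Gi: "integrable lborel (G N)" "(\<integral>x. G N x \<partial>lborel) \<le> X powr r" for N
        using truncated_Lr_bound[OF r Fm X d, of N "real N" "2 ^ N"] unfolding G_def by auto
      have G0: "0 \<le> G N x" for N x by (simp add: G_def)
      have "(\<lambda>x. \<bar>commut b \<epsilon> m \<alpha> i f x\<bar> powr r) \<in> borel_measurable
          lborel" by simp
      note fat = fatou_real[OF Gi(1) G0 Gi(2) lim this]
      have "Lp_norm r (commut b \<epsilon> m \<alpha> i f) \<le> (X powr r) powr (1 / r)"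
        unfolding Lp_norm_def using fat(2) r by (intro powr_mono2) auto
      also have "\<dots> = X" using r X by (simp add: powr_powr)
      finally show ?thesis using fat(1) by (simp add: X_def)
    qed
    have "in_Lp r (commut b \<epsilon> m \<alpha> i f)"
      unfolding in_Lp_def using bound[OF B0] by simp
    moreover have "Lp_norm r (commut b \<epsilon> m \<alpha> i f) \<le> C * bmo_norm b * W"
    proof -
      \<comment> \<open>The bound holds for every \<open>B\<close> above the norm with the same
        \<open>C\<close>; letting \<open>B\<close> decrease to \<open>bmo_norm b\<close> also covers
        a symbol of norm 0.\<close>
      have ev: "eventually (\<lambda>B. Lp_norm r (commut b \<epsilon> m \<alpha> i f) \<le> C * B * W)
          (at_right (bmo_norm b))"
        using bound by (intro eventually_at_right_less[THEN eventually_mono]) auto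
      have "((\<lambda>B. C * B * W) \<longlongrightarrow> C * bmo_norm b * W) (at_right (bmo_norm b))"
        by (intro tendsto_intros)
      from tendsto_lowerbound[OF this ev] show ?thesis by simp
    qed
    ultimately show "in_Lp r (commut b \<epsilon> m \<alpha> i f) \<and>
           Lp_norm r (commut b \<epsilon> m \<alpha> i f) \<le> C * bmo_norm b * (\<Prod>j=1..m. Lp_norm (p j) (f j))"
      by (simp add: W_def)
  qed
qed

end
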